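(* Let $T_1,\ldots ,T_n$ be commuting contractions on a complex Hilbert space $\mathcal{H}$ such that their product $T=\prod_{i=1}^nT_i$ is a $C_{\cdot 0}$ contraction. Then $(T_1,\ldots ,T_n)$ possesses an isometric dilation $(V_1,\ldots ,V_n)$ with $V=\prod_{i=1}^nV_i$ being a minimal isometric dilation of $T$ if and only if there are unique orthogonal projections $P_1,\ldots ,P_n$ and unique commuting unitaries $U_1,\ldots ,U_n$ in $\mathcal{B}(\mathcal{D}_{T^*})$ with $\prod_{i=1}^n U_i=I$ such that the following conditions hold for all $i,j\in\{1, \dots , n\}$: (1) $D_{T^*}T_i^*=P_i^{\perp}U_i^*D_{T^*}+P_iU_i^*D_{T^*}T^*$, (2) $P_i^{\perp}U_i^*P_j^{\perp}U_j^*=P_j^{\perp}U_j^*P_i^{\perp}U_i^*$, (3) $U_iP_iU_jP_j=U_jP_jU_iP_i$, (4) $P_1+U_1^*P_2U_1+U_1^*U_2^*P_3U_2U_1+\ldots +U_1^*U_2^*\ldots U_{n-1}^*P_nU_{n-1}\ldots U_2U_1 =I_{\mathcal{D}_{T^*}}$.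
   Context: All operators are bounded operators on complex Hilbert spaces. A contraction is an operator of norm at most $1$. A contraction $T$ is a $C_{\cdot 0}$ contraction if ${T^*}^k\to 0$ strongly as $k\to\infty$. For a contraction $T$ on $\mathcal H$, $D_{T^*}=(I-TT^* )^{1/2}$ and $\mathcal D_{T^*}=\overline{\mathrm{Ran}}\,D_{T^*}$. For an orthogonal projection $P$, $P^\perp=I-P$. A commuting tuple of isometries $(V_1,\dots,V_n)$ on a Hilbert space $\mathcal K$ is an isometric dilation of a commuting tuple of contractions $(T_1,\dots,T_n)$ on $\mathcal H$ if $\mathcal H$ is (identified with) a closed subspace of $\mathcal K$ and $T_1^{k_1}\cdots T_n^{k_n}=P_{\mathcal H}(V_1^{k_1}\cdots V_n^{k_n})|_{\mathcal H}$ for all non-negative integers $k_1,\dots,k_n$, where $P_{\mathcal H}:\mathcal K\to\mathcal H$ is the orthogonal projection. An isometric dilation $V$ on $\mathcal K$ of a single contraction $T$ is minimal if $\mathcal K=\overline{\mathrm{Span}}\{V^{k}h: h\in\mathcal H,\ k\in\mathbb N\cup\{0\}\}$. *)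

theory Defs
  imports "HOL-Analysis.Analysis" "HOL-Library.FuncSet"
begin

section \<open>Complex Hilbert spaces\<close>

text \<open>Norm, metric and completeness are inherited from \<^class>\<open>banach\<close>. The inner product is linear
  in the first and antilinear in the second argument.\<close>

class chilbert_space = banach +
  fixes scaleC :: "complex \<Rightarrow> 'a \<Rightarrow> 'a" (infixr "*\<^sub>C" 75)
    and cinner :: "'a \<Rightarrow> 'a \<Rightarrow> complex"
  assumes scaleC_add_right: "a *\<^sub>C (x + y) = a *\<^sub>C x + a *\<^sub>C y"
    and scaleC_add_left: "(a + b) *\<^sub>C x = a *\<^sub>C x + b *\<^sub>C x"
    and scaleC_scaleC: "a *\<^sub>C b *\<^sub>C x = (a * b) *\<^sub>C x"
    and scaleC_one: "1 *\<^sub>C x = x"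
    and scaleR_scaleC: "r *\<^sub>R x = complex_of_real r *\<^sub>C x"
    and cinner_add_left: "cinner (x + y) z = cinner x z + cinner y z"
    and cinner_scaleC_left: "cinner (a *\<^sub>C x) y = a * cinner x y"
    and cinner_commute: "cinner y x = cnj (cinner x y)"
    and cinner_self: "cinner x x = complex_of_real ((norm x)\<^sup>2)"

global_interpretation cvec: vector_space "scaleC :: complex \<Rightarrow> 'a \<Rightarrow> 'a::chilbert_space"
  defines csubspace = cvec.subspace and cspan = cvec.span
  by unfold_locales (simp_all add: scaleC_add_right scaleC_add_left scaleC_scaleC scaleC_one)

instantiation complex :: chilbert_space
begin
definition scaleC_complex :: "complex \<Rightarrow> complex \<Rightarrow> complex" where "scaleC_complex a z = a * z"
definition cinner_complex :: "complex \<Rightarrow> complex \<Rightarrow> complex" where "cinner_complex z w = z * cnj w"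
instance
proof
  show "cinner z z = complex_of_real ((norm z)\<^sup>2)" for z :: complex
    by (simp add: cinner_complex_def complex_norm_square[symmetric])
qed (simp_all add: scaleC_complex_def cinner_complex_def algebra_simps scaleR_conv_of_real)
end


section \<open>Bounded operators on closed subspaces\<close>

text \<open>An operator on a closed subspace \<open>S\<close> of a Hilbert space is a function that is extensional on
  \<open>S\<close>, i.e. it has the value \<^term>\<open>undefined\<close> outside \<open>S\<close>. So two operators on \<open>S\<close> are equal as soon as
  they agree on \<open>S\<close>, and \<open>\<exists>!\<close> has its usual meaning. For \<open>S = UNIV\<close> there is no restriction.\<close>

definition bop :: "'a::chilbert_space set \<Rightarrow> ('a \<Rightarrow> 'a) set" where
  "bop S = {A \<in> S \<rightarrow>\<^sub>E S.
     (\<forall>x\<in>S. \<forall>y\<in>S. A (x + y) = A x + A y) \<and>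
     (\<forall>a. \<forall>x\<in>S. A (a *\<^sub>C x) = a *\<^sub>C A x) \<and>
     (\<exists>C. \<forall>x\<in>S. norm (A x) \<le> C * norm x)}"

definition adj :: "'a::chilbert_space set \<Rightarrow> ('a \<Rightarrow> 'a) \<Rightarrow> 'a \<Rightarrow> 'a" where
  "adj S A = (\<lambda>y\<in>S. THE z. z \<in> S \<and> (\<forall>x\<in>S. cinner (A x) y = cinner x z))"

definition perp :: "'a::chilbert_space set \<Rightarrow> ('a \<Rightarrow> 'a) \<Rightarrow> 'a \<Rightarrow> 'a" where
  "perp S P = (\<lambda>x\<in>S. x - P x)"

definition projections :: "'a::chilbert_space set \<Rightarrow> ('a \<Rightarrow> 'a) set" where
  "projections S = {P \<in> bop S. adj S P = P \<and> (\<forall>x\<in>S. P (P x) = P x)}"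

definition unitaries :: "'a::chilbert_space set \<Rightarrow> ('a \<Rightarrow> 'a) set" where
  "unitaries S = {U \<in> bop S. \<forall>x\<in>S. adj S U (U x) = x \<and> U (adj S U x) = x}"

definition isometries :: "'a::chilbert_space set \<Rightarrow> ('a \<Rightarrow> 'a) set" where
  "isometries S = {V \<in> bop S. \<forall>x\<in>S. norm (V x) = norm x}"

definition commuting :: "'a set \<Rightarrow> nat \<Rightarrow> (nat \<Rightarrow> 'a \<Rightarrow> 'a) \<Rightarrow> bool" where
  "commuting S n A \<longleftrightarrow> (\<forall>i\<in>{1..n}. \<forall>j\<in>{1..n}. \<forall>x\<in>S. A i (A j x) = A j (A i x))"

text \<open>\<open>oprod A [i, j, \<dots>, k]\<close> is the composition of \<open>A i\<close>, \<open>A j\<close>, \dots, \<open>A k\<close>, where \<open>A k\<close> is applied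
  first. In particular the product of \<open>A 1\<close>, \dots, \<open>A n\<close> is \<open>oprod A [1..<Suc n]\<close>.\<close>

definition oprod :: "(nat \<Rightarrow> 'a \<Rightarrow> 'a) \<Rightarrow> nat list \<Rightarrow> 'a \<Rightarrow> 'a" where
  "oprod A is = foldr (\<lambda>i f. A i \<circ> f) is id"

definition positive_sqrt :: "('a::chilbert_space \<Rightarrow> 'a) \<Rightarrow> 'a \<Rightarrow> 'a" where
  "positive_sqrt A = (THE B. B \<in> bop UNIV \<and>
     (\<forall>x. Im (cinner (B x) x) = 0 \<and> Re (cinner (B x) x) \<ge> 0) \<and> (\<forall>x. B (B x) = A x))"

text \<open>Orthogonal projection of the ambient space onto the closed subspace \<open>M\<close>.\<close>

definition proj_onto :: "'a::chilbert_space set \<Rightarrow> 'a \<Rightarrow> 'a" where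
  "proj_onto M x = (THE y. y \<in> M \<and> (\<forall>z\<in>M. cinner (x - y) z = 0))"


section \<open>Contractions, defect operators and dilations\<close>

definition contraction :: "('a::chilbert_space \<Rightarrow> 'a) \<Rightarrow> bool" where
  "contraction T \<longleftrightarrow> T \<in> bop UNIV \<and> onorm T \<le> 1"

definition C_dot_zero :: "('a::chilbert_space \<Rightarrow> 'a) \<Rightarrow> bool" where
  "C_dot_zero T \<longleftrightarrow> contraction T \<and> (\<forall>x. (\<lambda>k. (adj UNIV T ^^ k) x) \<longlonglongrightarrow> 0)"

text \<open>The operator \<open>D\<^bsub>T\<^sup>*\<^esub> = (I - T T\<^sup>*)\<^bsup>1/2\<^esup>\<close> and the closure of its range.\<close>

definition defect_star :: "('a::chilbert_space \<Rightarrow> 'a) \<Rightarrow> 'a \<Rightarrow> 'a" where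
  "defect_star T = positive_sqrt (\<lambda>x. x - T (adj UNIV T x))"

definition defect_space_star :: "('a::chilbert_space \<Rightarrow> 'a) \<Rightarrow> 'a set" where
  "defect_space_star T = closure (range (defect_star T))"

text \<open>The dilation space is a closed subspace \<open>K\<close> of some ambient Hilbert space, and \<open>J\<close> is the
  isometry which identifies the original space with the closed subspace \<open>range J\<close> of \<open>K\<close>.\<close>

definition isometric_dilation ::
  "'k::chilbert_space set \<Rightarrow> ('a::chilbert_space \<Rightarrow> 'k) \<Rightarrow> nat \<Rightarrow>
    (nat \<Rightarrow> 'k \<Rightarrow> 'k) \<Rightarrow> (nat \<Rightarrow> 'a \<Rightarrow> 'a) \<Rightarrow> bool" where
  "isometric_dilation K J n V T \<longleftrightarrow>
     csubspace K \<and> closed K \<and>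
     Vector_Spaces.linear scaleC scaleC J \<and> (\<forall>h. norm (J h) = norm h) \<and> range J \<subseteq> K \<and>
     (\<forall>i\<in>{1..n}. V i \<in> isometries K) \<and> commuting K n V \<and>
     (\<forall>k :: nat \<Rightarrow> nat. \<forall>h.
        J (oprod (\<lambda>i. T i ^^ k i) [1..<Suc n] h) =
        proj_onto (range J) (oprod (\<lambda>i. V i ^^ k i) [1..<Suc n] (J h)))"

definition minimal_isometric_dilation ::
  "'k::chilbert_space set \<Rightarrow> ('a::chilbert_space \<Rightarrow> 'k) \<Rightarrow> ('k \<Rightarrow> 'k) \<Rightarrow> ('a \<Rightarrow> 'a) \<Rightarrow> bool" where
  "minimal_isometric_dilation K J V T \<longleftrightarrow>
     isometric_dilation K J 1 (\<lambda>_. V) (\<lambda>_. T) \<and>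
     K = closure (cspan {(V ^^ k) (J h) | k h. True})"

text \<open>HOL cannot quantify existentially over types. The type argument fixes the ambient space, and
  ``there is a Hilbert space \<open>K\<close>\<dots>'' is expressed as follows: if it is a hypothesis, the ambient
  type is an arbitrary type variable; if it is a conclusion, the ambient type is the concrete Hilbert
  space \<open>'a ell2\<close> of square-summable sequences, defined below.\<close>

definition has_minimal_product_dilation ::
  "'k::chilbert_space itself \<Rightarrow> nat \<Rightarrow> (nat \<Rightarrow> 'a::chilbert_space \<Rightarrow> 'a) \<Rightarrow> bool" where
  "has_minimal_product_dilation _ n T \<longleftrightarrow>
     (\<exists>(K :: 'k set) J V. isometric_dilation K J n V T \<and>
        minimal_isometric_dilation K J (restrict (oprod V [1..<Suc n]) K) (oprod T [1..<Suc n]))"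

text \<open>Uniqueness of the projections and of the unitaries is uniqueness of the pair \<open>(P, U)\<close>, so the
  families are extensional on \<open>{1..n}\<close>. Identities between operators on \<open>E\<close> are stated pointwise.\<close>

definition dilation_data ::
  "nat \<Rightarrow> (nat \<Rightarrow> 'a::chilbert_space \<Rightarrow> 'a) \<Rightarrow> (nat \<Rightarrow> 'a \<Rightarrow> 'a) \<Rightarrow> (nat \<Rightarrow> 'a \<Rightarrow> 'a) \<Rightarrow> bool" where
  "dilation_data n Ts P U \<longleftrightarrow>
    (let T = oprod Ts [1..<Suc n];
         D = defect_star T;
         E = defect_space_star T;
         Us = (\<lambda>i. adj E (U i));
         Pp = (\<lambda>i. perp E (P i))
     in
      P \<in> {1..n} \<rightarrow>\<^sub>E projections E \<and>
      U \<in> {1..n} \<rightarrow>\<^sub>E unitaries E \<and>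
      commuting E n U \<and>
      (\<forall>x\<in>E. oprod U [1..<Suc n] x = x) \<and>
      (\<forall>i\<in>{1..n}. \<forall>h. D (adj UNIV (Ts i) h) =
          Pp i (Us i (D h)) + P i (Us i (D (adj UNIV T h)))) \<and>
      (\<forall>i\<in>{1..n}. \<forall>j\<in>{1..n}. \<forall>x\<in>E.
          Pp i (Us i (Pp j (Us j x))) = Pp j (Us j (Pp i (Us i x)))) \<and>
      (\<forall>i\<in>{1..n}. \<forall>j\<in>{1..n}. \<forall>x\<in>E.
          U i (P i (U j (P j x))) = U j (P j (U i (P i x)))) \<and>
      (\<forall>x\<in>E. (\<Sum>m=1..n. oprod Us [1..<m] (P m (oprod U (rev [1..<m]) x))) = x))"


section \<open>Square-summable sequences in a Hilbert space\<close>

lemma cinner_add_right: "cinner x (y + z) = cinner x y + cinner x (z::'a::chilbert_space)"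
  by (metis cinner_add_left cinner_commute complex_cnj_add)

lemma cinner_scaleC_right: "cinner x (a *\<^sub>C y) = cnj a * cinner x (y::'a::chilbert_space)"
  by (metis cinner_scaleC_left cinner_commute complex_cnj_mult)

lemma scaleC_minus_one: "(- 1) *\<^sub>C x = - (x::'a::chilbert_space)"
  using scaleR_scaleC[of "-1" x] by simp

lemma norm_scaleC: "norm (a *\<^sub>C x) = cmod a * norm (x::'a::chilbert_space)"
proof -
  have "complex_of_real ((norm (a *\<^sub>C x))\<^sup>2) = cinner (a *\<^sub>C x) (a *\<^sub>C x)"
    by (simp add: cinner_self)
  also have "\<dots> = (a * cnj a) * cinner x x"
    by (simp add: cinner_scaleC_left cinner_scaleC_right)
  also have "\<dots> = complex_of_real ((cmod a * norm x)\<^sup>2)"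
    by (simp add: cinner_self complex_norm_square[symmetric] power_mult_distrib)
  finally have "(norm (a *\<^sub>C x))\<^sup>2 = (cmod a * norm x)\<^sup>2"
    using of_real_eq_iff by blast
  then show ?thesis by (simp add: power2_eq_iff_nonneg)
qed

lemma cmod_cinner_le: "2 * cmod (cinner x y) \<le> (norm x)\<^sup>2 + (norm (y::'a::chilbert_space))\<^sup>2"
proof -
  obtain u where u: "cmod u = 1" "u * cinner x y = complex_of_real (cmod (cinner x y))"
  proof (cases "cinner x y = 0")
    case False
    define c where "c = cinner x y"
    have c: "c \<noteq> 0" using False by (simp add: c_def)
    have "cnj c / of_real (cmod c) * c = of_real (cmod c)"
      using c complex_norm_square[of c] by (simp add: field_simps power2_eq_square)
    moreover have "cmod (cnj c / of_real (cmod c)) = 1"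
      using c by (simp add: norm_divide)
    ultimately show ?thesis
      using that c_def by blast
  qed (auto intro: that[of 1])
  define w where "w = u *\<^sub>C x"
  have w: "norm w = norm x" "cinner w y = complex_of_real (cmod (cinner x y))"
    by (simp_all add: w_def norm_scaleC u cinner_scaleC_left)
  have "complex_of_real ((norm (w - y))\<^sup>2) = cinner (w + (-1) *\<^sub>C y) (w + (-1) *\<^sub>C y)"
    by (simp add: scaleC_minus_one cinner_self)
  also have "\<dots> = cinner w w + cinner y y - cinner w y - cinner y w"
    by (simp only: cinner_add_left cinner_add_right cinner_scaleC_left cinner_scaleC_right) simp
  also have "\<dots> = complex_of_real ((norm x)\<^sup>2 + (norm y)\<^sup>2 - 2 * cmod (cinner x y))"
    using cinner_commute[of y w] by (simp add: cinner_self w)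
  finally have "(norm (w - y))\<^sup>2 = (norm x)\<^sup>2 + (norm y)\<^sup>2 - 2 * cmod (cinner x y)"
    using of_real_eq_iff by blast
  then show ?thesis
    by (metis diff_ge_0_iff_ge zero_le_power2)
qed

typedef (overloaded) ('a::chilbert_space) ell2 = "{f :: nat \<Rightarrow> 'a. summable (\<lambda>i. (norm (f i))\<^sup>2)}"
  by (rule exI[of _ "\<lambda>_. 0"]) simp

setup_lifting type_definition_ell2

lemma square_summable_add:
  fixes f g :: "nat \<Rightarrow> 'a::real_normed_vector"
  assumes "summable (\<lambda>i. (norm (f i))\<^sup>2)" "summable (\<lambda>i. (norm (g i))\<^sup>2)"
  shows "summable (\<lambda>i. (norm (f i + g i))\<^sup>2)"
proof (rule summable_comparison_test')
  show "summable (\<lambda>i. 2 * (norm (f i))\<^sup>2 + 2 * (norm (g i))\<^sup>2)"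
    by (intro summable_add summable_mult assms)
  fix i :: nat assume "i \<ge> 0"
  have "(norm (f i + g i))\<^sup>2 \<le> (norm (f i) + norm (g i))\<^sup>2"
    by (intro power_mono norm_triangle_ineq) simp
  also have "\<dots> \<le> 2 * (norm (f i))\<^sup>2 + 2 * (norm (g i))\<^sup>2"
    using sum_squares_ge_zero[of "norm (f i) - norm (g i)" 0]
    by (simp add: power2_eq_square algebra_simps)
  finally show "norm ((norm (f i + g i))\<^sup>2) \<le> 2 * (norm (f i))\<^sup>2 + 2 * (norm (g i))\<^sup>2" by simp
qed

lemma square_summable_scaleC:
  fixes f :: "nat \<Rightarrow> 'a::chilbert_space"
  assumes "summable (\<lambda>i. (norm (f i))\<^sup>2)"
  shows "summable (\<lambda>i. (norm (a *\<^sub>C f i))\<^sup>2)"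
  by (simp add: norm_scaleC power_mult_distrib summable_mult assms)

lemma square_summable_cinner:
  fixes f g :: "nat \<Rightarrow> 'a::chilbert_space"
  assumes "summable (\<lambda>i. (norm (f i))\<^sup>2)" "summable (\<lambda>i. (norm (g i))\<^sup>2)"
  shows "summable (\<lambda>i. cinner (f i) (g i))"
proof (rule summable_comparison_test')
  show "summable (\<lambda>i. (norm (f i))\<^sup>2 + (norm (g i))\<^sup>2)"
    by (intro summable_add assms)
  fix i :: nat assume "i \<ge> 0"
  show "norm (cinner (f i) (g i)) \<le> (norm (f i))\<^sup>2 + (norm (g i))\<^sup>2"
    using cmod_cinner_le[of "f i" "g i"] norm_ge_zero[of "cinner (f i) (g i)"] by linarith
qed

lemma ell2_triangle:
  fixes f g :: "nat \<Rightarrow> 'a::real_normed_vector"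
  assumes f: "summable (\<lambda>i. (norm (f i))\<^sup>2)" and g: "summable (\<lambda>i. (norm (g i))\<^sup>2)"
  shows "sqrt (\<Sum>i. (norm (f i + g i))\<^sup>2) \<le> sqrt (\<Sum>i. (norm (f i))\<^sup>2) + sqrt (\<Sum>i. (norm (g i))\<^sup>2)"
proof (rule LIMSEQ_le_const2)
  show "(\<lambda>N. sqrt (\<Sum>i<N. (norm (f i + g i))\<^sup>2)) \<longlonglongrightarrow> sqrt (\<Sum>i. (norm (f i + g i))\<^sup>2)"
    by (intro tendsto_real_sqrt summable_LIMSEQ square_summable_add f g)
  show "\<exists>N. \<forall>n\<ge>N. sqrt (\<Sum>i<n. (norm (f i + g i))\<^sup>2)
      \<le> sqrt (\<Sum>i. (norm (f i))\<^sup>2) + sqrt (\<Sum>i. (norm (g i))\<^sup>2)"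
  proof (intro exI allI impI)
    fix n :: nat
    have "sqrt (\<Sum>i<n. (norm (f i + g i))\<^sup>2) \<le> L2_set (\<lambda>i. norm (f i) + norm (g i)) {..<n}"
      unfolding L2_set_def
      by (intro real_sqrt_le_mono sum_mono power_mono norm_triangle_ineq) simp
    also have "\<dots> \<le> L2_set (\<lambda>i. norm (f i)) {..<n} + L2_set (\<lambda>i. norm (g i)) {..<n}"
      by (rule L2_set_triangle_ineq)
    also have "\<dots> \<le> sqrt (\<Sum>i. (norm (f i))\<^sup>2) + sqrt (\<Sum>i. (norm (g i))\<^sup>2)"
      unfolding L2_set_def by (intro add_mono real_sqrt_le_mono sum_le_suminf f g) auto
    finally show "sqrt (\<Sum>i<n. (norm (f i + g i))\<^sup>2)
      \<le> sqrt (\<Sum>i. (norm (f i))\<^sup>2) + sqrt (\<Sum>i. (norm (g i))\<^sup>2)" .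
  qed
qed

instantiation ell2 :: (chilbert_space) real_normed_vector
begin

lift_definition zero_ell2 :: "'a ell2" is "\<lambda>_. 0" by simp
lift_definition plus_ell2 :: "'a ell2 \<Rightarrow> 'a ell2 \<Rightarrow> 'a ell2" is "\<lambda>f g i. f i + g i"
  by (rule square_summable_add)
lift_definition uminus_ell2 :: "'a ell2 \<Rightarrow> 'a ell2" is "\<lambda>f i. - f i" by simp
lift_definition minus_ell2 :: "'a ell2 \<Rightarrow> 'a ell2 \<Rightarrow> 'a ell2" is "\<lambda>f g i. f i - g i"
  using square_summable_add[of _ "\<lambda>i. - _ i"] by simp
lift_definition scaleR_ell2 :: "real \<Rightarrow> 'a ell2 \<Rightarrow> 'a ell2" is "\<lambda>r f i. r *\<^sub>R f i"
  by (simp add: power_mult_distrib summable_mult)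
lift_definition norm_ell2 :: "'a ell2 \<Rightarrow> real" is "\<lambda>f. sqrt (\<Sum>i. (norm (f i))\<^sup>2)" .

definition sgn_ell2 :: "'a ell2 \<Rightarrow> 'a ell2" where "sgn_ell2 x = inverse (norm x) *\<^sub>R x"
definition dist_ell2 :: "'a ell2 \<Rightarrow> 'a ell2 \<Rightarrow> real" where "dist_ell2 x y = norm (x - y)"
definition uniformity_ell2 :: "('a ell2 \<times> 'a ell2) filter" where
  "uniformity_ell2 = (INF e\<in>{0<..}. principal {(x, y). dist x y < e})"
definition open_ell2 :: "'a ell2 set \<Rightarrow> bool" where
  "open_ell2 U = (\<forall>x\<in>U. eventually (\<lambda>(x', y). x' = x \<longrightarrow> y \<in> U) uniformity)"

instance
proof
  fix x y z :: "'a ell2" and a b :: real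
  show "x + y + z = x + (y + z)" "x + y = y + x" "0 + x = x" "- x + x = 0" "x - y = x + - y"
    "a *\<^sub>R (x + y) = a *\<^sub>R x + a *\<^sub>R y" "(a + b) *\<^sub>R x = a *\<^sub>R x + b *\<^sub>R x"
    "a *\<^sub>R b *\<^sub>R x = (a * b) *\<^sub>R x" "1 *\<^sub>R x = x"
    by (transfer; simp add: algebra_simps)+
  show "norm x = 0 \<longleftrightarrow> x = 0"
    by transfer (auto simp: suminf_eq_zero_iff)
  show "norm (x + y) \<le> norm x + norm y"
    by transfer (rule ell2_triangle)
  show "norm (a *\<^sub>R x) = \<bar>a\<bar> * norm x"
    by transfer (simp add: power_mult_distrib suminf_mult real_sqrt_mult)
qed (rule dist_ell2_def sgn_ell2_def uniformity_ell2_def open_ell2_def)+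

end

lemma norm_Rep_ell2_le: "norm (Rep_ell2 x i) \<le> norm (x :: 'a::chilbert_space ell2)"
proof transfer
  fix x :: "nat \<Rightarrow> 'a" and i assume x: "summable (\<lambda>i. (norm (x i))\<^sup>2)"
  have "(norm (x i))\<^sup>2 \<le> (\<Sum>j. (norm (x j))\<^sup>2)"
    using sum_le_suminf[OF x, of "{i}"] by simp
  then show "norm (x i) \<le> sqrt (\<Sum>j. (norm (x j))\<^sup>2)"
    by (simp add: real_le_rsqrt)
qed

lemma Rep_ell2_diff: "Rep_ell2 (x - y) i = Rep_ell2 x i - Rep_ell2 y i"
  by transfer simp

instance ell2 :: (chilbert_space) banach
proof
  fix X :: "nat \<Rightarrow> 'a ell2"
  assume X: "Cauchy X"
  have "\<exists>l. (\<lambda>m. Rep_ell2 (X m) i) \<longlonglongrightarrow> l" for i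
  proof -
    have "Cauchy (\<lambda>m. Rep_ell2 (X m) i)"
    proof (rule CauchyI)
      fix e :: real assume "e > 0"
      then obtain M where "\<forall>m\<ge>M. \<forall>n\<ge>M. norm (X m - X n) < e"
        using CauchyD[OF X] by blast
      then show "\<exists>M. \<forall>m\<ge>M. \<forall>n\<ge>M. norm (Rep_ell2 (X m) i - Rep_ell2 (X n) i) < e"
        by (metis Rep_ell2_diff norm_Rep_ell2_le order_le_less_trans)
    qed
    then show ?thesis
      by (simp add: Cauchy_convergent_iff convergent_def)
  qed
  then obtain l where l: "\<And>i. (\<lambda>m. Rep_ell2 (X m) i) \<longlonglongrightarrow> l i" by metis
  have tail: "\<exists>M. \<forall>m\<ge>M. \<forall>N. (\<Sum>i<N. (norm (Rep_ell2 (X m) i - l i))\<^sup>2) \<le> e\<^sup>2" if "e > 0" for e :: real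
  proof -
    obtain M where M: "\<forall>m\<ge>M. \<forall>n\<ge>M. norm (X m - X n) < e"
      using CauchyD[OF X \<open>e > 0\<close>] by blast
    have "(\<Sum>i<N. (norm (Rep_ell2 (X m) i - l i))\<^sup>2) \<le> e\<^sup>2" if "m \<ge> M" for m N
    proof (rule LIMSEQ_le_const2)
      show "(\<lambda>n. \<Sum>i<N. (norm (Rep_ell2 (X m) i - Rep_ell2 (X n) i))\<^sup>2)
          \<longlonglongrightarrow> (\<Sum>i<N. (norm (Rep_ell2 (X m) i - l i))\<^sup>2)"
        by (intro tendsto_intros l)
      show "\<exists>K. \<forall>n\<ge>K. (\<Sum>i<N. (norm (Rep_ell2 (X m) i - Rep_ell2 (X n) i))\<^sup>2) \<le> e\<^sup>2"
      proof (intro exI allI impI)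
        fix n assume "n \<ge> M"
        have s: "summable (\<lambda>i. (norm (Rep_ell2 (X m - X n) i))\<^sup>2)"
          using Rep_ell2[of "X m - X n"] by simp
        have "(\<Sum>i<N. (norm (Rep_ell2 (X m - X n) i))\<^sup>2) \<le> (norm (X m - X n))\<^sup>2"
          using sum_le_suminf[OF s, of "{..<N}"] suminf_nonneg[OF s] by (simp add: norm_ell2.rep_eq)
        also have "\<dots> \<le> e\<^sup>2"
          using M \<open>m \<ge> M\<close> \<open>n \<ge> M\<close> by (intro power_mono) (auto intro: less_imp_le)
        finally show "(\<Sum>i<N. (norm (Rep_ell2 (X m) i - Rep_ell2 (X n) i))\<^sup>2) \<le> e\<^sup>2"
          by (simp add: Rep_ell2_diff)
      qed
    qed
    then show ?thesis by blast
  qed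
  have sm: "summable (\<lambda>i. (norm (l i))\<^sup>2)"
  proof -
    obtain m where m: "\<And>N. (\<Sum>i<N. (norm (Rep_ell2 (X m) i - l i))\<^sup>2) \<le> 1\<^sup>2"
      using tail[of 1] by auto
    have "summable (\<lambda>i. (norm (l i - Rep_ell2 (X m) i))\<^sup>2)"
      using m by (intro bounded_imp_summable[where B = 1])
        (auto simp: norm_minus_commute lessThan_Suc_atMost[symmetric] simp del: sum.lessThan_Suc)
    moreover have "summable (\<lambda>i. (norm (Rep_ell2 (X m) i))\<^sup>2)"
      using Rep_ell2[of "X m"] by simp
    ultimately show ?thesis
      using square_summable_add by fastforce
  qed
  define L where "L = Abs_ell2 l"
  have L: "Rep_ell2 L = l"
    using sm by (simp add: L_def Abs_ell2_inverse)
  have "X \<longlonglongrightarrow> L"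
  proof (rule LIMSEQ_I)
    fix e :: real assume "e > 0"
    then obtain M where M: "\<forall>m\<ge>M. \<forall>N. (\<Sum>i<N. (norm (Rep_ell2 (X m) i - l i))\<^sup>2) \<le> (e/2)\<^sup>2"
      using tail[of "e/2"] by auto
    have "norm (X m - L) < e" if "m \<ge> M" for m
    proof -
      have "summable (\<lambda>i. (norm (Rep_ell2 (X m - L) i))\<^sup>2)"
        using Rep_ell2[of "X m - L"] by simp
      then have "(\<Sum>i. (norm (Rep_ell2 (X m - L) i))\<^sup>2) \<le> (e/2)\<^sup>2"
        using M that by (intro suminf_le_const) (auto simp: Rep_ell2_diff L)
      then have "norm (X m - L) \<le> e/2"
        using \<open>e > 0\<close> real_sqrt_le_mono[of _ "(e/2)\<^sup>2"] by (simp add: norm_ell2.rep_eq del: real_sqrt_le_iff)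
      then show ?thesis using \<open>e > 0\<close> by simp
    qed
    then show "\<exists>M. \<forall>m\<ge>M. norm (X m - L) < e" by blast
  qed
  then show "convergent X" by (auto simp: convergent_def)
qed

instantiation ell2 :: (chilbert_space) chilbert_space
begin

lift_definition scaleC_ell2 :: "complex \<Rightarrow> 'a ell2 \<Rightarrow> 'a ell2" is "\<lambda>a f i. a *\<^sub>C f i"
  by (rule square_summable_scaleC)
lift_definition cinner_ell2 :: "'a ell2 \<Rightarrow> 'a ell2 \<Rightarrow> complex" is "\<lambda>f g. \<Sum>i. cinner (f i) (g i)" .

instance
proof
  fix x y z :: "'a ell2" and a b :: complex and r :: real
  show "a *\<^sub>C (x + y) = a *\<^sub>C x + a *\<^sub>C y" by transfer (simp add: scaleC_add_right)
  show "(a + b) *\<^sub>C x = a *\<^sub>C x + b *\<^sub>C x" by transfer (simp add: scaleC_add_left)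
  show "a *\<^sub>C b *\<^sub>C x = (a * b) *\<^sub>C x" by transfer (simp add: scaleC_scaleC)
  show "1 *\<^sub>C x = x" by transfer (simp add: scaleC_one)
  show "r *\<^sub>R x = complex_of_real r *\<^sub>C x" by transfer (simp add: scaleR_scaleC)
  show "cinner (x + y) z = cinner x z + cinner y z"
    by transfer (simp add: cinner_add_left suminf_add square_summable_cinner)
  show "cinner (a *\<^sub>C x) y = a * cinner x y"
    by transfer (simp add: cinner_scaleC_left suminf_mult square_summable_cinner)
  show "cinner y x = cnj (cinner x y)"
  proof transfer
    fix y x :: "nat \<Rightarrow> 'a"
    assume "summable (\<lambda>i. (norm (y i))\<^sup>2)" "summable (\<lambda>i. (norm (x i))\<^sup>2)"
    then have "(\<lambda>i. cinner (x i) (y i)) sums (\<Sum>i. cinner (x i) (y i))"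
      by (intro summable_sums square_summable_cinner)
    then have "(\<lambda>i. cnj (cinner (x i) (y i))) sums cnj (\<Sum>i. cinner (x i) (y i))"
      by (simp only: sums_cnj)
    moreover have "(\<lambda>i. cnj (cinner (x i) (y i))) = (\<lambda>i. cinner (y i) (x i))"
      by (simp add: cinner_commute[symmetric])
    ultimately show "(\<Sum>i. cinner (y i) (x i)) = cnj (\<Sum>i. cinner (x i) (y i))"
      by (simp add: sums_iff)
  qed
  show "cinner x x = complex_of_real ((norm x)\<^sup>2)"
    by transfer (simp add: cinner_self suminf_nonneg suminf_of_real del: of_real_power)
qed

end

end

theory Submission
  imports Defs
begin

text \<open>
  Write \<open>D\<close> for the defect operator of \<open>T\<^sup>*\<close>, \<open>E\<close> for the closure of its range and \<open>V\<close> for the product of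
  the isometries \<open>V\<^sub>i\<close>. Because \<open>T\<close> is \<open>C\<^sub>\<cdot>\<^sub>0\<close>, its minimal isometric dilation is multiplication by \<open>z\<close>
  on the \<open>E\<close>-valued square-summable power series, with \<open>h\<close> embedded as \<open>\<Sum>\<^sub>k z\<^sup>k D T\<^sup>*\<^sup>k h\<close>. An isometry that
  is a factor of multiplication by \<open>z\<close> and commutes with it is multiplication by a linear pencil
  \<open>A + z B\<close>, as in the theorem of Berger, Coburn and Lebow. With the complementary factor, which has the pencil \<open>B\<^sup>* + z A\<^sup>*\<close>, one gets
  \<open>A\<^sup>* A + B\<^sup>* B = I = A A\<^sup>* + B B\<^sup>*\<close> and \<open>A\<^sup>* B = 0 = B A\<^sup>*\<close>. So \<open>U = A + B\<close> is unitary,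
  \<open>P = B\<^sup>* B\<close> is a projection, and the pencil is \<open>U (P\<^sup>\<bottom> + z P)\<close>.

  Given a dilation, the pencils of the \<open>V\<^sub>i\<close> are read off on the wandering subspace \<open>ker V\<^sup>*\<close>, which is
  a copy of \<open>E\<close>. The identity for \<open>D T\<^sub>i\<^sup>*\<close> says that the embedded copy of the original space is
  invariant under \<open>V\<^sub>i\<^sup>*\<close>, and the two commutation relations compare the extreme coefficients of the
  commuting pencils. That the unitaries have product \<open>I\<close> and the conjugated projections have sum \<open>I\<close>
  means that the product of the pencils is \<open>z I\<close>: its value at \<open>1\<close> is \<open>U\<^sub>n \<dots> U\<^sub>1\<close>, and its derivative
  at \<open>1\<close> is \<open>U\<^sub>n \<dots> U\<^sub>1\<close> times the sum of the conjugated projections.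
  These are \<open>AB_identities\<close>, \<open>D_adj_T\<close>, \<open>AB_commute\<close> and \<open>product_expansion\<close> below.

  Given the projections and unitaries, the pencils define the \<open>V\<^sub>i\<close> on power series. The
  conjugated projections have sum \<open>I\<close>, hence are mutually orthogonal, and so the product of the pencils
  collapses to \<open>z I\<close> (\<open>Rep_partial_product\<close>).

  For uniqueness, every choice of data gives a dilation on power series, and there the matrix
  coefficients of \<open>A\<^sub>i\<close> and \<open>B\<^sub>i\<close> between vectors \<open>D h\<close> are expressed by \<open>T\<^sub>1, \<dots>, T\<^sub>n\<close> alone
  (\<open>A_determined\<close>, \<open>B_determined\<close>); and \<open>A\<^sub>i\<close>, \<open>B\<^sub>i\<close> determine \<open>U\<^sub>i = A\<^sub>i + B\<^sub>i\<close> and \<open>P\<^sub>i = U\<^sub>i\<^sup>* B\<^sub>i\<close>.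
\<close>

section \<open>Inner products and bounded operators on closed subspaces\<close>

lemma cinner_Cauchy_Schwarz: "cmod (cinner x y) \<le> norm x * norm (y::'a::chilbert_space)"
proof (cases "x = 0 \<or> y = 0")
  case True
  moreover have "cinner 0 y = 0" "cinner x 0 = 0"
    using cinner_scaleC_left[of 0 x y] cinner_scaleC_right[of x 0 y] by simp_all
  ultimately show ?thesis by auto
next
  case False
  define a b where "a = complex_of_real (inverse (norm x))" and "b = complex_of_real (inverse (norm y))"
  have "norm (a *\<^sub>C x) = 1" "norm (b *\<^sub>C y) = 1"
    using False by (simp_all add: norm_scaleC a_def b_def norm_inverse)
  then have "cmod (cinner (a *\<^sub>C x) (b *\<^sub>C y)) \<le> 1"
    using cmod_cinner_le[of "a *\<^sub>C x" "b *\<^sub>C y"] by simp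
  then have "inverse (norm x) * inverse (norm y) * cmod (cinner x y) \<le> 1"
    by (simp add: cinner_scaleC_left cinner_scaleC_right norm_mult a_def b_def norm_inverse mult_ac)
  then show ?thesis using False by (simp add: field_simps)
qed

lemma bounded_bilinear_cinner: "bounded_bilinear (cinner :: 'a::chilbert_space \<Rightarrow> _)"
proof (rule bounded_bilinear.intro)
  show "\<exists>K. \<forall>a b :: 'a. cmod (cinner a b) \<le> norm a * norm b * K"
    by (intro exI[of _ 1]) (simp add: cinner_Cauchy_Schwarz)
qed (simp_all add: cinner_add_left cinner_add_right scaleR_scaleC cinner_scaleC_left
    cinner_scaleC_right scaleC_complex_def)

lemmas cinner_diff_left = bounded_bilinear.diff_left[OF bounded_bilinear_cinner]
  and cinner_diff_right = bounded_bilinear.diff_right[OF bounded_bilinear_cinner]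
  and cinner_zero_left [simp] = bounded_bilinear.zero_left[OF bounded_bilinear_cinner]
  and cinner_zero_right [simp] = bounded_bilinear.zero_right[OF bounded_bilinear_cinner]
  and cinner_sum_left = bounded_bilinear.sum_left[OF bounded_bilinear_cinner]
  and tendsto_cinner = bounded_bilinear.tendsto[OF bounded_bilinear_cinner]

lemmas cinner_linear_simps = cinner_add_left cinner_add_right cinner_diff_left cinner_diff_right
  cinner_scaleC_left cinner_scaleC_right

lemma cinner_self_eq_0 [simp]: "cinner x x = 0 \<longleftrightarrow> x = (0::'a::chilbert_space)"
  by (simp add: cinner_self)

lemma cinner_eq_0_commute: "cinner x y = 0 \<longleftrightarrow> cinner y (x::'a::chilbert_space) = 0"
  by (metis cinner_commute complex_cnj_zero)

lemma norm_squared_Re_cinner: "(norm (x::'a::chilbert_space))\<^sup>2 = Re (cinner x x)"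
  by (simp add: cinner_self del: of_real_power)

lemma norm_add_squared:
  "(norm (x + y))\<^sup>2 = (norm x)\<^sup>2 + (norm y)\<^sup>2 + 2 * Re (cinner x (y::'a::chilbert_space))"
proof -
  have "Re (cinner y x) = Re (cinner x y)"
    using cinner_commute[of y x] by simp
  then show ?thesis
    unfolding norm_squared_Re_cinner by (simp add: cinner_linear_simps)
qed

lemma norm_diff_squared:
  "(norm (x - y))\<^sup>2 = (norm x)\<^sup>2 + (norm y)\<^sup>2 - 2 * Re (cinner x (y::'a::chilbert_space))"
proof -
  have "Re (cinner y x) = Re (cinner x y)"
    using cinner_commute[of y x] by simp
  then show ?thesis
    unfolding norm_squared_Re_cinner by (simp add: cinner_linear_simps)
qed

lemma norm_add_squared_orthogonal:
  "cinner x y = 0 \<Longrightarrow> (norm (x + y))\<^sup>2 = (norm x)\<^sup>2 + (norm (y::'a::chilbert_space))\<^sup>2"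
  by (simp add: norm_add_squared)

definition closed_csubspace :: "'a::chilbert_space set \<Rightarrow> bool" where
  "closed_csubspace S \<longleftrightarrow> csubspace S \<and> closed S"

lemma closed_csubspace_UNIV [simp]: "closed_csubspace UNIV"
  by (simp add: closed_csubspace_def)

lemma closed_csubspaceD:
  assumes "closed_csubspace S"
  shows "0 \<in> S" "x \<in> S \<Longrightarrow> y \<in> S \<Longrightarrow> x + y \<in> S" "x \<in> S \<Longrightarrow> a *\<^sub>C x \<in> S"
    "x \<in> S \<Longrightarrow> y \<in> S \<Longrightarrow> x - y \<in> S" "x \<in> S \<Longrightarrow> - x \<in> S"
    "(\<And>i. i \<in> I \<Longrightarrow> g i \<in> S) \<Longrightarrow> (\<Sum>i\<in>I. g i) \<in> S" "closed S"
  using assms unfolding closed_csubspace_def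
  by (auto intro: cvec.subspace_0 cvec.subspace_add cvec.subspace_scale cvec.subspace_diff
      cvec.subspace_neg cvec.subspace_sum)

lemma scaleC_diff_right: "a *\<^sub>C (x - y) = a *\<^sub>C x - a *\<^sub>C (y::'a::chilbert_space)"
  by (rule cvec.scale_right_diff_distrib)

lemma tendsto_scaleC: "(f \<longlongrightarrow> x) F \<Longrightarrow> ((\<lambda>n. a *\<^sub>C f n) \<longlongrightarrow> a *\<^sub>C (x::'a::chilbert_space)) F"
proof -
  have "bounded_linear ((*\<^sub>C) a :: 'a \<Rightarrow> 'a)"
    by (rule bounded_linear_intro[where K = "cmod a"])
      (simp_all add: scaleC_add_right scaleR_scaleC scaleC_scaleC mult.commute norm_scaleC)
  then show "(f \<longlongrightarrow> x) F \<Longrightarrow> ((\<lambda>n. a *\<^sub>C f n) \<longlongrightarrow> a *\<^sub>C x) F"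
    by (rule bounded_linear.tendsto)
qed

lemma bopI:
  assumes "\<And>x. x \<in> S \<Longrightarrow> A x \<in> S" "A \<in> extensional S"
    "\<And>x y. x \<in> S \<Longrightarrow> y \<in> S \<Longrightarrow> A (x + y) = A x + A y"
    "\<And>a x. x \<in> S \<Longrightarrow> A (a *\<^sub>C x) = a *\<^sub>C A x"
    "\<And>x. x \<in> S \<Longrightarrow> norm (A x) \<le> C * norm x"
  shows "A \<in> bop S"
  using assms unfolding bop_def PiE_def by blast

lemma bopD:
  assumes "A \<in> bop S"
  shows "x \<in> S \<Longrightarrow> A x \<in> S" "A \<in> extensional S"
    "x \<in> S \<Longrightarrow> y \<in> S \<Longrightarrow> A (x + y) = A x + A y"
    "x \<in> S \<Longrightarrow> A (a *\<^sub>C x) = a *\<^sub>C A x"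
  using assms by (auto simp: bop_def PiE_def)

lemma bop_bound:
  assumes "A \<in> bop S"
  obtains C where "C > 0" "\<And>x. x \<in> S \<Longrightarrow> norm (A x) \<le> C * norm x"
proof -
  obtain C where C: "\<And>x. x \<in> S \<Longrightarrow> norm (A x) \<le> C * norm x"
    using assms unfolding bop_def by blast
  show ?thesis
  proof (rule that[of "\<bar>C\<bar> + 1"])
    show "norm (A x) \<le> (\<bar>C\<bar> + 1) * norm x" if "x \<in> S" for x
      by (rule order_trans[OF C[OF that]]) (simp add: mult_right_mono)
  qed simp
qed

lemma bop_diff:
  assumes "A \<in> bop S" "closed_csubspace S" "x \<in> S" "y \<in> S"
  shows "A (x - y) = A x - A y"
proof -
  have "A (x + (-1) *\<^sub>C y) = A x + (-1) *\<^sub>C A y"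
    using assms by (simp only: bopD(3,4)[OF assms(1)] closed_csubspaceD[OF assms(2)])
  then show ?thesis by simp
qed

lemma bop_0: "A \<in> bop S \<Longrightarrow> closed_csubspace S \<Longrightarrow> A 0 = 0"
  using bop_diff[of A S 0 0] by (simp add: closed_csubspaceD)

lemma bop_sum:
  assumes "A \<in> bop S" "closed_csubspace S" "\<And>i. i \<in> I \<Longrightarrow> g i \<in> S"
  shows "A (\<Sum>i\<in>I. g i) = (\<Sum>i\<in>I. A (g i))"
  using assms(3)
  by (induction I rule: infinite_finite_induct)
    (auto simp: bop_0[OF assms(1,2)] bopD(3)[OF assms(1)] closed_csubspaceD[OF assms(2)])

lemma bop_tendsto:
  assumes A: "A \<in> bop S" and S: "closed_csubspace S" and x: "\<And>n. x n \<in> S" and lim: "x \<longlonglongrightarrow> l"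
  shows "l \<in> S" "(\<lambda>n. A (x n)) \<longlonglongrightarrow> A l"
proof -
  show l: "l \<in> S"
    using closed_sequentially[OF closed_csubspaceD(7)[OF S]] x lim by blast
  obtain C where C: "\<And>x. x \<in> S \<Longrightarrow> norm (A x) \<le> C * norm x"
    using bop_bound[OF A] by blast
  have "(\<lambda>n. C * norm (x n - l)) \<longlonglongrightarrow> C * norm (l - l)"
    by (intro tendsto_intros lim)
  then have "(\<lambda>n. C * norm (x n - l)) \<longlonglongrightarrow> 0" by simp
  then have "(\<lambda>n. A (x n) - A l) \<longlonglongrightarrow> 0"
    by (rule Lim_null_comparison[rotated])
      (use C x l in \<open>simp add: bop_diff[OF A S, symmetric] closed_csubspaceD[OF S]\<close>)
  then show "(\<lambda>n. A (x n)) \<longlonglongrightarrow> A l"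
    by (rule LIM_zero_cancel)
qed

lemma bop_eqI:
  assumes "A \<in> extensional S" "B \<in> extensional S" "\<And>x. x \<in> S \<Longrightarrow> A x = B x"
  shows "A = B"
  using assms by (rule extensionalityI)

lemma cinner_right_ext:
  assumes "closed_csubspace S" "x \<in> S" "y \<in> S" "\<And>z. z \<in> S \<Longrightarrow> cinner z x = cinner z y"
  shows "x = (y::'a::chilbert_space)"
proof -
  have "cinner (x - y) (x - y) = 0"
    using assms by (simp add: cinner_diff_right closed_csubspaceD)
  then show ?thesis by simp
qed

lemma cinner_left_ext:
  assumes "closed_csubspace S" "x \<in> S" "y \<in> S" "\<And>z. z \<in> S \<Longrightarrow> cinner x z = cinner y z"
  shows "x = (y::'a::chilbert_space)"
  by (rule cinner_right_ext[OF assms(1-3)]) (metis assms(4) cinner_commute)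

text \<open>By polarization, a linear map that preserves norms preserves inner products.\<close>

lemma isometry_cinner:
  assumes S: "closed_csubspace S" "x \<in> S" "y \<in> S"
    and V: "\<And>x y. x \<in> S \<Longrightarrow> y \<in> S \<Longrightarrow> V (x + y) = V x + V y"
    "\<And>a x. x \<in> S \<Longrightarrow> V (a *\<^sub>C x) = a *\<^sub>C V x" "\<And>x. x \<in> S \<Longrightarrow> norm (V x) = norm x"
  shows "cinner (V x) (V y) = cinner x (y :: 'a::chilbert_space)"
proof -
  have Re: "Re (cinner (V x) (V y)) = Re (cinner x y)" if "x \<in> S" "y \<in> S" for x y
  proof -
    have "norm (V x + V y) = norm (x + y)"
      using V(1)[OF that] V(3)[OF closed_csubspaceD(2)[OF S(1) that]] by simp
    then show ?thesis
      using norm_add_squared[of "V x" "V y"] norm_add_squared[of x y] that by (simp add: V(3))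
  qed
  have "Re (cinner (V (\<i> *\<^sub>C x)) (V y)) = Re (cinner (\<i> *\<^sub>C x) y)"
    by (intro Re closed_csubspaceD(3) S)
  then have "Im (cinner (V x) (V y)) = Im (cinner x y)"
    by (simp add: V S cinner_scaleC_left)
  with Re[OF S(2,3)] show ?thesis by (simp add: complex_eq_iff)
qed


section \<open>Orthogonal projection, Riesz representation and adjoints\<close>

text \<open>A minimizing sequence for the distance from \<open>x\<close> to \<open>S\<close> is Cauchy by the parallelogram law,
  and the minimizer is the foot of the perpendicular.\<close>

lemma orthogonal_projection_exists:
  assumes S: "closed_csubspace S"
  shows "\<exists>y\<in>S. \<forall>z\<in>S. cinner (x - y) z = 0"
proof -
  define d where "d = (INF y\<in>S. (norm (x - y))\<^sup>2)"
  have bdd: "bdd_below ((\<lambda>y. (norm (x - y))\<^sup>2) ` S)"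
    by (rule bdd_belowI2[of _ 0]) simp
  have d_le: "d \<le> (norm (x - y))\<^sup>2" if "y \<in> S" for y
    unfolding d_def using bdd that by (rule cINF_lower)
  have "\<exists>y\<in>S. (norm (x - y))\<^sup>2 < d + e" if "e > 0" for e
    using that bdd cINF_less_iff[of S "\<lambda>y. (norm (x - y))\<^sup>2" "d + e"] closed_csubspaceD(1)[OF S]
    unfolding d_def by auto
  then have "\<exists>y\<in>S. (norm (x - y))\<^sup>2 < d + inverse (Suc n)" for n by simp
  then obtain y where y: "\<And>n. y n \<in> S" "\<And>n. (norm (x - y n))\<^sup>2 < d + inverse (Suc n)"
    by metis
  have half: "(1/2::complex) *\<^sub>C v + (1/2::complex) *\<^sub>C v = v" for v :: 'a
    by (simp add: scaleC_add_left[symmetric] scaleC_one)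
  \<comment> \<open>the parallelogram law, with the midpoint of \<open>u\<close> and \<open>v\<close> at distance at least \<open>\<surd>d\<close> from \<open>x\<close>\<close>
  have par: "(norm (u - v))\<^sup>2 \<le> 2 * (norm (x - u))\<^sup>2 + 2 * (norm (x - v))\<^sup>2 - 4 * d"
    if "u \<in> S" "v \<in> S" for u v
  proof -
    define m where "m = (1/2::complex) *\<^sub>C (u + v)"
    have "m \<in> S" using that by (simp add: m_def closed_csubspaceD[OF S])
    have "m + m = u + v" unfolding m_def by (rule half)
    then have eq: "(x - u) + (x - v) = (x - m) + (x - m)" by (simp add: algebra_simps)
    have "(norm ((x - u) + (x - v)))\<^sup>2 = 4 * (norm (x - m))\<^sup>2"
      unfolding eq using norm_add_squared[of "x - m" "x - m"] norm_squared_Re_cinner[of "x - m"] by simp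
    moreover have "(norm (u - v))\<^sup>2 = (norm ((x - u) - (x - v)))\<^sup>2"
      by (simp add: norm_minus_commute)
    ultimately show ?thesis
      using d_le[OF \<open>m \<in> S\<close>] norm_add_squared[of "x - u" "x - v"] norm_diff_squared[of "x - u" "x - v"]
      by simp
  qed
  have "Cauchy y"
  proof (rule CauchyI)
    fix e :: real assume "e > 0"
    then obtain N where N: "inverse (Suc N) < e\<^sup>2 / 4"
      using reals_Archimedean[of "e\<^sup>2/4"] by auto
    have "norm (y m - y n) < e" if "m \<ge> N" "n \<ge> N" for m n
    proof -
      have "inverse (real (Suc m)) \<le> inverse (Suc N)" "inverse (real (Suc n)) \<le> inverse (Suc N)"
        using that by (simp_all add: field_simps)
      then have "(norm (y m - y n))\<^sup>2 < e\<^sup>2"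
        using par[OF y(1) y(1), of m n] y(2)[of m] y(2)[of n] N by linarith
      then show ?thesis using \<open>e > 0\<close> by (simp add: power_less_imp_less_base)
    qed
    then show "\<exists>M. \<forall>m\<ge>M. \<forall>n\<ge>M. norm (y m - y n) < e" by blast
  qed
  then obtain l where l: "y \<longlonglongrightarrow> l" by (auto simp: Cauchy_convergent_iff convergent_def)
  have lS: "l \<in> S"
    using closed_sequentially[OF closed_csubspaceD(7)[OF S]] y(1) l by blast
  have "(norm (x - l))\<^sup>2 \<le> d"
  proof (rule LIMSEQ_le)
    show "(\<lambda>n. (norm (x - y n))\<^sup>2) \<longlonglongrightarrow> (norm (x - l))\<^sup>2" by (intro tendsto_intros l)
    show "(\<lambda>n. d + inverse (Suc n)) \<longlonglongrightarrow> d" by (rule LIMSEQ_inverse_real_of_nat_add)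
    show "\<exists>N. \<forall>n\<ge>N. (norm (x - y n))\<^sup>2 \<le> d + inverse (Suc n)"
      using y(2) less_imp_le by blast
  qed
  then have min: "(norm (x - l))\<^sup>2 \<le> (norm (x - l - z))\<^sup>2" if "z \<in> S" for z
  proof -
    have "d \<le> (norm (x - (l + z)))\<^sup>2" using that lS by (intro d_le closed_csubspaceD(2)[OF S])
    with \<open>(norm (x - l))\<^sup>2 \<le> d\<close> show ?thesis by (simp only: diff_diff_eq)
  qed
  have "cinner (x - l) z = 0" if "z \<in> S" for z
  proof (rule ccontr)
    \<comment> \<open>otherwise the multiple \<open>t c z\<close>, the projection of \<open>x - l\<close> to the line of \<open>z\<close>, improves on \<open>l\<close>\<close>
    assume c: "cinner (x - l) z \<noteq> 0"
    define c where "c = cinner (x - l) z"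
    define t where "t = inverse ((norm z)\<^sup>2)"
    have z0: "norm z > 0" using c by auto
    have "(norm (x - l))\<^sup>2 \<le> (norm (x - l - (of_real t * c) *\<^sub>C z))\<^sup>2"
      by (intro min closed_csubspaceD(3)[OF S] that)
    also have "\<dots> = (norm (x - l))\<^sup>2 + (t * cmod c * norm z)\<^sup>2 - 2 * t * (cmod c)\<^sup>2"
    proof -
      have "cinner (x - l) ((of_real t * c) *\<^sub>C z) = of_real (t * (cmod c)\<^sup>2)"
        using complex_norm_square[of c] by (simp add: cinner_scaleC_right c_def[symmetric] mult_ac)
      then have "Re (cinner (x - l) ((of_real t * c) *\<^sub>C z)) = t * (cmod c)\<^sup>2"
        by (simp only: Re_complex_of_real)
      moreover have "norm ((of_real t * c) *\<^sub>C z) = t * cmod c * norm z"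
        using z0 by (simp add: norm_scaleC norm_mult t_def norm_inverse norm_power)
      ultimately show ?thesis by (simp only: norm_diff_squared)
    qed
    also have "(t * cmod c * norm z)\<^sup>2 = t * (cmod c)\<^sup>2"
      using z0 by (simp add: t_def power2_eq_square field_simps)
    finally have "t * (cmod c)\<^sup>2 \<le> 0" by simp
    moreover have "t * (cmod c)\<^sup>2 > 0" using z0 c by (simp add: t_def c_def)
    ultimately show False by simp
  qed
  with lS show ?thesis by blast
qed

lemma orthogonal_projection_unique:
  assumes "closed_csubspace S" "y \<in> S" "\<And>z. z \<in> S \<Longrightarrow> cinner (x - y) z = 0"
    "y' \<in> S" "\<And>z. z \<in> S \<Longrightarrow> cinner (x - y') z = 0"
  shows "y = (y'::'a::chilbert_space)"
proof (rule cinner_left_ext[OF assms(1,2,4)])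
  show "cinner y z = cinner y' z" if "z \<in> S" for z
    using assms(3)[OF that] assms(5)[OF that] by (simp add: cinner_diff_left)
qed

lemma proj_onto_eqI:
  assumes "closed_csubspace S" "y \<in> S" "\<And>z. z \<in> S \<Longrightarrow> cinner (x - y) z = 0"
  shows "proj_onto S x = y"
  unfolding proj_onto_def
proof (rule the_equality)
  show "y \<in> S \<and> (\<forall>z\<in>S. cinner (x - y) z = 0)"
    using assms by blast
  show "y' = y" if "y' \<in> S \<and> (\<forall>z\<in>S. cinner (x - y') z = 0)" for y'
    using orthogonal_projection_unique[OF assms, of y'] that by simp
qed

lemma cinner_proj_onto:
  assumes "closed_csubspace S" "z \<in> S"
  shows "cinner (proj_onto S x) z = cinner x z"
proof -
  obtain y where y: "y \<in> S" "\<And>z. z \<in> S \<Longrightarrow> cinner (x - y) z = 0"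
    using orthogonal_projection_exists[OF assms(1)] by blast
  with proj_onto_eqI[OF assms(1) y] assms show ?thesis by (simp add: cinner_diff_left)
qed

text \<open>The representing vector spans the orthogonal complement of the kernel of the functional.\<close>

lemma Riesz_representation:
  assumes S: "closed_csubspace S"
    and f: "\<And>x y. x \<in> S \<Longrightarrow> y \<in> S \<Longrightarrow> f (x + y) = f x + f y"
    "\<And>a x. x \<in> S \<Longrightarrow> f (a *\<^sub>C x) = a * f x"
    "\<And>x. x \<in> S \<Longrightarrow> cmod (f x) \<le> C * norm x"
  shows "\<exists>z\<in>S. \<forall>x\<in>S. f x = cinner x z"
proof (cases "\<forall>x\<in>S. f x = 0")
  case True
  then show ?thesis using closed_csubspaceD(1)[OF S] by (intro bexI[of _ 0]) auto
next
  case False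
  then obtain x0 where x0: "x0 \<in> S" "f x0 \<noteq> 0" by blast
  have fdiff: "f (x - y) = f x - f y" if "x \<in> S" "y \<in> S" for x y
  proof -
    have "f (x + (-1) *\<^sub>C y) = f x + (-1) * f y"
      using f that by (simp only: closed_csubspaceD(3)[OF S])
    then show ?thesis by (simp add: scaleC_minus_one)
  qed
  define N where "N = {x\<in>S. f x = 0}"
  have "closed_csubspace N"
    unfolding closed_csubspace_def
  proof
    show "csubspace N"
      unfolding N_def using f fdiff[of 0 0] closed_csubspaceD[OF S] by (intro cvec.subspaceI) auto
    show "closed N"
      unfolding closed_sequential_limits
    proof (intro allI impI)
      fix x l assume xl: "(\<forall>n. x n \<in> N) \<and> x \<longlonglongrightarrow> l"
      then have lS: "l \<in> S"
        using closed_sequentially[OF closed_csubspaceD(7)[OF S], of x l] by (auto simp: N_def)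
      have "(\<lambda>n. C * norm (l - x n)) \<longlonglongrightarrow> C * norm (l - l)"
        using xl by (intro tendsto_intros) auto
      moreover have "cmod (f l) \<le> C * norm (l - x n)" for n
        using f(3)[of "l - x n"] xl lS fdiff[of l "x n"] by (auto simp: N_def closed_csubspaceD[OF S])
      ultimately have "cmod (f l) \<le> C * norm (l - l)"
        by (intro LIMSEQ_le_const) auto
      then show "l \<in> N" using lS by (simp add: N_def)
    qed
  qed
  then obtain y where y: "y \<in> N" "\<And>z. z \<in> N \<Longrightarrow> cinner (x0 - y) z = 0"
    using orthogonal_projection_exists by blast
  define u where "u = x0 - y"
  have u: "u \<in> S" "f u \<noteq> 0"
    using x0 y(1) fdiff by (auto simp: u_def N_def closed_csubspaceD[OF S])
  then have u0: "u \<noteq> 0" using fdiff[of 0 0] closed_csubspaceD(1)[OF S] by auto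
  define z where "z = cnj (f u / cinner u u) *\<^sub>C u"
  have "f x = cinner x z" if "x \<in> S" for x
  proof -
    have "x - (f x / f u) *\<^sub>C u \<in> N"
      using that u f fdiff by (simp add: N_def closed_csubspaceD[OF S])
    then have "cinner u (x - (f x / f u) *\<^sub>C u) = 0"
      using y(2) by (simp add: u_def)
    then have "cinner (x - (f x / f u) *\<^sub>C u) u = 0"
      by (simp add: cinner_eq_0_commute)
    then show ?thesis
      using u u0 by (simp add: cinner_linear_simps z_def field_simps)
  qed
  moreover have "z \<in> S" unfolding z_def by (rule closed_csubspaceD(3)[OF S u(1)])
  ultimately show ?thesis by blast
qed

lemma adj_unique:
  assumes S: "closed_csubspace S" and "y \<in> S" "z \<in> S" "\<And>x. x \<in> S \<Longrightarrow> cinner (A x) y = cinner x z"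
  shows "adj S A y = z"
  unfolding adj_def restrict_apply'[OF assms(2)]
proof (rule the_equality)
  show "z \<in> S \<and> (\<forall>x\<in>S. cinner (A x) y = cinner x z)"
    using assms by blast
  show "z' = z" if "z' \<in> S \<and> (\<forall>x\<in>S. cinner (A x) y = cinner x z')" for z'
    by (rule cinner_right_ext[OF S]) (use assms that in simp_all)
qed

lemma adj_props:
  assumes S: "closed_csubspace S" and A: "A \<in> bop S" and y: "y \<in> S"
  shows "adj S A y \<in> S \<and> (\<forall>x\<in>S. cinner (A x) y = cinner x (adj S A y))"
proof -
  obtain C where C: "C > 0" "\<And>x. x \<in> S \<Longrightarrow> norm (A x) \<le> C * norm x"
    using bop_bound[OF A] by blast
  have "\<exists>z\<in>S. \<forall>x\<in>S. cinner (A x) y = cinner x z"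
  proof (rule Riesz_representation[OF S])
    show "cmod (cinner (A x) y) \<le> (C * norm y) * norm x" if "x \<in> S" for x
    proof -
      have "cmod (cinner (A x) y) \<le> norm (A x) * norm y" by (rule cinner_Cauchy_Schwarz)
      also have "\<dots> \<le> (C * norm x) * norm y" by (intro mult_right_mono C that norm_ge_zero)
      finally show ?thesis by (simp add: mult_ac)
    qed
  qed (simp_all add: bopD[OF A] cinner_linear_simps)
  then obtain z where "z \<in> S" "\<forall>x\<in>S. cinner (A x) y = cinner x z" by blast
  with adj_unique[OF S y, of z A] show ?thesis by simp
qed

lemma adj_mem: "closed_csubspace S \<Longrightarrow> A \<in> bop S \<Longrightarrow> y \<in> S \<Longrightarrow> adj S A y \<in> S"
  using adj_props by blast

lemma cinner_adj_right:
  "closed_csubspace S \<Longrightarrow> A \<in> bop S \<Longrightarrow> x \<in> S \<Longrightarrow> y \<in> S \<Longrightarrow> cinner x (adj S A y) = cinner (A x) y"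
  using adj_props by metis

lemma cinner_adj_left:
  "closed_csubspace S \<Longrightarrow> A \<in> bop S \<Longrightarrow> x \<in> S \<Longrightarrow> y \<in> S \<Longrightarrow> cinner (adj S A x) y = cinner x (A y)"
  by (metis cinner_adj_right cinner_commute)

lemma adj_in_bop:
  assumes S: "closed_csubspace S" and A: "A \<in> bop S"
  shows "adj S A \<in> bop S"
proof -
  obtain C where C: "C > 0" "\<And>x. x \<in> S \<Longrightarrow> norm (A x) \<le> C * norm x"
    using bop_bound[OF A] by blast
  note m = adj_mem[OF S A]
  show ?thesis
  proof (rule bopI[where C = C])
    fix x y a assume xy: "x \<in> S" "y \<in> S"
    show "adj S A (x + y) = adj S A x + adj S A y"
      by (rule adj_unique[OF S])
        (simp_all add: xy m closed_csubspaceD[OF S] cinner_add_right cinner_adj_right[OF S A])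
  next
    fix x a assume x: "x \<in> S"
    show "adj S A x \<in> S" by (rule m[OF x])
    show "adj S A (a *\<^sub>C x) = a *\<^sub>C adj S A x"
      by (rule adj_unique[OF S])
        (simp_all add: x m closed_csubspaceD[OF S] cinner_scaleC_right cinner_adj_right[OF S A])
    let ?z = "adj S A x"
    have "(norm ?z)\<^sup>2 = cmod (cinner (A ?z) x)"
      by (simp add: cinner_adj_right[OF S A m[OF x] x, symmetric] cinner_self norm_power)
    also have "\<dots> \<le> norm (A ?z) * norm x" by (rule cinner_Cauchy_Schwarz)
    also have "\<dots> \<le> (C * norm ?z) * norm x" by (rule mult_right_mono[OF C(2)[OF m[OF x]] norm_ge_zero])
    finally have "norm ?z * norm ?z \<le> norm ?z * (C * norm x)" by (simp add: power2_eq_square mult_ac)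
    then show "norm ?z \<le> C * norm x"
      using C by (cases "norm ?z = 0") (auto simp: mult_le_cancel_left)
  qed (simp add: adj_def)
qed

lemma closed_csubspace_orthogonal: "closed_csubspace {y::'a::chilbert_space. cinner x y = 0}"
  unfolding closed_csubspace_def
proof
  show "csubspace {y. cinner x y = 0}"
    by (intro cvec.subspaceI) (auto simp: cinner_linear_simps)
  have "continuous_on UNIV (\<lambda>y. cinner x y)"
    by (rule linear_continuous_on[OF bounded_bilinear.bounded_linear_right[OF bounded_bilinear_cinner]])
  then show "closed {y. cinner x y = 0}"
    by (rule closed_Collect_eq) simp
qed

lemma orthogonal_closure_cspan:
  assumes "\<And>g. g \<in> G \<Longrightarrow> cinner x g = 0" "y \<in> closure (cspan G)"
  shows "cinner x (y::'a::chilbert_space) = 0"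
proof -
  let ?M = "{y. cinner x y = 0}"
  have "cspan G \<subseteq> ?M"
    using closed_csubspace_orthogonal[of x] assms(1)
    by (intro cvec.span_minimal) (auto simp: closed_csubspace_def)
  then have "closure (cspan G) \<subseteq> ?M"
    by (intro closure_minimal closed_csubspaceD closed_csubspace_orthogonal)
  then show ?thesis using assms(2) by blast
qed

lemma orthogonal_closure:
  assumes "\<And>g. g \<in> G \<Longrightarrow> cinner x g = 0" "y \<in> closure G"
  shows "cinner x (y::'a::chilbert_space) = 0"
  using orthogonal_closure_cspan[OF assms(1)] assms(2) closure_mono[OF cvec.span_superset] by blast

lemma closed_csubspace_closure:
  assumes "csubspace M"
  shows "closed_csubspace (closure M)"
  unfolding closed_csubspace_def
proof (intro conjI cvec.subspaceI)
  show "0 \<in> closure M" using cvec.subspace_0[OF assms] closure_subset by blast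
  fix x y :: 'a and a assume "x \<in> closure M" "y \<in> closure M"
  then obtain f g where fg: "\<And>n. f n \<in> M" "f \<longlonglongrightarrow> x" "\<And>n. g n \<in> M" "g \<longlonglongrightarrow> y"
    unfolding closure_sequential by blast
  show "x + y \<in> closure M"
    unfolding closure_sequential
    by (rule exI[of _ "\<lambda>n. f n + g n"]) (use fg assms in \<open>auto intro: tendsto_add cvec.subspace_add\<close>)
next
  fix x :: 'a and a assume "x \<in> closure M"
  then obtain f where fg: "\<And>n. f n \<in> M" "f \<longlonglongrightarrow> x"
    unfolding closure_sequential by blast
  show "a *\<^sub>C x \<in> closure M"
    unfolding closure_sequential
    by (rule exI[of _ "\<lambda>n. a *\<^sub>C f n"])
      (use fg assms in \<open>auto intro: tendsto_scaleC cvec.subspace_scale\<close>)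
qed simp

text \<open>If \<open>y\<close> is the projection of \<open>x \<in> K\<close> to \<open>M\<close>, then \<open>x - y\<close> is a vector of \<open>K\<close> orthogonal to \<open>M\<close>.\<close>

lemma closed_csubspace_eqI:
  assumes M: "closed_csubspace M" and K: "closed_csubspace K" "M \<subseteq> K"
    and "\<And>x. x \<in> K \<Longrightarrow> (\<And>z. z \<in> M \<Longrightarrow> cinner x z = 0) \<Longrightarrow> x = 0"
  shows "M = K"
proof
  show "K \<subseteq> M"
  proof
    fix x assume x: "x \<in> K"
    obtain y where y: "y \<in> M" "\<And>z. z \<in> M \<Longrightarrow> cinner (x - y) z = 0"
      using orthogonal_projection_exists[OF M] by blast
    have "x - y = 0" using assms(4)[of "x - y"] x y K by (auto simp: closed_csubspaceD)
    then show "x \<in> M" using y by simp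
  qed
qed (rule K(2))

lemma csubspace_range:
  fixes D :: "'a::chilbert_space \<Rightarrow> 'b::chilbert_space"
  assumes "\<And>x y. D (x + y) = D x + D y" "\<And>a x. D (a *\<^sub>C x) = a *\<^sub>C D x"
  shows "csubspace (range D)"
proof (rule cvec.subspaceI)
  show "0 \<in> range D" using assms(1)[of 0 0] by (metis add_cancel_left_left rangeI)
  show "x + y \<in> range D" if "x \<in> range D" "y \<in> range D" for x y
    using that by (auto simp: assms[symmetric])
  show "a *\<^sub>C x \<in> range D" if "x \<in> range D" for a x
    using that by (auto simp: assms[symmetric])
qed

text \<open>If \<open>D h\<^sub>n\<close> converges, then \<open>F h\<^sub>n\<close> is Cauchy, since \<open>\<parallel>F h\<parallel> = \<parallel>D h\<parallel>\<close>; its limit depends only on the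
  limit of \<open>D h\<^sub>n\<close>, and this defines the factor \<open>L\<close> of \<open>F\<close> through \<open>D\<close>.\<close>

lemma isometric_factorization:
  fixes D :: "'a::chilbert_space \<Rightarrow> 'b::chilbert_space" and F :: "'a \<Rightarrow> 'c::chilbert_space"
  assumes D: "\<And>x y. D (x + y) = D x + D y" "\<And>a x. D (a *\<^sub>C x) = a *\<^sub>C D x"
    and F: "\<And>x y. F (x + y) = F x + F y" "\<And>a x. F (a *\<^sub>C x) = a *\<^sub>C F x"
    and n: "\<And>x. norm (F x) = norm (D x)"
  shows "\<exists>L. (\<forall>x. L (D x) = F x) \<and> (\<forall>x\<in>closure (range D). \<forall>y\<in>closure (range D). L (x + y) = L x + L y) \<and>
    (\<forall>a. \<forall>x\<in>closure (range D). L (a *\<^sub>C x) = a *\<^sub>C L x) \<and>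
    (\<forall>x\<in>closure (range D). norm (L x) = norm x) \<and> (\<forall>x\<in>closure (range D). L x \<in> closure (range F))"
proof -
  have diff: "D (x - y) = D x - D y" "F (x - y) = F x - F y" for x y
    using D(1)[of "x - y" y] F(1)[of "x - y" y] by simp_all
  have seq: "\<exists>h. (\<lambda>n. D (h n)) \<longlonglongrightarrow> x" if "x \<in> closure (range D)" for x
    using that unfolding closure_sequential
  proof (elim exE conjE)
    fix g :: "nat \<Rightarrow> 'b" assume g: "\<forall>n. g n \<in> range D" "g \<longlonglongrightarrow> x"
    then have "g n = D (inv D (g n))" for n by (simp add: f_inv_into_f)
    then show ?thesis using g(2) by (intro exI[of _ "\<lambda>n. inv D (g n)"]) simp
  qed
  have "\<exists>y. \<forall>h. (\<lambda>n. D (h n)) \<longlonglongrightarrow> x \<longrightarrow> (\<lambda>n. F (h n)) \<longlonglongrightarrow> y" if x: "x \<in> closure (range D)" for x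
  proof -
    obtain k where kx: "(\<lambda>n. D (k n)) \<longlonglongrightarrow> x"
      using seq[OF x] by metis
    then have "Cauchy (\<lambda>n. D (k n))" by (rule LIMSEQ_imp_Cauchy)
    then have "Cauchy (\<lambda>n. F (k n))"
      unfolding Cauchy_iff diff[symmetric] n .
    then obtain y where y: "(\<lambda>n. F (k n)) \<longlonglongrightarrow> y"
      by (auto simp: Cauchy_convergent_iff convergent_def)
    have "(\<lambda>n. F (h n)) \<longlonglongrightarrow> y" if "(\<lambda>n. D (h n)) \<longlonglongrightarrow> x" for h
    proof -
      have "(\<lambda>n. D (h n) - D (k n)) \<longlonglongrightarrow> x - x" by (intro tendsto_diff that kx)
      then have "(\<lambda>n. norm (D (h n) - D (k n))) \<longlonglongrightarrow> 0"
        by (intro tendsto_norm_zero) simp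
      moreover have "norm (D (h m) - D (k m)) = norm (F (h m) - F (k m))" for m
        unfolding diff[symmetric] n ..
      ultimately have "(\<lambda>n. F (h n) - F (k n)) \<longlonglongrightarrow> 0"
        by (intro tendsto_norm_zero_cancel[of "\<lambda>n. F (h n) - F (k n)"]) simp
      from tendsto_add[OF this y] show ?thesis by simp
    qed
    then show ?thesis by (intro exI allI impI)
  qed
  then obtain L where L: "\<And>x h. x \<in> closure (range D) \<Longrightarrow> (\<lambda>n. D (h n)) \<longlonglongrightarrow> x \<Longrightarrow> (\<lambda>n. F (h n)) \<longlonglongrightarrow> L x"
    by metis
  have sub: "csubspace (range D)" by (rule csubspace_range[OF D])
  note C = closed_csubspaceD[OF closed_csubspace_closure[OF sub]]
  show ?thesis
  proof (intro exI[of _ L] conjI allI ballI)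
    fix x show "L (D x) = F x"
      using L[of "D x" "\<lambda>_. x"] closure_subset[of "range D"] LIMSEQ_unique tendsto_const by blast
  next
    fix x y assume xy: "x \<in> closure (range D)" "y \<in> closure (range D)"
    obtain h k where hk: "(\<lambda>n. D (h n)) \<longlonglongrightarrow> x" "(\<lambda>n. D (k n)) \<longlonglongrightarrow> y"
      using seq xy by blast
    have "(\<lambda>n. F (h n + k n)) \<longlonglongrightarrow> L (x + y)"
      by (rule L) (use hk xy C in \<open>auto simp: D intro: tendsto_add\<close>)
    moreover have "(\<lambda>n. F (h n + k n)) \<longlonglongrightarrow> L x + L y"
      unfolding F by (intro tendsto_add L xy hk)
    ultimately show "L (x + y) = L x + L y" by (rule LIMSEQ_unique)
  next
    fix a x assume x: "x \<in> closure (range D)"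
    obtain h where h: "(\<lambda>n. D (h n)) \<longlonglongrightarrow> x"
      using seq x by blast
    have "(\<lambda>n. F (a *\<^sub>C h n)) \<longlonglongrightarrow> L (a *\<^sub>C x)"
      by (rule L) (use h x C in \<open>auto simp: D intro: tendsto_scaleC\<close>)
    moreover have "(\<lambda>n. F (a *\<^sub>C h n)) \<longlonglongrightarrow> a *\<^sub>C L x"
      unfolding F by (intro tendsto_scaleC L x h)
    ultimately show "L (a *\<^sub>C x) = a *\<^sub>C L x" by (rule LIMSEQ_unique)
  next
    fix x assume x: "x \<in> closure (range D)"
    obtain h where h: "(\<lambda>n. D (h n)) \<longlonglongrightarrow> x"
      using seq x by blast
    show "norm (L x) = norm x"
      using tendsto_norm[OF L[OF x h]] tendsto_norm[OF h] unfolding n by (rule LIMSEQ_unique)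
    show "L x \<in> closure (range F)"
      unfolding closure_sequential by (rule exI[of _ "\<lambda>n. F (h n)"]) (simp add: L[OF x h])
  qed
qed


section \<open>The positive square root and the defect operator\<close>

text \<open>For a self-adjoint contraction \<open>B\<close> the iteration \<open>Y \<mapsto> (B + Y\<^sup>2) / 2\<close>, started at \<open>0\<close>, has a limit \<open>Y\<close> with \<open>(I - Y)\<^sup>2 = I - B\<close>.\<close>

primrec sqrt_iter :: "('a::chilbert_space \<Rightarrow> 'a) \<Rightarrow> nat \<Rightarrow> 'a \<Rightarrow> 'a" where
  "sqrt_iter B 0 = (\<lambda>x. 0)"
| "sqrt_iter B (Suc n) = (\<lambda>x. (1/2) *\<^sub>C (B x + sqrt_iter B n (sqrt_iter B n x)))"

text \<open>The case \<open>B = 1\<close> on the line; it majorizes the iteration of every contraction \<open>B\<close>.\<close>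

primrec sqrt_majorant :: "nat \<Rightarrow> real" where
  "sqrt_majorant 0 = 0"
| "sqrt_majorant (Suc n) = (1 + (sqrt_majorant n)\<^sup>2) / 2"

lemma sqrt_majorant_bounds: "0 \<le> sqrt_majorant n" "sqrt_majorant n \<le> 1"
proof -
  show 0: "0 \<le> sqrt_majorant n" for n by (induction n) auto
  show "sqrt_majorant n \<le> 1"
    by (induction n) (auto simp: power_le_one[OF 0])
qed

lemma sqrt_majorant_mono: "sqrt_majorant n \<le> sqrt_majorant (Suc n)"
  using sum_squares_ge_zero[of "1 - sqrt_majorant n" 0] by (simp add: power2_eq_square algebra_simps)

lemma convergent_sqrt_majorant: "convergent sqrt_majorant"
proof (rule Bseq_mono_convergent)
  show "Bseq sqrt_majorant"
    using sqrt_majorant_bounds by (intro BseqI'[of _ 1]) auto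
  show "\<forall>m n. m \<le> n \<longrightarrow> sqrt_majorant m \<le> sqrt_majorant n"
    using sqrt_majorant_mono lift_Suc_mono_le by blast
qed

context
  fixes B :: "'a::chilbert_space \<Rightarrow> 'a"
  assumes B: "B \<in> bop UNIV" and self_adjoint: "\<And>x y. cinner (B x) y = cinner x (B y)"
    and contractive: "\<And>x. norm (B x) \<le> norm x"
begin

lemma sqrt_iter_add: "sqrt_iter B n (x + y) = sqrt_iter B n x + sqrt_iter B n y"
  by (induction n arbitrary: x y) (simp_all add: bopD[OF B] scaleC_add_right)

lemma sqrt_iter_scaleC: "sqrt_iter B n (a *\<^sub>C x) = a *\<^sub>C sqrt_iter B n x"
  by (induction n arbitrary: x)
    (simp_all add: bopD[OF B] scaleC_add_right scaleC_scaleC mult.commute)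

lemma sqrt_iter_self_adjoint: "cinner (sqrt_iter B n x) y = cinner x (sqrt_iter B n y)"
  by (induction n arbitrary: x y) (simp_all add: cinner_linear_simps self_adjoint)

text \<open>In particular the iterates commute with each other and with every square root of \<open>I - B\<close>.\<close>

lemma sqrt_iter_commute:
  assumes "C \<in> bop UNIV" "\<And>x. C (B x) = B (C x)"
  shows "C (sqrt_iter B n x) = sqrt_iter B n (C x)"
  by (induction n arbitrary: x)
    (simp_all add: bop_0[OF assms(1)] bopD(3,4)[OF assms(1)] assms(2))

lemma norm_sqrt_iter: "norm (sqrt_iter B n x) \<le> sqrt_majorant n * norm x"
proof (induction n arbitrary: x)
  case (Suc n)
  have "norm (sqrt_iter B n (sqrt_iter B n x)) \<le> sqrt_majorant n * (sqrt_majorant n * norm x)"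
    using Suc[of "sqrt_iter B n x"] mult_left_mono[OF Suc[of x] sqrt_majorant_bounds(1)[of n]]
    by linarith
  moreover have "norm (sqrt_iter B (Suc n) x) \<le> (norm (B x) + norm (sqrt_iter B n (sqrt_iter B n x))) / 2"
    using norm_triangle_ineq[of "B x"] by (simp add: norm_scaleC)
  ultimately show ?case
    using contractive[of x] by (simp add: power2_eq_square algebra_simps)
qed simp

lemma sqrt_iter_in_bop: "sqrt_iter B n \<in> bop UNIV"
  by (rule bopI[OF _ _ _ _ norm_sqrt_iter]) (simp_all add: sqrt_iter_add sqrt_iter_scaleC)

text \<open>For commuting \<open>Y\<close> and \<open>Z\<close> one has \<open>Z\<^sup>2 - Y\<^sup>2 = (Z - Y) (Z + Y)\<close>, and the majorant satisfies the same
  recursion with equality.\<close>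

lemma sqrt_iter_Suc_diff:
  "norm (sqrt_iter B (Suc n) x - sqrt_iter B n x) \<le> (sqrt_majorant (Suc n) - sqrt_majorant n) * norm x"
proof (induction n arbitrary: x)
  case 0
  show ?case using contractive[of x] by (simp add: norm_scaleC)
next
  case (Suc n)
  let ?Y = "sqrt_iter B n" and ?Z = "sqrt_iter B (Suc n)"
  let ?s = "sqrt_majorant n" and ?t = "sqrt_majorant (Suc n)"
  have "?Y (B u) = B (?Y u)" for u
    by (rule sqrt_iter_commute[OF B, symmetric]) simp
  then have comm: "?Y (?Z u) = ?Z (?Y u)" for u
    by (rule sqrt_iter_commute[OF sqrt_iter_in_bop])
  have "sqrt_iter B (Suc (Suc n)) x - ?Z x = (1/2) *\<^sub>C (?Z (?Z x) - ?Y (?Y x))"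
    by (simp only: sqrt_iter.simps(2)[of B "Suc n"] sqrt_iter.simps(2)[of B n, THEN fun_cong, of x]
        scaleC_diff_right[symmetric]) simp
  also have "?Z (?Z x) - ?Y (?Y x) = (?Z (?Z x) - ?Y (?Z x)) + (?Z (?Y x) - ?Y (?Y x))"
    by (simp add: comm del: sqrt_iter.simps)
  finally have "norm (sqrt_iter B (Suc (Suc n)) x - ?Z x)
      \<le> (norm (?Z (?Z x) - ?Y (?Z x)) + norm (?Z (?Y x) - ?Y (?Y x))) / 2"
    using norm_triangle_ineq[of "?Z (?Z x) - ?Y (?Z x)" "?Z (?Y x) - ?Y (?Y x)"]
    by (simp add: norm_scaleC del: sqrt_iter.simps)
  also have "\<dots> \<le> ((?t - ?s) * norm (?Z x) + (?t - ?s) * norm (?Y x)) / 2"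
    by (intro divide_right_mono add_mono Suc) simp
  also have "\<dots> \<le> ((?t - ?s) * (?t * norm x) + (?t - ?s) * (?s * norm x)) / 2"
    using sqrt_majorant_mono[of n]
    by (intro divide_right_mono add_mono mult_left_mono norm_sqrt_iter) simp_all
  also have "\<dots> = (sqrt_majorant (Suc (Suc n)) - ?t) * norm x"
    by (simp add: sqrt_majorant.simps(2)[of "Suc n"] sqrt_majorant.simps(2)[of n, THEN arg_cong, of "\<lambda>r. _ - r"]
        power2_eq_square algebra_simps del: sqrt_majorant.simps)
      (simp add: field_simps power2_eq_square)
  finally show ?case .
qed

lemma convergent_sqrt_iter: "convergent (\<lambda>n. sqrt_iter B n x)"
proof -
  have mono: "norm (sqrt_iter B m x - sqrt_iter B n x) \<le> (sqrt_majorant m - sqrt_majorant n) * norm x"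
    if "n \<le> m" for m n
    using that
  proof (induction m rule: dec_induct)
    case (step m)
    have "norm (sqrt_iter B (Suc m) x - sqrt_iter B n x)
        \<le> norm (sqrt_iter B (Suc m) x - sqrt_iter B m x) + norm (sqrt_iter B m x - sqrt_iter B n x)"
      using norm_triangle_ineq[of "sqrt_iter B (Suc m) x - sqrt_iter B m x" "sqrt_iter B m x - sqrt_iter B n x"]
      by (simp del: sqrt_iter.simps)
    with sqrt_iter_Suc_diff[of m x] step show ?case
      by (simp add: algebra_simps del: sqrt_iter.simps sqrt_majorant.simps)
  qed simp
  have "Cauchy (\<lambda>n. sqrt_majorant n * norm x)"
    using convergent_sqrt_majorant by (intro convergent_Cauchy convergent_mult convergent_const)
  then have "Cauchy (\<lambda>n. sqrt_iter B n x)"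
    unfolding Cauchy_iff
  proof (intro allI impI)
    fix e :: real assume c: "\<forall>e>0. \<exists>M. \<forall>m\<ge>M. \<forall>n\<ge>M.
        norm (sqrt_majorant m * norm x - sqrt_majorant n * norm x) < e" and "e > 0"
    then obtain M where M: "\<And>m n. m \<ge> M \<Longrightarrow> n \<ge> M \<Longrightarrow>
        norm (sqrt_majorant m * norm x - sqrt_majorant n * norm x) < e" by meson
    have le: "norm (sqrt_iter B m x - sqrt_iter B n x) < e" if "n \<ge> M" "n \<le> m" for m n
      using mono[OF that(2)] M[of m n] that by (simp add: left_diff_distrib)
    have "norm (sqrt_iter B m x - sqrt_iter B n x) < e" if "m \<ge> M" "n \<ge> M" for m n
      using le[of n m] le[of m n] that by (cases "n \<le> m") (auto simp: norm_minus_commute)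
    then show "\<exists>M. \<forall>m\<ge>M. \<forall>n\<ge>M. norm (sqrt_iter B m x - sqrt_iter B n x) < e" by blast
  qed
  then show ?thesis by (simp add: Cauchy_convergent_iff)
qed

lemma positive_sqrt_exists:
  "\<exists>R\<in>bop UNIV. (\<forall>x y. cinner (R x) y = cinner x (R y)) \<and>
    (\<forall>x. Re (cinner (R x) x) \<ge> 0) \<and> (\<forall>x. R (R x) = x - B x) \<and>
    (\<forall>C\<in>bop UNIV. (\<forall>x. C (B x) = B (C x)) \<longrightarrow> (\<forall>x. C (R x) = R (C x)))"
proof -
  obtain Y where Y: "\<And>x. (\<lambda>n. sqrt_iter B n x) \<longlonglongrightarrow> Y x"
    using convergent_sqrt_iter unfolding convergent_def by metis
  have add: "Y (x + y) = Y x + Y y" for x y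
    using Y[of "x + y"] tendsto_add[OF Y[of x] Y[of y]] by (simp add: sqrt_iter_add LIMSEQ_unique)
  have scale: "Y (a *\<^sub>C x) = a *\<^sub>C Y x" for a x
    using Y[of "a *\<^sub>C x"] tendsto_scaleC[OF Y[of x]] by (simp add: sqrt_iter_scaleC LIMSEQ_unique)
  have n1: "norm (sqrt_iter B n x) \<le> norm x" for n x
    using norm_sqrt_iter[of n x] mult_right_mono[OF sqrt_majorant_bounds(2)[of n] norm_ge_zero[of x]]
    by simp
  have norm: "norm (Y x) \<le> norm x" for x
    by (rule LIMSEQ_le_const2[OF tendsto_norm[OF Y]]) (use n1 in blast)
  have self: "cinner (Y x) y = cinner x (Y y)" for x y
    using tendsto_cinner[OF Y[of x] tendsto_const[of y]] tendsto_cinner[OF tendsto_const[of x] Y[of y]]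
    by (simp add: sqrt_iter_self_adjoint LIMSEQ_unique)
  have comm: "C (Y x) = Y (C x)" if "C \<in> bop UNIV" "\<And>x. C (B x) = B (C x)" for C x
    using bop_tendsto(2)[OF that(1) closed_csubspace_UNIV _ Y[of x]] Y[of "C x"]
    by (simp add: sqrt_iter_commute[OF that] LIMSEQ_unique)
  have YY: "(\<lambda>n. sqrt_iter B n (sqrt_iter B n x)) \<longlonglongrightarrow> Y (Y x)" for x
  proof -
    have "(\<lambda>n. norm (sqrt_iter B n x - Y x)) \<longlonglongrightarrow> norm (Y x - Y x)"
      by (intro tendsto_intros Y)
    then have "(\<lambda>n. sqrt_iter B n (sqrt_iter B n x - Y x)) \<longlonglongrightarrow> 0"
      by (intro Lim_null_comparison[OF always_eventually[OF allI[OF n1]]]) simp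
    from tendsto_add[OF this Y[of "Y x"]] show ?thesis
      by (simp add: sqrt_iter_add[symmetric])
  qed
  have fix_eq: "Y x = (1/2) *\<^sub>C (B x + Y (Y x))" for x
  proof -
    have "(\<lambda>n. sqrt_iter B (Suc n) x) \<longlonglongrightarrow> (1/2) *\<^sub>C (B x + Y (Y x))"
      unfolding sqrt_iter.simps by (intro tendsto_scaleC tendsto_add tendsto_const YY)
    then show ?thesis using LIMSEQ_Suc[OF Y[of x]] LIMSEQ_unique by blast
  qed
  have Y2: "Y x + Y x = B x + Y (Y x)" for x
    using scaleC_add_left[of "1/2" "1/2" "B x + Y (Y x)"] unfolding fix_eq[of x, symmetric]
    by (simp add: scaleC_one)
  have Ydiff: "Y (x - y) = Y x - Y y" for x y
    using add[of "x - y" y] by simp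
  define R where "R x = x - Y x" for x
  show ?thesis
  proof (intro bexI[of _ R] conjI allI ballI impI)
    show "R \<in> bop UNIV"
    proof (rule bopI[where C = 2])
      show "norm (R x) \<le> 2 * norm x" for x
        using norm_triangle_ineq4[of x "Y x"] norm[of x] by (simp add: R_def)
    qed (simp_all add: R_def add scale scaleC_diff_right)
    show "cinner (R x) y = cinner x (R y)" for x y
      by (simp add: R_def cinner_linear_simps self)
    show "Re (cinner (R x) x) \<ge> 0" for x
    proof -
      have "Re (cinner (Y x) x) \<le> norm (Y x) * norm x"
        using complex_Re_le_cmod[of "cinner (Y x) x"] cinner_Cauchy_Schwarz[of "Y x" x] by linarith
      also have "\<dots> \<le> norm x * norm x" by (intro mult_right_mono norm) simp
      finally show ?thesis
        using norm_squared_Re_cinner[of x] by (simp add: R_def cinner_linear_simps power2_eq_square)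
    qed
    show "R (R x) = x - B x" for x
      using Y2[of x] by (simp add: R_def Ydiff algebra_simps)
    show "C (R x) = R (C x)" if "C \<in> bop UNIV" "\<forall>x. C (B x) = B (C x)" for C x
      using that by (simp add: R_def bop_diff[OF that(1)] comm)
  qed
qed

end

lemma real_form_imp_self_adjoint:
  assumes R: "R \<in> bop UNIV" and real: "\<And>x. Im (cinner (R x) x) = 0"
  shows "cinner (R x) y = cinner x (R y)"
proof -
  note l = bopD(3,4)[OF R]
  have "Im (cinner (R x) y + cinner (R y) x) = 0"
    using real[of "x + y"] real[of x] real[of y] by (simp add: l cinner_linear_simps)
  moreover have "Re (cinner (R y) x) = Re (cinner (R x) y)"
    using real[of "x + \<i> *\<^sub>C y"] real[of x] real[of y] by (simp add: l cinner_linear_simps)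
  ultimately have "cinner (R x) y = cnj (cinner (R y) x)"
    by (simp add: complex_eq_iff)
  then show ?thesis using cinner_commute[of x "R y"] by simp
qed

text \<open>The quadratic form of \<open>R\<close> is nonnegative, so it is minimal at \<open>y\<close> and its derivative there vanishes; the
  derivative in the direction of \<open>R y\<close> is \<open>2 \<parallel>R y\<parallel>\<^sup>2\<close>.\<close>

lemma positive_form_null:
  assumes R: "R \<in> bop UNIV" and self: "\<And>x y. cinner (R x) y = cinner x (R y)"
    and pos: "\<And>x. Re (cinner (R x) x) \<ge> 0" and 0: "cinner (R y) y = 0"
  shows "R y = 0"
proof (rule ccontr)
  assume "R y \<noteq> 0"
  define n c t where "n = (norm (R y))\<^sup>2" and "c = Re (cinner (R (R y)) (R y))" and "t = n / (c + 1)"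
  have n: "n > 0" using \<open>R y \<noteq> 0\<close> by (simp add: n_def)
  have c: "c \<ge> 0" using pos by (simp add: c_def)
  have "t > 0" using n c by (simp add: t_def)
  \<comment> \<open>along \<open>y - s R y\<close> the form is \<open>c s\<^sup>2 - 2 n s\<close>, which is negative at \<open>s = t\<close>\<close>
  let ?z = "of_real t *\<^sub>C R y"
  have "0 \<le> Re (cinner (R (y - ?z)) (y - ?z))" by (rule pos)
  also have "\<dots> = t * (t * c - 2 * n)"
    using 0 self[of "R y" y] self[of y "R y"]
    by (simp add: bop_diff[OF R] bopD(4)[OF R] cinner_linear_simps n_def norm_squared_Re_cinner c_def
        algebra_simps)
  finally have "t * c \<ge> 2 * n" using \<open>t > 0\<close> by (simp add: zero_le_mult_iff)
  moreover have "t * c < n" using n c by (simp add: t_def field_simps)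
  ultimately show False using n by linarith
qed

text \<open>For \<open>y = (R - Q) x\<close> one has \<open>(R + Q) y = (R\<^sup>2 - Q\<^sup>2) x = 0\<close>, so both forms vanish at \<open>y\<close>.\<close>

lemma positive_sqrt_unique:
  assumes R: "R \<in> bop UNIV" "\<And>x y. cinner (R x) y = cinner x (R y)" "\<And>x. Re (cinner (R x) x) \<ge> 0"
    and Q: "Q \<in> bop UNIV" "\<And>x y. cinner (Q x) y = cinner x (Q y)" "\<And>x. Re (cinner (Q x) x) \<ge> 0"
    and eq: "\<And>x. R (R x) = Q (Q x)" and comm: "\<And>x. R (Q x) = Q (R x)"
  shows "Q = R"
proof
  fix x
  note l = bop_diff[OF R(1)] bop_diff[OF Q(1)]
  define y where "y = R x - Q x"
  have "R y + Q y = 0" by (simp add: y_def l eq comm)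
  then have "cinner (R y) y + cinner (Q y) y = 0"
    by (metis cinner_add_left cinner_zero_left)
  moreover have "Im (cinner (R y) y) = 0" "Im (cinner (Q y) y) = 0"
    using R(2)[of y y] Q(2)[of y y] cinner_commute[of y "R y"] cinner_commute[of y "Q y"]
    by (metis Reals_cnj_iff complex_is_Real_iff)+
  ultimately have "cinner (R y) y = 0" "cinner (Q y) y = 0"
    using R(3)[of y] Q(3)[of y] by (auto simp: complex_eq_iff)
  then have "R y = 0" "Q y = 0"
    by (auto intro: positive_form_null[OF R] positive_form_null[OF Q])
  moreover have "cinner y y = cinner x (R y - Q y)"
    by (simp add: y_def cinner_linear_simps R(2) Q(2) l)
  ultimately show "Q x = R x" by (simp add: y_def)
qed

text \<open>Any positive square root \<open>R'\<close> of \<open>I - B\<close> commutes with \<open>B = I - R'\<^sup>2\<close>, hence with the root obtained by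
  iteration, so the two agree.\<close>

lemma positive_sqrt_props:
  assumes B: "B \<in> bop UNIV" "\<And>x y. cinner (B x) y = cinner x (B y)" "\<And>x. norm (B x) \<le> norm x"
  defines "R \<equiv> positive_sqrt (\<lambda>x. x - B x)"
  shows "R \<in> bop UNIV" "cinner (R x) y = cinner x (R y)" "R (R x) = x - B x"
proof -
  obtain Q where Q: "Q \<in> bop UNIV" "\<And>x y. cinner (Q x) y = cinner x (Q y)"
    "\<And>x. Re (cinner (Q x) x) \<ge> 0" "\<And>x. Q (Q x) = x - B x"
    "\<And>C. C \<in> bop UNIV \<Longrightarrow> \<forall>x. C (B x) = B (C x) \<Longrightarrow> \<forall>x. C (Q x) = Q (C x)"
    using positive_sqrt_exists[OF B] by auto
  have "R = Q"
    unfolding R_def positive_sqrt_def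
  proof (rule the_equality, intro conjI allI)
    show "Im (cinner (Q x) x) = 0" for x
      using Q(2)[of x x] cinner_commute[of x "Q x"] by (metis Reals_cnj_iff complex_is_Real_iff)
    fix R' assume R': "R' \<in> bop UNIV \<and> (\<forall>x. Im (cinner (R' x) x) = 0 \<and> 0 \<le> Re (cinner (R' x) x)) \<and>
      (\<forall>x. R' (R' x) = x - B x)"
    then have R1: "R' \<in> bop UNIV" and R2: "Im (cinner (R' x) x) = 0" "0 \<le> Re (cinner (R' x) x)"
      and R3: "R' (R' x) = x - B x" for x by auto
    have "B u = u - R' (R' u)" for u by (simp add: R3)
    then have "R' (B x) = B (R' x)" for x by (simp add: bop_diff[OF R1])
    then have comm: "R' (Q x) = Q (R' x)" for x using Q(5)[OF R1] by blast
    show "R' = Q"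
      by (rule positive_sqrt_unique[OF Q(1-3) R1 real_form_imp_self_adjoint[OF R1 R2(1)] R2(2)])
        (simp_all add: Q(4) R3 comm)
  qed (use Q in auto)
  then show "R \<in> bop UNIV" "cinner (R x) y = cinner x (R y)" "R (R x) = x - B x"
    using Q by auto
qed

lemma contractionD:
  assumes "contraction T"
  shows "T \<in> bop UNIV" "norm (T x) \<le> norm x"
proof -
  show T: "T \<in> bop UNIV" using assms by (simp add: contraction_def)
  obtain C where C: "norm (T x) \<le> C * norm x" for x
    using T by (auto simp: bop_def)
  have "bounded_linear T"
    by (rule bounded_linear_intro[where K = C])
      (simp_all add: bopD[OF T] scaleR_scaleC C mult.commute)
  then have "norm (T x) \<le> onorm T * norm x" by (rule onorm)
  also have "\<dots> \<le> 1 * norm x"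
    using assms by (intro mult_right_mono) (auto simp: contraction_def)
  finally show "norm (T x) \<le> norm x" by simp
qed

lemma norm_adj_contraction:
  assumes "contraction T"
  shows "norm (adj UNIV T x) \<le> norm x"
proof (cases "adj UNIV T x = 0")
  case False
  note T = contractionD[OF assms]
  let ?z = "adj UNIV T x"
  have "(norm ?z)\<^sup>2 = Re (cinner ?z (adj UNIV T x))" by (rule norm_squared_Re_cinner)
  also have "\<dots> = Re (cinner (T ?z) x)" by (simp add: cinner_adj_right[OF _ T(1)])
  also have "\<dots> \<le> norm (T ?z) * norm x"
    using complex_Re_le_cmod cinner_Cauchy_Schwarz order_trans by blast
  also have "\<dots> \<le> norm ?z * norm x" by (intro mult_right_mono T) simp
  finally show ?thesis using False by (simp add: power2_eq_square)
qed simp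

lemma defect_star_props:
  assumes "contraction T"
  shows "defect_star T \<in> bop UNIV"
    "cinner (defect_star T x) y = cinner x (defect_star T y)"
    "defect_star T (defect_star T x) = x - T (adj UNIV T x)"
proof -
  note T = contractionD[OF assms] and ad = adj_in_bop[OF _ contractionD(1)[OF assms], simplified]
  let ?B = "\<lambda>x. T (adj UNIV T x)"
  have n: "norm (?B x) \<le> norm x" for x
    using T(2)[of "adj UNIV T x"] norm_adj_contraction[OF assms, of x] by linarith
  have B: "?B \<in> bop UNIV"
    by (rule bopI[where C = 1]) (use n in \<open>simp_all add: bopD[OF T(1)] bopD[OF ad]\<close>)
  have s: "cinner (?B x) y = cinner x (?B y)" for x y
  proof -
    have "cinner (?B x) y = cinner (adj UNIV T x) (adj UNIV T y)"
      by (rule cinner_adj_right[OF _ T(1), symmetric]) simp_all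
    also have "\<dots> = cinner x (?B y)"
      by (rule cinner_adj_left[OF _ T(1)]) simp_all
    finally show ?thesis .
  qed
  show "defect_star T \<in> bop UNIV" "cinner (defect_star T x) y = cinner x (defect_star T y)"
    "defect_star T (defect_star T x) = x - T (adj UNIV T x)"
    unfolding defect_star_def by (rule positive_sqrt_props[OF B s n])+
qed

lemma norm_defect_star:
  assumes "contraction T"
  shows "(norm (defect_star T x))\<^sup>2 = (norm x)\<^sup>2 - (norm (adj UNIV T x))\<^sup>2"
  unfolding norm_squared_Re_cinner
  by (simp add: defect_star_props[OF assms] cinner_diff_right contractionD(1)[OF assms]
      cinner_adj_left[OF closed_csubspace_UNIV contractionD(1)[OF assms], symmetric])

lemma closed_csubspace_defect_space_star:
  assumes "contraction T"
  shows "closed_csubspace (defect_space_star T)"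
  unfolding defect_space_star_def
  by (intro closed_csubspace_closure csubspace_range) (simp_all add: bopD[OF defect_star_props(1)[OF assms]])


section \<open>Products of commuting families\<close>

lemma oprod_Nil [simp]: "oprod F [] = id"
  and oprod_Cons [simp]: "oprod F (i # is) = F i \<circ> oprod F is"
  by (simp_all add: oprod_def)

lemma oprod_append: "oprod F (xs @ ys) = oprod F xs \<circ> oprod F ys"
  by (induction xs) (auto simp: comp_assoc)

lemma oprod_mem: "(\<And>i x. i \<in> set is \<Longrightarrow> x \<in> S \<Longrightarrow> F i x \<in> S) \<Longrightarrow> x \<in> S \<Longrightarrow> oprod F is x \<in> S"
  by (induction "is") auto

lemma oprod_commute:
  assumes "\<And>i x. i \<in> set is \<Longrightarrow> x \<in> S \<Longrightarrow> F i x \<in> S"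
    and "\<And>i x. i \<in> set is \<Longrightarrow> x \<in> S \<Longrightarrow> A (F i x) = F i (A x)" "x \<in> S"
  shows "A (oprod F is x) = oprod F is (A x)"
  using assms
proof (induction "is")
  case (Cons i "is")
  have "oprod F is x \<in> S" using Cons.prems by (intro oprod_mem) auto
  then show ?case using Cons by simp
qed simp

lemma oprod_oprod:
  assumes F: "\<And>i x. i \<in> set is \<Longrightarrow> x \<in> S \<Longrightarrow> F i x \<in> S" and G: "\<And>i x. i \<in> set is \<Longrightarrow> x \<in> S \<Longrightarrow> G i x \<in> S"
    and comm: "\<And>i j x. i \<in> set is \<Longrightarrow> j \<in> set is \<Longrightarrow> x \<in> S \<Longrightarrow> F i (G j x) = G j (F i x)" and "x \<in> S"
  shows "oprod F is (oprod G is x) = oprod (\<lambda>i. F i \<circ> G i) is x"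
  using assms
proof (induction "is")
  case (Cons i "is")
  have mem: "oprod F is x \<in> S" "oprod G is x \<in> S" using Cons.prems by (auto intro!: oprod_mem)
  have "G i (oprod F is (oprod G is x)) = oprod F is (G i (oprod G is x))"
    by (rule oprod_commute[where S = S]) (use Cons.prems mem in auto)
  moreover have "oprod F is (oprod G is x) = oprod (\<lambda>i. F i \<circ> G i) is x"
    using Cons by (simp add: comp_def)
  ultimately show ?case by (simp add: comp_def)
qed simp

lemma oprod_single:
  assumes "distinct is" "i \<in> set is"
  shows "oprod (\<lambda>j. if j = i then F else id) is = F"
proof -
  have id: "oprod (\<lambda>j. if j = i then F else id) js = id" if "i \<notin> set js" for js
    using that by (induction js) auto
  show ?thesis
    using assms by (induction "is") (auto simp: id)
qed

lemma oprod_rev: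
  assumes "\<And>i x. i \<in> set is \<Longrightarrow> x \<in> S \<Longrightarrow> F i x \<in> S"
    and "\<And>i j x. i \<in> set is \<Longrightarrow> j \<in> set is \<Longrightarrow> x \<in> S \<Longrightarrow> F i (F j x) = F j (F i x)" "x \<in> S"
  shows "oprod F (rev is) x = oprod F is x"
  using assms
proof (induction "is" arbitrary: x)
  case (Cons i "is")
  have "oprod F (rev (i # is)) x = oprod F is (F i x)"
    using Cons by (simp add: oprod_append)
  also have "\<dots> = F i (oprod F is x)"
    by (rule oprod_commute[where S = S, symmetric]) (use Cons.prems in auto)
  finally show ?case by simp
qed simp

lemma funpow_mem: "(\<And>x. x \<in> S \<Longrightarrow> f x \<in> S) \<Longrightarrow> x \<in> S \<Longrightarrow> (f ^^ k) x \<in> S"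
  by (induction k) auto

lemma funpow_commute_on:
  assumes "\<And>x. x \<in> S \<Longrightarrow> f x \<in> S" "\<And>x. x \<in> S \<Longrightarrow> g (f x) = f (g x)" "x \<in> S"
  shows "g ((f ^^ k) x) = (f ^^ k) (g x)"
  using assms(3) by (induction k) (simp_all add: assms funpow_mem)

lemma oprod_rev_snoc: "oprod F (rev [1..<Suc (Suc m)]) x = F (Suc m) (oprod F (rev [1..<Suc m]) x)"
  by simp

lemma oprod_rev_inverse:
  assumes "\<And>i x. i \<in> set is \<Longrightarrow> x \<in> S \<Longrightarrow> G i x \<in> S" "\<And>i x. i \<in> set is \<Longrightarrow> x \<in> S \<Longrightarrow> F i (G i x) = x" "x \<in> S"
  shows "oprod F (rev is) (oprod G is x) = x"
  using assms
proof (induction "is")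
  case (Cons i "is")
  have "oprod G is x \<in> S" using Cons.prems by (intro oprod_mem) auto
  then show ?case using Cons by (simp add: oprod_append)
qed simp

definition monomial :: "nat \<Rightarrow> (nat \<Rightarrow> 'a \<Rightarrow> 'a) \<Rightarrow> (nat \<Rightarrow> nat) \<Rightarrow> 'a \<Rightarrow> 'a" where
  "monomial n V k = oprod (\<lambda>i. V i ^^ k i) [1..<Suc n]"

lemma monomial_1: "monomial n V (\<lambda>_. 1) = oprod V [1..<Suc n]"
  by (simp add: monomial_def)

locale commuting_family =
  fixes S :: "'a set" and n :: nat and V :: "nat \<Rightarrow> 'a \<Rightarrow> 'a"
  assumes V_mem: "\<And>i x. i \<in> {1..n} \<Longrightarrow> x \<in> S \<Longrightarrow> V i x \<in> S"
    and V_commute: "commuting S n V"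
begin

lemma pow_mem: "i \<in> {1..n} \<Longrightarrow> x \<in> S \<Longrightarrow> (V i ^^ k) x \<in> S"
  using V_mem by (intro funpow_mem)

lemma pow_commute:
  assumes "i \<in> {1..n}" "j \<in> {1..n}" "x \<in> S"
  shows "(V i ^^ k) ((V j ^^ l) x) = (V j ^^ l) ((V i ^^ k) x)"
proof -
  have "V i ((V j ^^ l) y) = (V j ^^ l) (V i y)" if "y \<in> S" for y
    by (rule funpow_commute_on) (use assms that V_mem V_commute in \<open>auto simp: commuting_def\<close>)
  then have "(V j ^^ l) (V i y) = V i ((V j ^^ l) y)" if "y \<in> S" for y
    using that by simp
  then have "(V j ^^ l) ((V i ^^ k) x) = (V i ^^ k) ((V j ^^ l) x)"
    by (intro funpow_commute_on[where S = S]) (use assms V_mem in auto)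
  then show ?thesis by simp
qed

lemma monomial_mem: "x \<in> S \<Longrightarrow> monomial n V k x \<in> S"
  unfolding monomial_def by (rule oprod_mem) (auto intro: pow_mem)

lemma monomial_add: "x \<in> S \<Longrightarrow> monomial n V k (monomial n V l x) = monomial n V (\<lambda>i. k i + l i) x"
  unfolding monomial_def funpow_add
  by (rule oprod_oprod[where S = S]) (auto intro: pow_mem pow_commute)

lemma monomial_single: "i \<in> {1..n} \<Longrightarrow> monomial n V (\<lambda>j. if j = i then 1 else 0) = V i"
proof -
  assume "i \<in> {1..n}"
  moreover have "(\<lambda>j. V j ^^ (if j = i then 1 else 0)) = (\<lambda>j. if j = i then V i else id)"
    by (auto simp: fun_eq_iff)
  ultimately show ?thesis
    unfolding monomial_def by (simp add: oprod_single del: upt_Suc)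
qed

lemma monomial_0: "monomial n V (\<lambda>_. 0) x = x"
proof -
  have "oprod (\<lambda>_. id :: 'a \<Rightarrow> 'a) is = id" for "is" :: "nat list" by (induction "is") auto
  then show ?thesis by (simp add: monomial_def id_def[symmetric] del: upt_Suc)
qed

lemma product_pow: "x \<in> S \<Longrightarrow> (oprod V [1..<Suc n] ^^ m) x = monomial n V (\<lambda>_. m) x"
proof (induction m)
  case (Suc m)
  then show ?case unfolding monomial_1[symmetric] by (simp add: monomial_add)
qed (simp add: monomial_0)

end


definition cofactor :: "nat \<Rightarrow> (nat \<Rightarrow> 'a \<Rightarrow> 'a) \<Rightarrow> nat \<Rightarrow> 'a \<Rightarrow> 'a" where
  "cofactor n V i = monomial n V (\<lambda>j. if j = i then 0 else 1)"

context commuting_family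
begin

lemma factor_monomial:
  assumes "i \<in> {1..n}" "x \<in> S"
  shows "V i (monomial n V k x) = monomial n V (\<lambda>j. (if j = i then 1 else 0) + k j) x"
    "monomial n V k (V i x) = monomial n V (\<lambda>j. (if j = i then 1 else 0) + k j) x"
  using monomial_add[OF assms(2), of "\<lambda>j. if j = i then 1 else 0" k]
    monomial_add[OF assms(2), of k "\<lambda>j. if j = i then 1 else 0"]
  by (simp_all add: monomial_single[OF assms(1)] add.commute)

lemma factor_cofactor:
  assumes "i \<in> {1..n}" "x \<in> S"
  shows "V i (cofactor n V i x) = monomial n V (\<lambda>_. 1) x" "cofactor n V i (V i x) = monomial n V (\<lambda>_. 1) x"
proof -
  have "(\<lambda>j. (if j = i then 1 else 0) + (if j = i then 0 else 1)) = (\<lambda>_. 1::nat)" by auto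
  then show "V i (cofactor n V i x) = monomial n V (\<lambda>_. 1) x" "cofactor n V i (V i x) = monomial n V (\<lambda>_. 1) x"
    unfolding cofactor_def by (simp_all only: factor_monomial[OF assms])
qed

lemma product_rev: "x \<in> S \<Longrightarrow> oprod V (rev [1..<Suc n]) x = oprod V [1..<Suc n] x"
  by (rule oprod_rev[where S = S]) (use V_mem V_commute in \<open>auto simp: commuting_def\<close>)

end


section \<open>Isometries\<close>

text \<open>In contrast to \<^const>\<open>isometries\<close>, values outside \<open>S\<close> are irrelevant, so that compositions and
  the identity need no restriction.\<close>

definition isometric_on :: "'a::chilbert_space set \<Rightarrow> ('a \<Rightarrow> 'a) \<Rightarrow> bool" where
  "isometric_on S X \<longleftrightarrow> (\<forall>x\<in>S. X x \<in> S \<and> norm (X x) = norm x \<and> (\<forall>a. X (a *\<^sub>C x) = a *\<^sub>C X x) \<and>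
     (\<forall>y\<in>S. X (x + y) = X x + X y))"

lemma isometries_iff: "V \<in> isometries S \<longleftrightarrow> isometric_on S V \<and> V \<in> extensional S"
proof
  assume "V \<in> isometries S"
  then show "isometric_on S V \<and> V \<in> extensional S"
    by (auto simp: isometries_def isometric_on_def bop_def PiE_def)
next
  assume "isometric_on S V \<and> V \<in> extensional S"
  then show "V \<in> isometries S"
    unfolding isometries_def isometric_on_def by (auto intro!: bopI[where C = 1])
qed

lemma isometric_onD:
  assumes "isometric_on S X"
  shows "x \<in> S \<Longrightarrow> X x \<in> S" "x \<in> S \<Longrightarrow> norm (X x) = norm x" "x \<in> S \<Longrightarrow> X (a *\<^sub>C x) = a *\<^sub>C X x"
    "x \<in> S \<Longrightarrow> y \<in> S \<Longrightarrow> X (x + y) = X x + X y"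
  using assms by (auto simp: isometric_on_def)

lemma isometric_on_cinner:
  assumes "isometric_on S X" "closed_csubspace S" "x \<in> S" "y \<in> S"
  shows "cinner (X x) (X y) = cinner x y"
  by (rule isometry_cinner[OF assms(2-4)]) (use assms(1) in \<open>auto simp: isometric_on_def\<close>)

lemma isometric_on_diff:
  assumes "isometric_on S X" "closed_csubspace S" "x \<in> S" "y \<in> S"
  shows "X (x - y) = X x - X y"
  using isometric_onD(4)[OF assms(1), of "x - y" y] assms(2-4) by (simp add: closed_csubspaceD)

lemma isometric_on_restrict: "isometric_on S X \<Longrightarrow> closed_csubspace S \<Longrightarrow> restrict X S \<in> isometries S"
  by (auto simp: isometries_iff isometric_on_def closed_csubspaceD)

lemma isometries_in_bop: "V \<in> isometries S \<Longrightarrow> V \<in> bop S"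
  by (simp add: isometries_def)

lemma isometric_on_id: "isometric_on S id"
  by (simp add: isometric_on_def)

lemma isometric_on_comp: "isometric_on S X \<Longrightarrow> isometric_on S Y \<Longrightarrow> isometric_on S (X \<circ> Y)"
  by (simp add: isometric_on_def)

lemma isometric_on_funpow: "isometric_on S X \<Longrightarrow> isometric_on S (X ^^ k)"
  by (induction k) (auto simp: isometric_on_id[unfolded id_def] isometric_on_id intro: isometric_on_comp)

lemma isometric_on_oprod: "(\<And>i. i \<in> set is \<Longrightarrow> isometric_on S (F i)) \<Longrightarrow> isometric_on S (oprod F is)"
  by (induction "is") (auto intro: isometric_on_comp isometric_on_id)

lemma isometric_on_monomial:
  "(\<And>i. i \<in> {1..n} \<Longrightarrow> isometric_on S (V i)) \<Longrightarrow> isometric_on S (monomial n V k)"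
  unfolding monomial_def by (rule isometric_on_oprod) (auto intro: isometric_on_funpow)

lemma restrict_funpow:
  assumes "\<And>x. x \<in> S \<Longrightarrow> f x \<in> S" "x \<in> S"
  shows "(restrict f S ^^ k) x = (f ^^ k) x"
  using assms(2) by (induction k) (simp_all add: funpow_mem assms(1))

text \<open>An isometry carries convergent sequences back to Cauchy sequences, so it maps closed sets onto closed
  sets.\<close>

lemma closed_csubspace_isometric_image:
  fixes F :: "'a::chilbert_space \<Rightarrow> 'b::chilbert_space"
  assumes S: "closed_csubspace S"
    and F: "\<And>x y. x \<in> S \<Longrightarrow> y \<in> S \<Longrightarrow> F (x + y) = F x + F y" "\<And>a x. x \<in> S \<Longrightarrow> F (a *\<^sub>C x) = a *\<^sub>C F x"
    "\<And>x. x \<in> S \<Longrightarrow> norm (F x) = norm x"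
  shows "closed_csubspace (F ` S)"
  unfolding closed_csubspace_def
proof
  have F0: "F 0 = 0" using F(3)[of 0] S by (simp add: closed_csubspaceD)
  show "csubspace (F ` S)"
  proof (rule cvec.subspaceI)
    show "0 \<in> F ` S" using F0 closed_csubspaceD(1)[OF S] by (metis imageI)
    show "x + y \<in> F ` S" if "x \<in> F ` S" "y \<in> F ` S" for x y
      using that by (auto simp: F[symmetric] closed_csubspaceD[OF S])
    show "a *\<^sub>C x \<in> F ` S" if "x \<in> F ` S" for a x
      using that by (auto simp: F[symmetric] closed_csubspaceD[OF S])
  qed
  have diff: "F (x - y) = F x - F y" if "x \<in> S" "y \<in> S" for x y
    using F(1)[of "x - y" y] that by (simp add: closed_csubspaceD[OF S])
  show "closed (F ` S)"
    unfolding closed_sequential_limits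
  proof (intro allI impI)
    fix f :: "nat \<Rightarrow> 'b" and l assume f: "(\<forall>n. f n \<in> F ` S) \<and> f \<longlonglongrightarrow> l"
    define g where "g n = inv_into S F (f n)" for n
    have g: "g n \<in> S" "F (g n) = f n" for n
      using f by (simp_all add: g_def inv_into_into f_inv_into_f)
    have "Cauchy f" using f LIMSEQ_imp_Cauchy by blast
    moreover have "norm (g m - g n) = norm (f m - f n)" for m n
      using F(3)[of "g m - g n"] g by (simp add: diff closed_csubspaceD[OF S])
    ultimately have "Cauchy g" by (simp add: Cauchy_iff)
    then obtain x where x: "g \<longlonglongrightarrow> x" by (auto simp: Cauchy_convergent_iff convergent_def)
    then have xS: "x \<in> S"
      using closed_sequentially[OF closed_csubspaceD(7)[OF S]] g by blast
    have "(\<lambda>n. norm (g n - x)) \<longlonglongrightarrow> norm (x - x)" by (intro tendsto_intros x)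
    moreover have "norm (g n - x) = norm (f n - F x)" for n
      using F(3)[of "g n - x"] g xS by (simp add: diff closed_csubspaceD[OF S])
    ultimately have "(\<lambda>n. f n - F x) \<longlonglongrightarrow> 0"
      by (intro tendsto_norm_zero_cancel[of "\<lambda>n. f n - F x"]) simp
    then have "f \<longlonglongrightarrow> F x" by (rule LIM_zero_cancel)
    then have "l = F x" using f LIMSEQ_unique by blast
    then show "l \<in> F ` S" using xS by simp
  qed
qed


section \<open>Commuting contractions with a pure product\<close>

locale contraction_tuple =
  fixes n :: nat and T :: "nat \<Rightarrow> 'a::chilbert_space \<Rightarrow> 'a"
  assumes n_pos: "n \<ge> 1" and contractions: "\<forall>i\<in>{1..n}. contraction (T i)"
    and commuting_T: "commuting UNIV n T" and product_pure: "C_dot_zero (oprod T [1..<Suc n])"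
begin

definition Tprod :: "'a \<Rightarrow> 'a" where "Tprod = monomial n T (\<lambda>_. 1)"
definition Tstar :: "'a \<Rightarrow> 'a" where "Tstar = adj UNIV Tprod"
definition D :: "'a \<Rightarrow> 'a" where "D = defect_star Tprod"
definition E :: "'a set" where "E = defect_space_star Tprod"

lemma oprod_T: "oprod T [1..<Suc n] = Tprod"
  by (simp only: Tprod_def monomial_1)

sublocale T: commuting_family UNIV n T
  by unfold_locales (simp_all add: commuting_T)

lemma contraction_Tprod: "contraction Tprod"
  using product_pure unfolding oprod_T C_dot_zero_def by blast

lemma Tprod_bop: "Tprod \<in> bop UNIV"
  by (rule contractionD(1)[OF contraction_Tprod])

lemma T_bop: "i \<in> {1..n} \<Longrightarrow> T i \<in> bop UNIV"
  using contractions contractionD(1) by blast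

lemma Tstar_bop: "Tstar \<in> bop UNIV"
  unfolding Tstar_def by (rule adj_in_bop[OF closed_csubspace_UNIV Tprod_bop])

lemmas Tstar_linear = bopD(3,4)[OF Tstar_bop, simplified]

lemma cinner_Tstar: "cinner x (Tstar y) = cinner (Tprod x) y" "cinner (Tstar x) y = cinner x (Tprod y)"
  unfolding Tstar_def by (simp_all add: cinner_adj_right cinner_adj_left Tprod_bop)

lemma D_bop: "D \<in> bop UNIV"
  unfolding D_def by (rule defect_star_props[OF contraction_Tprod])

lemmas D_linear = bopD(3,4)[OF D_bop, simplified]

lemma norm_D: "(norm (D x))\<^sup>2 = (norm x)\<^sup>2 - (norm (Tstar x))\<^sup>2"
  unfolding D_def Tstar_def by (rule norm_defect_star[OF contraction_Tprod])

lemma E_closed: "closed_csubspace E"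
  unfolding E_def by (rule closed_csubspace_defect_space_star[OF contraction_Tprod])

lemma E_eq: "E = closure (range D)"
  by (simp add: E_def D_def defect_space_star_def)

lemma D_mem: "D x \<in> E"
  unfolding E_eq by (rule subsetD[OF closure_subset]) simp

lemma E_eq_0: "x \<in> E \<Longrightarrow> (\<And>h. cinner x (D h) = 0) \<Longrightarrow> x = 0"
  using orthogonal_closure[of "range D" x x] by (auto simp: E_eq)

lemma Tstar_pow_lim: "(\<lambda>k. (Tstar ^^ k) x) \<longlonglongrightarrow> 0"
  using product_pure unfolding oprod_T C_dot_zero_def Tstar_def by blast

lemma Tprod_T: "i \<in> {1..n} \<Longrightarrow> Tprod (T i x) = T i (Tprod x)"
  using T.factor_monomial[of i x] by (simp add: Tprod_def)

lemma Tstar_adj_T: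
  assumes "i \<in> {1..n}"
  shows "adj UNIV (T i) (Tstar x) = Tstar (adj UNIV (T i) x)"
  by (rule cinner_right_ext[of UNIV])
    (simp_all add: cinner_adj_right T_bop[OF assms] cinner_Tstar Tprod_T[OF assms])

end


section \<open>The wandering subspace of a dilation\<close>

locale product_dilation = contraction_tuple n T
  for n and T :: "nat \<Rightarrow> 'a::chilbert_space \<Rightarrow> 'a" +
  fixes K :: "'k::chilbert_space set" and J :: "'a \<Rightarrow> 'k" and V :: "nat \<Rightarrow> 'k \<Rightarrow> 'k"
  assumes dilation: "isometric_dilation K J n V T"
    and minimal: "minimal_isometric_dilation K J (restrict (oprod V [1..<Suc n]) K) (oprod T [1..<Suc n])"
begin

lemma K_closed: "closed_csubspace K"
  using dilation by (simp add: isometric_dilation_def closed_csubspace_def)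

lemma V_isometry: "i \<in> {1..n} \<Longrightarrow> V i \<in> isometries K"
  using dilation by (simp add: isometric_dilation_def)

lemma V_isometric: "i \<in> {1..n} \<Longrightarrow> isometric_on K (V i)"
  using V_isometry by (simp add: isometries_iff)

sublocale V: commuting_family K n V
proof
  show "V i x \<in> K" if "i \<in> {1..n}" "x \<in> K" for i x
    using isometric_onD(1)[OF V_isometric] that by blast
  show "commuting K n V" using dilation by (simp add: isometric_dilation_def)
qed

lemma J_linear: "J (x + y) = J x + J y" "J (a *\<^sub>C x) = a *\<^sub>C J x"
proof -
  have "Vector_Spaces.linear scaleC scaleC J" using dilation by (simp add: isometric_dilation_def)
  then interpret Vector_Spaces.linear scaleC scaleC J .
  show "J (x + y) = J x + J y" "J (a *\<^sub>C x) = a *\<^sub>C J x" by (rule add scale)+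
qed

lemma J_norm: "norm (J x) = norm x"
  using dilation by (simp add: isometric_dilation_def)

lemma J_mem: "J x \<in> K"
  using dilation by (auto simp: isometric_dilation_def)

lemma cinner_J: "cinner (J x) (J y) = cinner x y"
  by (rule isometry_cinner[of UNIV]) (simp_all add: J_linear J_norm)

lemma cinner_monomial_J: "cinner (monomial n V k (J h)) (J g) = cinner (monomial n T k h) g"
proof -
  have "closed_csubspace (range J)"
    by (rule closed_csubspace_isometric_image) (simp_all add: J_linear J_norm)
  then have "cinner (proj_onto (range J) (monomial n V k (J h))) (J g) = cinner (monomial n V k (J h)) (J g)"
    by (rule cinner_proj_onto) simp
  moreover have "J (monomial n T k h) = proj_onto (range J) (monomial n V k (J h))"
    using dilation unfolding isometric_dilation_def monomial_def by blast
  ultimately show ?thesis by (simp add: cinner_J[symmetric])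
qed

definition Vprod :: "'k \<Rightarrow> 'k" where "Vprod = monomial n V (\<lambda>_. 1)"
definition Vstar :: "'k \<Rightarrow> 'k" where "Vstar = adj K (restrict Vprod K)"

lemma Vprod_isometric: "isometric_on K Vprod"
  unfolding Vprod_def by (rule isometric_on_monomial[OF V_isometric])

lemmas Vprod_mem = isometric_onD(1)[OF Vprod_isometric]
  and Vprod_linear = isometric_onD(3,4)[OF Vprod_isometric]

lemma Vprod_bop: "restrict Vprod K \<in> bop K"
  by (intro isometries_in_bop isometric_on_restrict Vprod_isometric K_closed)

lemma Vprod_diff: "x \<in> K \<Longrightarrow> y \<in> K \<Longrightarrow> Vprod (x - y) = Vprod x - Vprod y"
  by (rule isometric_on_diff[OF Vprod_isometric K_closed])

lemma cinner_Vprod: "x \<in> K \<Longrightarrow> y \<in> K \<Longrightarrow> cinner (Vprod x) (Vprod y) = cinner x y"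
  by (rule isometric_on_cinner[OF Vprod_isometric K_closed])

lemma Vstar_bop: "Vstar \<in> bop K"
  unfolding Vstar_def by (rule adj_in_bop[OF K_closed Vprod_bop])

lemmas Vstar_mem = bopD(1)[OF Vstar_bop]
  and Vstar_linear = bopD(3,4)[OF Vstar_bop]
  and Vstar_diff = bop_diff[OF Vstar_bop K_closed]

lemma cinner_Vstar:
  assumes "x \<in> K" "y \<in> K"
  shows "cinner x (Vstar y) = cinner (Vprod x) y" "cinner (Vstar x) y = cinner x (Vprod y)"
  using cinner_adj_right[OF K_closed Vprod_bop] cinner_adj_left[OF K_closed Vprod_bop] assms
  by (simp_all add: Vstar_def)

lemma Vstar_Vprod: "x \<in> K \<Longrightarrow> Vstar (Vprod x) = x"
  by (rule cinner_right_ext[OF K_closed]) (simp_all add: Vstar_mem Vprod_mem cinner_Vstar cinner_Vprod)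

text \<open>By minimality the vectors \<open>V\<^sup>k J h\<close> span \<open>K\<close>, so a vector orthogonal to all of them is \<open>0\<close>.\<close>

lemma K_eq_0:
  assumes "x \<in> K" "\<And>k h. cinner x (monomial n V (\<lambda>_. k) (J h)) = 0"
  shows "x = 0"
proof -
  have prod: "oprod V [1..<Suc n] = Vprod"
    by (simp only: Vprod_def monomial_1)
  have "K = closure (cspan {(restrict Vprod K ^^ k) (J h) | k h. True})"
    using minimal unfolding minimal_isometric_dilation_def prod by blast
  moreover have "(restrict Vprod K ^^ k) (J h) = monomial n V (\<lambda>_. k) (J h)" for k h
    using restrict_funpow[of K Vprod "J h" k] V.product_pow[of "J h" k] Vprod_mem J_mem
    unfolding prod by simp
  ultimately have "x \<in> closure (cspan {monomial n V (\<lambda>_. k) (J h) | k h. True})"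
    using assms(1) by simp
  then have "cinner x x = 0"
    by (rule orthogonal_closure_cspan[rotated]) (use assms(2) in auto)
  then show ?thesis by simp
qed

text \<open>The copy \<open>J\<close> of the original space is invariant under the adjoints of the dilation: both sides have the
  same inner product with \<open>V\<^sup>k J g\<close>, by the dilation property.\<close>

lemma adj_J:
  assumes X: "X \<in> bop K" "\<And>x. x \<in> K \<Longrightarrow> X x = monomial n V m x"
    and Y: "Y \<in> bop UNIV" "Y = monomial n T m"
  shows "adj K X (J h) = J (adj UNIV Y h)"
proof -
  let ?d = "adj K X (J h) - J (adj UNIV Y h)"
  have mem: "adj K X (J h) \<in> K" by (rule adj_mem[OF K_closed X(1) J_mem])
  have "?d = 0"
  proof (rule K_eq_0)
    show "?d \<in> K" by (intro closed_csubspaceD[OF K_closed] mem J_mem)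
    fix k g
    let ?v = "monomial n V (\<lambda>_. k) (J g)"
    have v: "?v \<in> K" by (rule V.monomial_mem[OF J_mem])
    have "cinner ?v (adj K X (J h)) = cinner (monomial n V m ?v) (J h)"
      using cinner_adj_right[OF K_closed X(1) v J_mem] X(2)[OF v] by simp
    also have "\<dots> = cinner (monomial n T m (monomial n T (\<lambda>_. k) g)) h"
      by (simp add: V.monomial_add J_mem cinner_monomial_J T.monomial_add)
    also have "\<dots> = cinner (monomial n T (\<lambda>_. k) g) (adj UNIV Y h)"
      using cinner_adj_right[OF _ Y(1)] Y(2) by simp
    also have "\<dots> = cinner ?v (J (adj UNIV Y h))" by (simp add: cinner_monomial_J)
    finally have "cinner ?v ?d = 0" by (simp add: cinner_diff_right)
    then show "cinner ?d ?v = 0" by (simp add: cinner_eq_0_commute)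
  qed
  then show ?thesis by simp
qed

lemma Vstar_J: "Vstar (J h) = J (Tstar h)"
  unfolding Vstar_def Tstar_def
  by (rule adj_J[OF Vprod_bop _ Tprod_bop]) (auto simp: Vprod_def Tprod_def)

lemma adj_V_J: "i \<in> {1..n} \<Longrightarrow> adj K (V i) (J h) = J (adj UNIV (T i) h)"
  by (rule adj_J[where m = "\<lambda>j. if j = i then 1 else 0"])
    (simp_all only: V.monomial_single T.monomial_single T_bop isometries_in_bop[OF V_isometry])

text \<open>The vector on the left is \<open>(I - V V\<^sup>*) J h\<close>, and \<open>\<parallel>J h\<parallel>\<^sup>2 - \<parallel>V\<^sup>* J h\<parallel>\<^sup>2 = \<parallel>h\<parallel>\<^sup>2 - \<parallel>T\<^sup>* h\<parallel>\<^sup>2\<close>.\<close>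

lemma norm_J_diff: "norm (J h - Vprod (J (Tstar h))) = norm (D h)"
proof -
  have "cinner (J h) (Vprod (J (Tstar h))) = cinner (J (Tstar h)) (J (Tstar h))"
    by (simp add: cinner_Vstar(2)[symmetric] J_mem Vstar_J)
  then have "(norm (J h - Vprod (J (Tstar h))))\<^sup>2 = (norm (D h))\<^sup>2"
    by (simp add: norm_diff_squared norm_D J_norm isometric_onD(2)[OF Vprod_isometric] J_mem
        norm_squared_Re_cinner[symmetric])
  then show ?thesis by simp
qed

end

text \<open>\<open>L\<close> extends \<open>D h \<mapsto> (I - V V\<^sup>*) J h\<close> to the defect space. It turns out to be an isometry onto the
  wandering subspace \<open>ker V\<^sup>*\<close>, so that operators between wandering vectors become operators on \<open>E\<close>.\<close>

locale wandering_embedding = product_dilation n T K J V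
  for n and T :: "nat \<Rightarrow> 'a::chilbert_space \<Rightarrow> 'a" and K :: "'k::chilbert_space set" and J V +
  fixes L :: "'a \<Rightarrow> 'k"
  assumes L_D: "L (D h) = J h - Vprod (J (Tstar h))"
    and L_add: "e \<in> E \<Longrightarrow> f \<in> E \<Longrightarrow> L (e + f) = L e + L f"
    and L_scaleC: "e \<in> E \<Longrightarrow> L (a *\<^sub>C e) = a *\<^sub>C L e"
    and L_norm: "e \<in> E \<Longrightarrow> norm (L e) = norm e"
    and L_closure: "e \<in> E \<Longrightarrow> L e \<in> closure (range (\<lambda>h. J h - Vprod (J (Tstar h))))"

lemma (in product_dilation) wandering_embedding_exists: "\<exists>L. wandering_embedding n T K J V L"
proof -
  let ?F = "\<lambda>h. J h - Vprod (J (Tstar h))"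
  have "?F (x + y) = ?F x + ?F y" "?F (a *\<^sub>C x) = a *\<^sub>C ?F x" for x y a
    by (simp_all add: J_linear Tstar_linear Vprod_linear J_mem scaleC_diff_right)
  from isometric_factorization[of D ?F, OF D_linear this norm_J_diff]
  show ?thesis
    unfolding E_eq[symmetric]
  proof (elim exE conjE)
    fix L :: "'a \<Rightarrow> 'k" assume "\<forall>h. L (D h) = ?F h" "\<forall>e\<in>E. \<forall>f\<in>E. L (e + f) = L e + L f"
      "\<forall>a. \<forall>e\<in>E. L (a *\<^sub>C e) = a *\<^sub>C L e" "\<forall>e\<in>E. norm (L e) = norm e"
      "\<forall>e\<in>E. L e \<in> closure (range ?F)"
    then have "wandering_embedding n T K J V L"
      by unfold_locales auto
    then show "\<exists>L. wandering_embedding n T K J V L" by (intro exI[of _ L])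
  qed
qed

context wandering_embedding
begin

lemma L_mem: "e \<in> E \<Longrightarrow> L e \<in> K"
proof -
  have "range (\<lambda>h. J h - Vprod (J (Tstar h))) \<subseteq> K"
    by (auto intro!: closed_csubspaceD[OF K_closed] J_mem Vprod_mem)
  then have "closure (range (\<lambda>h. J h - Vprod (J (Tstar h)))) \<subseteq> K"
    by (intro closure_minimal closed_csubspaceD[OF K_closed])
  then show "e \<in> E \<Longrightarrow> L e \<in> K" using L_closure by blast
qed

lemma L_cinner: "e \<in> E \<Longrightarrow> f \<in> E \<Longrightarrow> cinner (L e) (L f) = cinner e f"
  by (rule isometry_cinner[OF E_closed]) (simp_all add: L_add L_scaleC L_norm)

lemma L_0: "L 0 = 0"
  using L_norm[of 0] closed_csubspaceD(1)[OF E_closed] by simp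

lemma L_diff: "e \<in> E \<Longrightarrow> f \<in> E \<Longrightarrow> L (e - f) = L e - L f"
  using L_add[of "e - f" f] by (simp add: closed_csubspaceD[OF E_closed])

lemma L_eq_0: "e \<in> E \<Longrightarrow> L e = 0 \<Longrightarrow> e = 0"
  using L_norm[of e] by simp

lemma L_orthogonal:
  assumes "x \<in> K" "e \<in> E"
  shows "cinner (Vprod x) (L e) = 0" "cinner (L e) (Vprod x) = 0"
proof -
  show "cinner (Vprod x) (L e) = 0"
  proof (rule orthogonal_closure[OF _ L_closure[OF assms(2)]])
    fix g assume "g \<in> range (\<lambda>h. J h - Vprod (J (Tstar h)))"
    then obtain h where g: "g = J h - Vprod (J (Tstar h))" by blast
    show "cinner (Vprod x) g = 0"
      using assms(1) by (simp add: g cinner_diff_right cinner_Vprod J_mem cinner_Vstar(1)[symmetric] Vstar_J)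
  qed
  then show "cinner (L e) (Vprod x) = 0" by (simp add: cinner_eq_0_commute)
qed

lemma Vstar_L: "e \<in> E \<Longrightarrow> Vstar (L e) = 0"
  by (rule cinner_right_ext[OF K_closed])
    (simp_all add: Vstar_mem L_mem closed_csubspaceD[OF K_closed] cinner_Vstar L_orthogonal)

lemma L_image_closed: "closed_csubspace (L ` E)"
  by (rule closed_csubspace_isometric_image[OF E_closed]) (simp_all add: L_add L_scaleC L_norm)

text \<open>A vector of \<open>ker V\<^sup>*\<close> that is orthogonal to the image of \<open>L\<close> is orthogonal to \<open>V K\<close> and to all
  \<open>(I - V V\<^sup>*) J h\<close>, hence to all \<open>V\<^sup>k J h\<close>.\<close>

lemma L_image:
  assumes w: "w \<in> K" "Vstar w = 0"
  shows "w \<in> L ` E"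
proof -
  obtain y where y: "y \<in> L ` E" "\<And>z. z \<in> L ` E \<Longrightarrow> cinner (w - y) z = 0"
    using orthogonal_projection_exists[OF L_image_closed] by blast
  have yK: "y \<in> K" and y0: "Vstar y = 0" using y(1) L_mem Vstar_L by auto
  have uK: "w - y \<in> K" by (intro closed_csubspaceD[OF K_closed] w yK)
  have u0: "Vstar (w - y) = 0" using w y0 yK by (simp add: Vstar_diff)
  have ortho: "cinner (w - y) (Vprod x) = 0" if "x \<in> K" for x
    using cinner_Vstar(2)[OF uK that] u0 by simp
  have "w - y = 0"
  proof (rule K_eq_0[OF uK])
    fix k h
    show "cinner (w - y) (monomial n V (\<lambda>_. k) (J h)) = 0"
    proof (cases k)
      case 0
      have "cinner (w - y) (L (D h)) = 0" by (intro y(2) imageI D_mem)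
      then show ?thesis
        using ortho[of "J (Tstar h)"] by (simp add: 0 V.monomial_0 L_D cinner_diff_right J_mem)
    next
      case (Suc k')
      have "monomial n V (\<lambda>_. k) (J h) = Vprod (monomial n V (\<lambda>_. k') (J h))"
        by (simp add: Vprod_def V.monomial_add J_mem Suc)
      then show ?thesis using ortho V.monomial_mem[OF J_mem] by simp
    qed
  qed
  then show ?thesis using y(1) by simp
qed

definition Linv :: "'k \<Rightarrow> 'a" where "Linv = inv_into E L"

lemma Linv:
  assumes "w \<in> K" "Vstar w = 0"
  shows "Linv w \<in> E" "L (Linv w) = w"
  using L_image[OF assms] by (simp_all add: Linv_def inv_into_into f_inv_into_f)

lemma decomposition_unique:
  assumes "e \<in> E" "x \<in> K" "L e + Vprod x = 0"
  shows "e = 0" "x = 0"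
proof -
  have "Vstar (L e + Vprod x) = x"
    by (simp add: Vstar_linear L_mem Vprod_mem Vstar_L Vstar_Vprod assms(1,2))
  then show "x = 0" using assms(3) bop_0[OF Vstar_bop K_closed] by simp
  then have "L e = 0" using assms(3) Vprod_diff[of 0 0] by (simp add: closed_csubspaceD[OF K_closed])
  then show "e = 0" using assms(1) L_eq_0 by blast
qed

lemma decomposition_unique2:
  assumes "e \<in> E" "f \<in> E" "x \<in> K" "y \<in> K" "L e + Vprod x = L f + Vprod y"
  shows "e = f" "x = y"
proof -
  have "L (e - f) + Vprod (x - y) = (L e + Vprod x) - (L f + Vprod y)"
    by (simp add: L_diff Vprod_diff assms(1-4))
  then have "L (e - f) + Vprod (x - y) = 0" by (simp add: assms(5))
  from decomposition_unique[OF _ _ this] assms show "e = f" "x = y"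
    by (simp_all add: closed_csubspaceD[OF E_closed] closed_csubspaceD[OF K_closed])
qed

text \<open>A factor \<open>X\<close> of \<open>V\<close> maps the wandering subspace \<open>W\<close> into \<open>W \<oplus> V W\<close>. These are the two coefficients;
  in the power series model \<open>X\<close> is multiplication by \<open>coeff0 X + z coeff1 X\<close>.\<close>

definition coeff0 :: "('k \<Rightarrow> 'k) \<Rightarrow> 'a \<Rightarrow> 'a" where
  "coeff0 X e = Linv (X (L e) - Vprod (Vstar (X (L e))))"

definition coeff1 :: "('k \<Rightarrow> 'k) \<Rightarrow> 'a \<Rightarrow> 'a" where
  "coeff1 X e = Linv (Vstar (X (L e)))"

text \<open>The two factors play symmetric roles. The lemmas are applied to \<open>V i\<close> with its cofactor and to the
  cofactor with \<open>V i\<close>.\<close>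

definition factorization :: "('k \<Rightarrow> 'k) \<Rightarrow> ('k \<Rightarrow> 'k) \<Rightarrow> bool" where
  "factorization X Y \<longleftrightarrow> isometric_on K X \<and> isometric_on K Y \<and>
     (\<forall>x\<in>K. X (Y x) = Vprod x \<and> Y (X x) = Vprod x)"

lemma factorization_sym: "factorization X Y \<Longrightarrow> factorization Y X"
  by (auto simp: factorization_def)

lemma factorization_Vprod:
  assumes "factorization X Y" "x \<in> K"
  shows "X (Vprod x) = Vprod (X x)"
proof -
  have "X (Vprod x) = X (Y (X x))" using assms by (simp add: factorization_def)
  also have "\<dots> = Vprod (X x)"
    using assms isometric_onD(1)[of K X x] unfolding factorization_def by blast
  finally show ?thesis .
qed

text \<open>There are no higher terms: \<open>X W\<close> is orthogonal to \<open>V\<^sup>2 K = X V Y K\<close>, because \<open>X\<close> is isometric and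
  \<open>W\<close> is orthogonal to \<open>V K\<close>.\<close>

lemma factorization_decomposition:
  assumes XY: "factorization X Y" and e: "e \<in> E"
  shows "coeff0 X e \<in> E" "coeff1 X e \<in> E" "X (L e) = L (coeff0 X e) + Vprod (L (coeff1 X e))"
proof -
  have X: "isometric_on K X" and Y: "isometric_on K Y" using XY by (auto simp: factorization_def)
  let ?w = "X (L e)" and ?b = "Vstar (X (L e))"
  have wK: "?w \<in> K" by (intro isometric_onD(1)[OF X] L_mem e)
  have bK: "?b \<in> K" by (intro Vstar_mem wK)
  have aK: "?w - Vprod ?b \<in> K" by (intro closed_csubspaceD[OF K_closed] wK Vprod_mem bK)
  have "Vstar ?b = 0"
  proof (rule cinner_left_ext[OF K_closed])
    fix y assume y: "y \<in> K"
    have Yy: "Y y \<in> K" using Y y by (rule isometric_onD)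
    have "cinner (Vstar ?b) y = cinner ?w (Vprod (Vprod y))"
      by (simp add: cinner_Vstar y bK wK Vprod_mem)
    also have "Vprod (Vprod y) = X (Vprod (Y y))"
      using factorization_Vprod[OF XY Yy] XY y by (simp add: factorization_def)
    also have "cinner ?w (X (Vprod (Y y))) = cinner (L e) (Vprod (Y y))"
      by (intro isometric_on_cinner[OF X K_closed] L_mem e Vprod_mem Yy)
    also have "\<dots> = 0" by (intro L_orthogonal Yy e)
    finally show "cinner (Vstar ?b) y = cinner 0 y" by simp
  qed (simp_all add: Vstar_mem bK closed_csubspaceD[OF K_closed])
  note b = Linv[OF bK this]
  have "Vstar (?w - Vprod ?b) = 0" by (simp add: Vstar_diff wK bK Vprod_mem Vstar_Vprod)
  note a = Linv[OF aK this]
  show "coeff0 X e \<in> E" "coeff1 X e \<in> E" "X (L e) = L (coeff0 X e) + Vprod (L (coeff1 X e))"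
    using a b by (simp_all add: coeff0_def coeff1_def)
qed

lemmas coeff_mem = factorization_decomposition(1,2)

lemma coeff_add:
  assumes XY: "factorization X Y" and e: "e \<in> E" "f \<in> E"
  shows "coeff0 X (e + f) = coeff0 X e + coeff0 X f" "coeff1 X (e + f) = coeff1 X e + coeff1 X f"
proof -
  have X: "isometric_on K X" using XY by (auto simp: factorization_def)
  have ef: "e + f \<in> E" by (intro closed_csubspaceD[OF E_closed] e)
  note c = coeff_mem[OF XY e(1)] coeff_mem[OF XY e(2)] coeff_mem[OF XY ef]
  have "X (L (e + f)) = X (L e) + X (L f)"
    by (simp add: L_add e isometric_onD(4)[OF X] L_mem)
  then have "L (coeff0 X (e + f)) + Vprod (L (coeff1 X (e + f)))
      = L (coeff0 X e + coeff0 X f) + Vprod (L (coeff1 X e + coeff1 X f))"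
    unfolding factorization_decomposition(3)[OF XY e(1)] factorization_decomposition(3)[OF XY e(2)]
      factorization_decomposition(3)[OF XY ef]
    using c by (simp add: L_add Vprod_linear L_mem algebra_simps)
  note d = decomposition_unique2[OF _ _ _ _ this]
  show "coeff0 X (e + f) = coeff0 X e + coeff0 X f"
    by (rule d(1)) (use c in \<open>auto intro!: L_mem closed_csubspaceD[OF E_closed]\<close>)
  have "L (coeff1 X (e + f)) = L (coeff1 X e + coeff1 X f)"
    by (rule d(2)) (use c in \<open>auto intro!: L_mem closed_csubspaceD[OF E_closed]\<close>)
  then have "L (coeff1 X (e + f) - (coeff1 X e + coeff1 X f)) = 0"
    using c by (simp add: L_diff closed_csubspaceD[OF E_closed])
  then have "coeff1 X (e + f) - (coeff1 X e + coeff1 X f) = 0"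
    by (rule L_eq_0[rotated]) (use c in \<open>auto intro!: closed_csubspaceD[OF E_closed]\<close>)
  then show "coeff1 X (e + f) = coeff1 X e + coeff1 X f" by simp
qed

text \<open>The first two identities compare the coefficients in \<open>\<langle>X w, X w'\<rangle> = \<langle>w, w'\<rangle>\<close> and
  \<open>\<langle>X w, X V w'\<rangle> = \<langle>w, V w'\<rangle> = 0\<close>. The last one reads \<open>\<langle>V w, Y w'\<rangle> = \<langle>Y X w, Y w'\<rangle> = \<langle>X w, w'\<rangle>\<close>.\<close>

lemma coeff_cinner:
  assumes XY: "factorization X Y" and e: "e \<in> E" and f: "f \<in> E"
  shows "cinner (coeff0 X e) (coeff0 X f) + cinner (coeff1 X e) (coeff1 X f) = cinner e f"
    "cinner (coeff1 X e) (coeff0 X f) = 0"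
    "cinner (coeff0 X e) f = cinner e (coeff1 Y f)"
proof -
  have X: "isometric_on K X" using XY by (auto simp: factorization_def)
  note YX = factorization_sym[OF XY]
  note c = coeff_mem[OF XY e] coeff_mem[OF XY f] coeff_mem[OF YX e] coeff_mem[OF YX f]
  note s = cinner_linear_simps Vprod_linear L_orthogonal cinner_Vprod L_cinner L_mem Vprod_mem c e f
  have "cinner (X (L e)) (X (L f)) = cinner (L e) (L f)"
    by (intro isometric_on_cinner[OF X K_closed] L_mem e f)
  then show "cinner (coeff0 X e) (coeff0 X f) + cinner (coeff1 X e) (coeff1 X f) = cinner e f"
    unfolding factorization_decomposition(3)[OF XY e] factorization_decomposition(3)[OF XY f]
    by (simp add: s)
  have "cinner (X (L e)) (X (Vprod (L f))) = cinner (L e) (Vprod (L f))"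
    by (intro isometric_on_cinner[OF X K_closed] L_mem Vprod_mem e f)
  then have "cinner (X (L e)) (Vprod (X (L f))) = 0"
    by (simp add: factorization_Vprod[OF XY] s)
  then show "cinner (coeff1 X e) (coeff0 X f) = 0"
    unfolding factorization_decomposition(3)[OF XY e] factorization_decomposition(3)[OF XY f]
    by (simp add: s)
  have "cinner (X (L e)) (X (Y (L f))) = cinner (L e) (Y (L f))"
    using isometric_onD(1)[of K Y "L f"] XY
    by (intro isometric_on_cinner[OF X K_closed] L_mem e) (auto simp: factorization_def L_mem f)
  then have "cinner (X (L e)) (Vprod (L f)) = cinner (L e) (Y (L f))"
    using XY f by (simp add: factorization_def L_mem)
  then have "cinner (coeff1 X e) f = cinner e (coeff0 Y f)"
    unfolding factorization_decomposition(3)[OF XY e] factorization_decomposition(3)[OF YX f]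
    by (simp add: s)
  have "cinner (Y (X (L e))) (Y (L f)) = cinner (X (L e)) (L f)"
    using isometric_onD(1)[OF X, of "L e"] YX
    by (intro isometric_on_cinner[OF _ K_closed] L_mem f) (auto simp: factorization_def L_mem e)
  then have "cinner (Vprod (L e)) (Y (L f)) = cinner (X (L e)) (L f)"
    using XY e by (simp add: factorization_def L_mem)
  then show "cinner (coeff0 X e) f = cinner e (coeff1 Y f)"
    unfolding factorization_decomposition(3)[OF XY e] factorization_decomposition(3)[OF YX f]
    by (simp add: s)
qed

end


section \<open>The projections and unitaries of a dilation\<close>

context wandering_embedding
begin

lemma factorization_V:
  assumes "i \<in> {1..n}"
  shows "factorization (V i) (cofactor n V i)"
  unfolding factorization_def Vprod_def cofactor_def
  using V.factor_cofactor[OF assms]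
  by (auto simp: cofactor_def intro: V_isometric[OF assms] isometric_on_monomial[OF V_isometric])

text \<open>The pencil of \<open>V i\<close> is \<open>A i + z B i\<close>, that of the cofactor is \<open>Bs i + z As i\<close>. The names anticipate
  that \<open>As i\<close> and \<open>Bs i\<close> are the adjoints of \<open>A i\<close> and \<open>B i\<close>.\<close>

definition "A i = coeff0 (V i)"
definition "B i = coeff1 (V i)"
definition "As i = coeff1 (cofactor n V i)"
definition "Bs i = coeff0 (cofactor n V i)"

context
  fixes i assumes i: "i \<in> {1..n}"
begin

lemma AB_mem: "e \<in> E \<Longrightarrow> A i e \<in> E" "e \<in> E \<Longrightarrow> B i e \<in> E" "e \<in> E \<Longrightarrow> As i e \<in> E" "e \<in> E \<Longrightarrow> Bs i e \<in> E"
  unfolding A_def B_def As_def Bs_def by (rule coeff_mem[OF factorization_V[OF i]] coeff_mem[OF factorization_sym[OF factorization_V[OF i]]]; assumption)+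

lemma V_L: "e \<in> E \<Longrightarrow> V i (L e) = L (A i e) + Vprod (L (B i e))"
  unfolding A_def B_def by (rule factorization_decomposition(3)[OF factorization_V[OF i]])

lemma AB_adjoint:
  assumes "e \<in> E" "x \<in> E"
  shows "cinner (A i e) x = cinner e (As i x)" "cinner (B i e) x = cinner e (Bs i x)"
    "cinner (As i e) x = cinner e (A i x)" "cinner (Bs i e) x = cinner e (B i x)"
proof -
  have *: "cinner (A i e) x = cinner e (As i x)" "cinner (Bs i e) x = cinner e (B i x)"
    if "e \<in> E" "x \<in> E" for e x
    using coeff_cinner(3)[OF factorization_V[OF i] that]
      coeff_cinner(3)[OF factorization_sym[OF factorization_V[OF i]] that]
    by (simp_all add: A_def B_def As_def Bs_def)
  show "cinner (A i e) x = cinner e (As i x)" "cinner (Bs i e) x = cinner e (B i x)"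
    using *[OF assms] by simp_all
  show "cinner (B i e) x = cinner e (Bs i x)" "cinner (As i e) x = cinner e (A i x)"
    using *[OF assms(2,1)] by (metis cinner_commute)+
qed

lemma AB_add:
  assumes "e \<in> E" "x \<in> E"
  shows "A i (e + x) = A i e + A i x" "B i (e + x) = B i e + B i x"
    "As i (e + x) = As i e + As i x" "Bs i (e + x) = Bs i e + Bs i x"
  using coeff_add[OF factorization_V[OF i] assms] coeff_add[OF factorization_sym[OF factorization_V[OF i]] assms] by (simp_all add: A_def B_def As_def Bs_def)

lemma AB_0: "A i 0 = 0" "B i 0 = 0"
  using AB_add(1,2)[of 0 0] closed_csubspaceD(1)[OF E_closed] by simp_all

lemma AB_scaleC:
  assumes "e \<in> E"
  shows "A i (a *\<^sub>C e) = a *\<^sub>C A i e" "B i (a *\<^sub>C e) = a *\<^sub>C B i e"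
  by (rule cinner_left_ext[OF E_closed];
      simp add: AB_mem AB_adjoint cinner_scaleC_left assms closed_csubspaceD[OF E_closed])+

text \<open>Those with the adjoint on the left express that \<open>V i\<close> is isometric, the others that its cofactor is.\<close>

lemma AB_identities:
  assumes "e \<in> E"
  shows "As i (A i e) + Bs i (B i e) = e" "A i (As i e) + B i (Bs i e) = e"
    "As i (B i e) = 0" "Bs i (A i e) = 0" "A i (Bs i e) = 0" "B i (As i e) = 0"
proof -
  note c = closed_csubspaceD[OF E_closed] AB_mem assms
  have X: "cinner (A i e) (A i x) + cinner (B i e) (B i x) = cinner e x"
    "cinner (B i e) (A i x) = 0" "cinner (A i e) (B i x) = 0" if "e \<in> E" "x \<in> E" for e x
    using coeff_cinner(1,2)[OF factorization_V[OF i] that] coeff_cinner(2)[OF factorization_V[OF i] that(2,1)]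
    by (simp_all add: A_def B_def cinner_eq_0_commute)
  have Y: "cinner (As i e) (As i x) + cinner (Bs i e) (Bs i x) = cinner e x"
    "cinner (As i e) (Bs i x) = 0" "cinner (Bs i e) (As i x) = 0" if "e \<in> E" "x \<in> E" for e x
    using coeff_cinner(1,2)[OF factorization_sym[OF factorization_V[OF i]] that] coeff_cinner(2)[OF factorization_sym[OF factorization_V[OF i]] that(2,1)]
    by (simp_all add: As_def Bs_def cinner_eq_0_commute add.commute)
  show "As i (A i e) + Bs i (B i e) = e" "As i (B i e) = 0" "Bs i (A i e) = 0"
    by (rule cinner_left_ext[OF E_closed]; simp add: c AB_adjoint(3,4) X cinner_add_left)+
  show "A i (As i e) + B i (Bs i e) = e" "A i (Bs i e) = 0" "B i (As i e) = 0"
    by (rule cinner_left_ext[OF E_closed]; simp add: c AB_adjoint(1,2) Y cinner_add_left)+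
qed

end

text \<open>\<open>P i = B\<^sup>* B\<close> projects to the initial space of the partial isometry \<open>B i\<close>, and \<open>A i\<close> is a partial
  isometry from the kernel of \<open>P i\<close> to the complement of the range of \<open>B i\<close>. So \<open>U i\<close> is unitary,
  with \<open>A i = U i (I - P i)\<close> and \<open>B i = U i P i\<close>.\<close>

definition P :: "nat \<Rightarrow> 'a \<Rightarrow> 'a" where "P = (\<lambda>i\<in>{1..n}. \<lambda>e\<in>E. Bs i (B i e))"
definition U :: "nat \<Rightarrow> 'a \<Rightarrow> 'a" where "U = (\<lambda>i\<in>{1..n}. \<lambda>e\<in>E. A i e + B i e)"

context
  fixes i assumes i: "i \<in> {1..n}"
begin

lemmas mem_i = AB_mem[OF i] closed_csubspaceD[OF E_closed]

lemma AB_bounded: "e \<in> E \<Longrightarrow> (norm (A i e))\<^sup>2 + (norm (B i e))\<^sup>2 = (norm e)\<^sup>2"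
  using coeff_cinner(1)[OF factorization_V[OF i], of e e]
  by (simp add: norm_squared_Re_cinner A_def B_def plus_complex.simps(1)[symmetric] del: plus_complex.simps)

lemma U_apply: "e \<in> E \<Longrightarrow> U i e = A i e + B i e"
  and P_apply: "e \<in> E \<Longrightarrow> P i e = Bs i (B i e)"
  using i by (simp_all add: U_def P_def)

lemma P_mem: "e \<in> E \<Longrightarrow> P i e \<in> E" and U_mem: "e \<in> E \<Longrightarrow> U i e \<in> E"
  by (simp_all add: P_apply U_apply mem_i)

lemma norm_U: "e \<in> E \<Longrightarrow> norm (U i e) = norm e"
proof -
  assume e: "e \<in> E"
  have "cinner (A i e) (B i e) = 0"
    by (simp add: AB_adjoint[OF i] AB_identities[OF i] e mem_i)
  then have "(norm (U i e))\<^sup>2 = (norm e)\<^sup>2"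
    using AB_bounded[OF e] by (simp add: U_apply e norm_add_squared_orthogonal)
  then show ?thesis by simp
qed

lemma U_add: "e \<in> E \<Longrightarrow> x \<in> E \<Longrightarrow> U i (e + x) = U i e + U i x"
  by (simp add: U_apply mem_i AB_add[OF i])

lemma U_bop: "U i \<in> bop E"
proof (rule bopI[where C = 1])
  show "U i \<in> extensional E" using i by (simp add: U_def)
  show "U i (a *\<^sub>C e) = a *\<^sub>C U i e" if "e \<in> E" for a e
    using that by (simp add: U_apply mem_i AB_scaleC[OF i] scaleC_add_right)
qed (simp_all add: U_mem norm_U U_add)

lemma adj_U: "e \<in> E \<Longrightarrow> adj E (U i) e = As i e + Bs i e"
  by (rule adj_unique[OF E_closed])
    (simp_all add: mem_i U_apply cinner_linear_simps AB_adjoint[OF i])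

lemma U_unitary: "U i \<in> unitaries E"
proof -
  have "adj E (U i) (U i e) = e" "U i (adj E (U i) e) = e" if e: "e \<in> E" for e
  proof -
    have "adj E (U i) (U i e) = (As i (A i e) + Bs i (B i e)) + (As i (B i e) + Bs i (A i e))"
      by (simp add: adj_U U_apply AB_add[OF i] mem_i e del: AB_identities)
    then show "adj E (U i) (U i e) = e" by (simp add: AB_identities[OF i] e)
    have "U i (adj E (U i) e) = (A i (As i e) + B i (Bs i e)) + (A i (Bs i e) + B i (As i e))"
      by (simp add: adj_U U_apply AB_add[OF i] mem_i e)
    then show "U i (adj E (U i) e) = e" by (simp add: AB_identities[OF i] e)
  qed
  with U_bop show ?thesis by (simp add: unitaries_def)
qed

lemma B_P: "e \<in> E \<Longrightarrow> B i (P i e) = B i e" and A_P: "e \<in> E \<Longrightarrow> A i (P i e) = 0"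
  and U_P: "e \<in> E \<Longrightarrow> U i (P i e) = B i e"
proof -
  assume e: "e \<in> E"
  show "B i (P i e) = B i e"
    using AB_identities(2)[OF i, of "B i e"] e
    by (simp add: P_apply mem_i AB_identities[OF i] AB_0[OF i])
  moreover show "A i (P i e) = 0"
    by (simp add: P_apply e mem_i AB_identities[OF i])
  ultimately show "U i (P i e) = B i e" by (simp add: U_apply P_mem e)
qed

lemma P_adj_U: "e \<in> E \<Longrightarrow> P i (adj E (U i) e) = Bs i e"
  and perp_P_adj_U: "e \<in> E \<Longrightarrow> perp E (P i) (adj E (U i) e) = As i e"
proof -
  assume e: "e \<in> E"
  have Ue: "adj E (U i) e \<in> E" by (simp add: adj_U e mem_i)
  have "B i (adj E (U i) e) = B i (Bs i e)"
    by (simp add: adj_U e mem_i AB_add[OF i] AB_identities[OF i])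
  moreover have "Bs i e = Bs i (A i (As i e) + B i (Bs i e))"
    by (simp add: AB_identities[OF i] e)
  then have "Bs i e = Bs i (B i (Bs i e))"
    by (simp only: AB_add[OF i] mem_i e) (simp add: AB_identities[OF i] mem_i e)
  ultimately show "P i (adj E (U i) e) = Bs i e" by (simp add: P_apply Ue)
  then show "perp E (P i) (adj E (U i) e) = As i e"
    using Ue by (simp add: perp_def adj_U e)
qed

lemma P_projection: "P i \<in> projections E"
proof -
  have ext: "P i \<in> extensional E" using i by (simp add: P_def)
  have sa: "cinner (P i e) x = cinner e (P i x)" if "e \<in> E" "x \<in> E" for e x
    using that by (simp add: P_apply AB_adjoint[OF i] mem_i)
  have idem: "P i (P i e) = P i e" if "e \<in> E" for e
    using P_apply[OF P_mem[OF that]] B_P[OF that] P_apply[OF that] by simp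
  have nrm: "norm (P i e) \<le> 1 * norm e" if e: "e \<in> E" for e
  proof -
    have "(norm (P i e))\<^sup>2 = (norm (B i e))\<^sup>2"
      using sa[of e "P i e"] idem[OF e] e
      by (simp add: norm_squared_Re_cinner sa P_mem P_apply[of e] AB_adjoint[OF i] mem_i)
    also have "\<dots> \<le> (norm e)\<^sup>2" using AB_bounded[OF e] zero_le_power2[of "norm (A i e)"] by linarith
    finally show ?thesis by (simp add: power2_le_iff_abs_le)
  qed
  have sc: "P i (a *\<^sub>C e) = a *\<^sub>C P i e" if e: "e \<in> E" for a e
    by (rule cinner_left_ext[OF E_closed]) (simp_all add: P_mem mem_i e sa cinner_scaleC_left)
  have "P i \<in> bop E"
    by (rule bopI[OF P_mem ext _ sc nrm]) (simp_all add: P_apply mem_i AB_add[OF i])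
  moreover have "adj E (P i) = P i"
  proof (rule extensionalityI[OF _ ext])
    show "adj E (P i) \<in> extensional E" by (simp add: adj_def)
    show "adj E (P i) e = P i e" if "e \<in> E" for e
      by (rule adj_unique[OF E_closed that P_mem[OF that] sa[OF _ that]])
  qed
  ultimately show ?thesis using idem by (simp add: projections_def)
qed

text \<open>The expansion of \<open>J h\<close> along \<open>W, V W, V\<^sup>2 W, \<dots>\<close> begins with \<open>L D h + V L D T\<^sup>* h\<close>, and \<open>V i L e\<close> has
  only these two components. The identity is the component in \<open>W\<close> of \<open>V\<^sub>i\<^sup>* J h = J T\<^sub>i\<^sup>* h\<close>.\<close>

lemma D_adj_T: "D (adj UNIV (T i) h) = As i (D h) + Bs i (D (Tstar h))"
proof (rule cinner_right_ext[OF E_closed])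
  fix e assume e: "e \<in> E"
  have J: "J x = L (D x) + Vprod (J (Tstar x))" for x by (simp add: L_D)
  note s = cinner_linear_simps L_orthogonal cinner_Vprod L_cinner L_mem Vprod_mem Vprod_linear D_mem e J_mem mem_i
  have "cinner (L x) (J y) = cinner x (D y)" if "x \<in> E" for x y
    unfolding J[of y] by (simp add: s that)
  note LJ = this
  have "cinner e (D (adj UNIV (T i) h)) = cinner (L e) (J (adj UNIV (T i) h))"
    by (simp add: LJ e)
  also have "\<dots> = cinner (V i (L e)) (J h)"
    using cinner_adj_right[OF K_closed isometries_in_bop[OF V_isometry[OF i]] L_mem[OF e] J_mem]
    by (simp add: adj_V_J[OF i])
  also have "\<dots> = cinner (L (A i e)) (J h) + cinner (Vprod (L (B i e))) (J h)"
    by (simp add: V_L[OF i e] cinner_add_left)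
  also have "cinner (Vprod (L (B i e))) (J h) = cinner (L (B i e)) (J (Tstar h))"
    unfolding J[of h] by (simp add: s)
  finally show "cinner e (D (adj UNIV (T i) h)) = cinner e (As i (D h) + Bs i (D (Tstar h)))"
    by (simp add: LJ mem_i e AB_adjoint[OF i] D_mem cinner_add_right)
qed (simp_all add: D_mem mem_i)

end

text \<open>These are the coefficients of \<open>V\<^sub>i V\<^sub>j L e = V\<^sub>j V\<^sub>i L e\<close> in \<open>W \<oplus> V W \<oplus> V\<^sup>2 W\<close>.\<close>

lemma AB_commute:
  assumes i: "i \<in> {1..n}" and j: "j \<in> {1..n}" and e: "e \<in> E"
  shows "A i (A j e) = A j (A i e)" "B i (B j e) = B j (B i e)"
    "B i (A j e) + A i (B j e) = B j (A i e) + A j (B i e)"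
proof -
  have exp: "V i (V j (L e)) = L (A i (A j e)) + Vprod (L (B i (A j e) + A i (B j e)) + Vprod (L (B i (B j e))))"
    if i: "i \<in> {1..n}" and j: "j \<in> {1..n}" for i j
  proof -
    note m = AB_mem[OF i] AB_mem[OF j] e
    have "V i (V j (L e)) = V i (L (A j e)) + Vprod (V i (L (B j e)))"
      using V_isometric[OF i] factorization_Vprod[OF factorization_V[OF i] L_mem[of "B j e"]]
      by (simp add: V_L[OF j e] isometric_onD(4) L_mem Vprod_mem m)
    then show ?thesis
      by (simp add: V_L[OF i] m L_add Vprod_linear L_mem Vprod_mem closed_csubspaceD[OF K_closed] add_ac)
  qed
  note m = AB_mem[OF i] AB_mem[OF j] e L_mem Vprod_mem closed_csubspaceD[OF K_closed] closed_csubspaceD[OF E_closed]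
  have "V i (V j (L e)) = V j (V i (L e))"
    using V.V_commute i j L_mem[OF e] by (simp add: commuting_def)
  note eq = this[unfolded exp[OF i j] exp[OF j i]]
  show "A i (A j e) = A j (A i e)"
    by (rule decomposition_unique2(1)[OF _ _ _ _ eq]) (simp_all add: m)
  have eq2: "L (B i (A j e) + A i (B j e)) + Vprod (L (B i (B j e))) = L (B j (A i e) + A j (B i e)) + Vprod (L (B j (B i e)))"
    by (rule decomposition_unique2(2)[OF _ _ _ _ eq]) (simp_all add: m)
  show "B i (A j e) + A i (B j e) = B j (A i e) + A j (B i e)"
    by (rule decomposition_unique2(1)[OF _ _ _ _ eq2]) (simp_all add: m)
  have "L (B i (B j e)) = L (B j (B i e))"
    by (rule decomposition_unique2(2)[OF _ _ _ _ eq2]) (simp_all add: m)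
  then have "B i (B j e) - B j (B i e) = 0"
    by (intro L_eq_0) (simp_all add: m L_diff)
  then show "B i (B j e) = B j (B i e)" by simp
qed

lemma U_commuting: "commuting E n U"
  unfolding commuting_def
proof (intro ballI)
  fix i j e assume ij: "i \<in> {1..n}" "j \<in> {1..n}" and e: "e \<in> E"
  have exp: "U i (U j e) = A i (A j e) + (B i (A j e) + A i (B j e)) + B i (B j e)"
    if i: "i \<in> {1..n}" and j: "j \<in> {1..n}" for i j
    by (simp add: U_apply[OF i] U_apply[OF j] U_mem[OF j] e AB_mem[OF j] AB_add[OF i]
        closed_csubspaceD[OF E_closed] add_ac)
  show "U i (U j e) = U j (U i e)"
    unfolding exp[OF ij] exp[OF ij(2,1)] AB_commute[OF ij e] ..
qed

lemma As_commute:
  assumes i: "i \<in> {1..n}" and j: "j \<in> {1..n}" and e: "e \<in> E"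
  shows "As i (As j e) = As j (As i e)"
  by (rule cinner_left_ext[OF E_closed])
    (simp_all add: AB_mem[OF i] AB_mem[OF j] e AB_adjoint[OF i] AB_adjoint[OF j] AB_commute(1)[OF i j])

sublocale U: commuting_family E n U
  by unfold_locales (simp_all add: U_mem U_commuting)

text \<open>The vanishing sum is \<open>L c\<^sub>0 + V r\<close>, where \<open>r\<close> is the sum for the shifted coefficients, and \<open>W\<close> is orthogonal
  to \<open>V K\<close>.\<close>

lemma expansion_unique:
  assumes "\<And>k. c k \<in> E" "(\<Sum>k\<le>m. monomial n V (\<lambda>_. k) (L (c k))) = 0" "k \<le> m"
  shows "c k = 0"
  using assms
proof (induction m arbitrary: c k)
  case 0
  then show ?case using L_eq_0 by (simp add: V.monomial_0)
next
  case (Suc m)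
  let ?r = "\<Sum>k\<le>m. monomial n V (\<lambda>_. k) (L (c (Suc k)))"
  have mem: "monomial n V (\<lambda>_. k) (L (c j)) \<in> K" for k j
    using Suc.prems(1) by (intro V.monomial_mem L_mem)
  have "monomial n V (\<lambda>_. Suc k) (L (c (Suc k))) = Vprod (monomial n V (\<lambda>_. k) (L (c (Suc k))))" for k
    using Suc.prems(1) by (simp add: Vprod_def V.monomial_add L_mem)
  then have "(\<Sum>k\<le>m. monomial n V (\<lambda>_. Suc k) (L (c (Suc k)))) = Vprod ?r"
    using bop_sum[OF Vprod_bop K_closed, of "{..m}" "\<lambda>k. monomial n V (\<lambda>_. k) (L (c (Suc k)))"]
    by (simp add: mem closed_csubspaceD[OF K_closed])
  then have "L (c 0) + Vprod ?r = 0"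
    using Suc.prems(2) by (simp add: sum.atMost_Suc_shift V.monomial_0 del: sum.atMost_Suc)
  note z = decomposition_unique[OF Suc.prems(1) _ this]
  have r: "?r \<in> K" by (intro closed_csubspaceD[OF K_closed] mem)
  show ?case
  proof (cases k)
    case 0
    then show ?thesis using z(1)[OF r] by simp
  next
    case (Suc k')
    show ?thesis
      using Suc.IH[of "\<lambda>k. c (Suc k)" k'] Suc.prems z(2)[OF r] Suc by simp
  qed
qed

text \<open>The projection \<open>P l\<close> conjugated by \<open>U\<^sub>l\<^sub>-\<^sub>1 \<dots> U\<^sub>1\<close>; these are the summands in the last identity of
  \<^const>\<open>dilation_data\<close>.\<close>

definition Q :: "nat \<Rightarrow> 'a \<Rightarrow> 'a" where
  "Q l e = oprod (\<lambda>i. adj E (U i)) [1..<l] (P l (oprod U (rev [1..<l]) e))"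

lemma oprod_U_mem: "m \<le> n \<Longrightarrow> e \<in> E \<Longrightarrow> oprod U (rev [1..<Suc m]) e \<in> E"
  by (rule oprod_mem) (auto intro: U_mem)

lemma Q_mem: "l \<in> {1..n} \<Longrightarrow> e \<in> E \<Longrightarrow> Q l e \<in> E"
  unfolding Q_def
  by (intro oprod_mem[where S = E] P_mem adj_mem[OF E_closed U_bop]) (auto intro!: U_mem)

lemma oprod_U_Q:
  assumes "Suc m \<le> n" "e \<in> E"
  shows "oprod U (rev [1..<Suc m]) (Q (Suc m) e) = P (Suc m) (oprod U (rev [1..<Suc m]) e)"
  unfolding Q_def
proof (rule oprod_rev_inverse[where S = E])
  show "P (Suc m) (oprod U (rev [1..<Suc m]) e) \<in> E"
    using assms by (intro P_mem oprod_U_mem) auto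
  show "U i (adj E (U i) x) = x" if "i \<in> set [1..<Suc m]" "x \<in> E" for i x
    using U_unitary[of i] that assms by (auto simp: unitaries_def)
  show "adj E (U i) x \<in> E" if "i \<in> set [1..<Suc m]" "x \<in> E" for i x
    using that assms by (intro adj_mem[OF E_closed U_bop]) auto
qed

lemma oprod_U_add:
  assumes "m \<le> n" "e \<in> E" "x \<in> E"
  shows "oprod U (rev [1..<Suc m]) (e + x) = oprod U (rev [1..<Suc m]) e + oprod U (rev [1..<Suc m]) x"
  using assms(1)
proof (induction m)
  case (Suc m)
  have "oprod U (rev [1..<Suc m]) e \<in> E" "oprod U (rev [1..<Suc m]) x \<in> E"
    using Suc.prems assms by (intro oprod_U_mem; simp)+
  with Suc show ?case unfolding oprod_rev_snoc by (simp add: U_add)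
qed simp

text \<open>Expand \<open>V\<^sub>m \<dots> V\<^sub>1 L e\<close> as \<open>\<Sum>\<^sub>k V\<^sup>k L c\<^sub>k\<close>. The value at \<open>1\<close> of the polynomial \<open>\<Sum>\<^sub>k z\<^sup>k c\<^sub>k\<close> is
  \<open>U\<^sub>m \<dots> U\<^sub>1 e\<close>, and its derivative at \<open>1\<close> is \<open>U\<^sub>m \<dots> U\<^sub>1 (Q\<^sub>1 + \<dots> + Q\<^sub>m) e\<close>.\<close>

lemma product_expansion:
  assumes e: "e \<in> E" and "m \<le> n"
  shows "\<exists>c. (\<forall>k. c k \<in> E) \<and> (\<forall>k>m. c k = 0) \<and>
    oprod V (rev [1..<Suc m]) (L e) = (\<Sum>k\<le>m. monomial n V (\<lambda>_. k) (L (c k))) \<and>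
    (\<Sum>k\<le>m. c k) = oprod U (rev [1..<Suc m]) e \<and>
    (\<Sum>k\<le>m. of_nat k *\<^sub>C c k) = oprod U (rev [1..<Suc m]) (\<Sum>l=1..m. Q l e)"
  using assms(2)
proof (induction m)
  case 0
  show ?case
    by (rule exI[of _ "\<lambda>k. if k = 0 then e else 0"])
      (simp add: e closed_csubspaceD[OF E_closed] V.monomial_0)
next
  case (Suc m)
  define W where "W = oprod U (rev [1..<Suc m])"
  obtain c where c: "\<And>k. c k \<in> E" "\<And>k. k > m \<Longrightarrow> c k = 0"
    "oprod V (rev [1..<Suc m]) (L e) = (\<Sum>k\<le>m. monomial n V (\<lambda>_. k) (L (c k)))"
    "(\<Sum>k\<le>m. c k) = W e" "(\<Sum>k\<le>m. of_nat k *\<^sub>C c k) = W (\<Sum>l=1..m. Q l e)"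
    using Suc unfolding W_def by auto
  define i where "i = Suc m"
  have i: "i \<in> {1..n}" using Suc.prems by (simp add: i_def)
  have We: "W e \<in> E" unfolding W_def by (rule oprod_U_mem) (use Suc.prems e in auto)
  \<comment> \<open>the coefficients of \<open>(A i + z B i) \<Sum>\<^sub>k z\<^sup>k c\<^sub>k\<close>\<close>
  define d where "d k = A i (c k) + (case k of 0 \<Rightarrow> 0 | Suc j \<Rightarrow> B i (c j))" for k
  note m = AB_mem[OF i] c(1) closed_csubspaceD[OF E_closed]
  note A0 = AB_0(1)[OF i] and B0 = AB_0(2)[OF i]
  have A_sum: "A i (\<Sum>k\<in>I. g k) = (\<Sum>k\<in>I. A i (g k))" and B_sum: "B i (\<Sum>k\<in>I. g k) = (\<Sum>k\<in>I. B i (g k))"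
    if "\<And>k. g k \<in> E" for g :: "nat \<Rightarrow> 'a" and I
    by (induction I rule: infinite_finite_induct; simp add: A0 B0 AB_add[OF i] that closed_csubspaceD[OF E_closed])+
  have dE: "d k \<in> E" for k by (auto simp: d_def m split: nat.split)
  moreover have "d k = 0" if "k > Suc m" for k
    using that by (auto simp: d_def c(2) A0 B0 split: nat.split)
  moreover have "oprod V (rev [1..<Suc (Suc m)]) (L e) = (\<Sum>k\<le>Suc m. monomial n V (\<lambda>_. k) (L (d k)))"
  proof -
    have lin: "monomial n V (\<lambda>_. k) (x + y) = monomial n V (\<lambda>_. k) x + monomial n V (\<lambda>_. k) y"
      if "x \<in> K" "y \<in> K" for x y k
      by (rule isometric_onD(4)[OF isometric_on_monomial[OF V_isometric] that])
    have lin0: "monomial n V (\<lambda>_. k) 0 = 0" for k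
      using lin[of 0 0 k] closed_csubspaceD(1)[OF K_closed] by simp
    have step: "V i (monomial n V (\<lambda>_. k) (L x)) = monomial n V (\<lambda>_. k) (L (A i x)) + monomial n V (\<lambda>_. Suc k) (L (B i x))"
      if "x \<in> E" for x k
    proof -
      have "V i (monomial n V (\<lambda>_. k) (L x)) = monomial n V (\<lambda>_. k) (V i (L x))"
        using V.factor_monomial[OF i L_mem[OF that]] by simp
      moreover have "monomial n V (\<lambda>_. k) (Vprod (L (B i x))) = monomial n V (\<lambda>_. Suc k) (L (B i x))"
        by (simp add: Vprod_def V.monomial_add L_mem m that)
      ultimately show ?thesis by (simp add: V_L[OF i] that lin L_mem Vprod_mem m)
    qed
    have "oprod V (rev [1..<Suc (Suc m)]) (L e) = V i (\<Sum>k\<le>m. monomial n V (\<lambda>_. k) (L (c k)))"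
      unfolding oprod_rev_snoc c(3) i_def ..
    also have "\<dots> = (\<Sum>k\<le>m. V i (monomial n V (\<lambda>_. k) (L (c k))))"
      by (rule bop_sum[OF isometries_in_bop[OF V_isometry[OF i]] K_closed]) (intro V.monomial_mem L_mem c)
    also have "\<dots> = (\<Sum>k\<le>m. monomial n V (\<lambda>_. k) (L (A i (c k)))) + (\<Sum>k\<le>m. monomial n V (\<lambda>_. Suc k) (L (B i (c k))))"
      by (simp add: step c sum.distrib)
    also have "(\<Sum>k\<le>m. monomial n V (\<lambda>_. k) (L (A i (c k)))) = (\<Sum>k\<le>Suc m. monomial n V (\<lambda>_. k) (L (A i (c k))))"
      by (simp add: c(2) A0 L_0 lin0)
    also have "(\<Sum>k\<le>m. monomial n V (\<lambda>_. Suc k) (L (B i (c k))))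
        = (\<Sum>k\<le>Suc m. monomial n V (\<lambda>_. k) (L (case k of 0 \<Rightarrow> 0 | Suc j \<Rightarrow> B i (c j))))"
      by (simp add: sum.atMost_Suc_shift L_0 lin0 del: sum.atMost_Suc)
    also have "(\<Sum>k\<le>Suc m. monomial n V (\<lambda>_. k) (L (A i (c k)))) + \<dots> = (\<Sum>k\<le>Suc m. monomial n V (\<lambda>_. k) (L (d k)))"
      unfolding sum.distrib[symmetric] d_def
      by (rule sum.cong) (auto simp: L_add m L_mem lin split: nat.split)
    finally show ?thesis .
  qed
  moreover have sum_d: "(\<Sum>k\<le>Suc m. d k) = U i (W e)"
  proof -
    have "(\<Sum>k\<le>Suc m. d k) = (\<Sum>k\<le>m. A i (c k)) + (\<Sum>k\<le>m. B i (c k))"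
      unfolding d_def sum.distrib
      unfolding sum.atMost_Suc_shift[of "\<lambda>k. case k of 0 \<Rightarrow> 0 | Suc j \<Rightarrow> B i (c j)"]
      by (simp add: c(2) A0)
    also have "\<dots> = U i (W e)"
      by (simp add: A_sum[symmetric] B_sum[symmetric] c U_apply[OF i] We)
    finally show ?thesis .
  qed
  moreover have "(\<Sum>k\<le>Suc m. of_nat k *\<^sub>C d k) = oprod U (rev [1..<Suc (Suc m)]) (\<Sum>l=1..Suc m. Q l e)"
  proof -
    define R where "R = (\<Sum>l=1..m. Q l e)"
    have R: "R \<in> E" unfolding R_def by (intro closed_csubspaceD[OF E_closed] Q_mem e) (use Suc.prems in auto)
    have Qi: "Q i e \<in> E" by (rule Q_mem[OF i e])
    have WR: "W R \<in> E" unfolding W_def by (rule oprod_U_mem) (use Suc.prems R in auto)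
    have mm: "of_nat k *\<^sub>C c k \<in> E" for k by (intro m)
    have "(\<Sum>k\<le>Suc m. of_nat k *\<^sub>C d k)
        = (\<Sum>k\<le>Suc m. of_nat k *\<^sub>C A i (c k)) + (\<Sum>k\<le>Suc m. of_nat k *\<^sub>C (case k of 0 \<Rightarrow> 0 | Suc j \<Rightarrow> B i (c j)))"
      by (simp add: d_def scaleC_add_right sum.distrib)
    also have "(\<Sum>k\<le>Suc m. of_nat k *\<^sub>C A i (c k)) = (\<Sum>k\<le>m. A i (of_nat k *\<^sub>C c k))"
      by (simp add: c(2) A0 AB_scaleC[OF i] c(1))
    also have "(\<Sum>k\<le>Suc m. of_nat k *\<^sub>C (case k of 0 \<Rightarrow> 0 | Suc j \<Rightarrow> B i (c j)))
        = (\<Sum>k\<le>m. B i (of_nat k *\<^sub>C c k)) + (\<Sum>k\<le>m. B i (c k))"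
      by (simp add: sum.atMost_Suc_shift AB_scaleC[OF i] c(1) scaleC_add_left scaleC_one sum.distrib add.commute
          del: sum.atMost_Suc)
    also have "(\<Sum>k\<le>m. A i (of_nat k *\<^sub>C c k)) + \<dots> = U i (W R) + B i (W e)"
      by (simp add: A_sum[symmetric] B_sum[symmetric] mm c(1,4) c(5)[folded R_def] U_apply[OF i] WR add.assoc)
    also have "B i (W e) = U i (W (Q i e))"
    proof -
      have "W (Q i e) = P i (W e)"
        unfolding W_def i_def by (rule oprod_U_Q[OF _ e]) (use Suc.prems in simp)
      then show ?thesis by (simp add: U_P[OF i We])
    qed
    also have "U i (W R) + U i (W (Q i e)) = U i (W (R + Q i e))"
      using oprod_U_add[of m R "Q i e"] Suc.prems R Qi WR oprod_U_mem[of m "Q i e"]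
      by (simp add: U_add[OF i] W_def del: upt_Suc)
    also have "\<dots> = oprod U (rev [1..<Suc (Suc m)]) (\<Sum>l=1..Suc m. Q l e)"
      unfolding oprod_rev_snoc by (simp add: W_def i_def R_def del: upt_Suc)
    finally show ?thesis .
  qed
  ultimately show ?case
    unfolding oprod_rev_snoc W_def i_def by blast
qed

text \<open>For \<open>m = n\<close> the left-hand side is \<open>V L e\<close>, so the polynomial is \<open>z e\<close>, with value and derivative \<open>e\<close>
  at \<open>1\<close>.\<close>

lemma U_product_and_derivative:
  assumes e: "e \<in> E"
  shows "oprod U [1..<Suc n] e = e" "oprod U [1..<Suc n] (\<Sum>l=1..n. Q l e) = e"
proof -
  obtain c where c: "\<And>k. c k \<in> E" "\<And>k. k > n \<Longrightarrow> c k = 0"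
    "oprod V (rev [1..<Suc n]) (L e) = (\<Sum>k\<le>n. monomial n V (\<lambda>_. k) (L (c k)))"
    "(\<Sum>k\<le>n. c k) = oprod U (rev [1..<Suc n]) e"
    "(\<Sum>k\<le>n. of_nat k *\<^sub>C c k) = oprod U (rev [1..<Suc n]) (\<Sum>l=1..n. Q l e)"
    using product_expansion[OF e order_refl] by blast
  have revV: "oprod V (rev [1..<Suc n]) x = Vprod x" if "x \<in> K" for x
    unfolding Vprod_def monomial_1 by (rule V.product_rev[OF that])
  have revU: "oprod U (rev [1..<Suc n]) x = oprod U [1..<Suc n] x" if "x \<in> E" for x
    by (rule U.product_rev[OF that])
  \<comment> \<open>the coefficients of \<open>V\<^sub>n \<dots> V\<^sub>1 L e - V L e = 0\<close>\<close>
  define b where "b k = c k - (if k = 1 then e else 0)" for k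
  have bE: "b k \<in> E" for k by (simp add: b_def c e closed_csubspaceD[OF E_closed])
  have mono_diff: "monomial n V (\<lambda>_. k) (x - y) = monomial n V (\<lambda>_. k) x - monomial n V (\<lambda>_. k) y"
    if "x \<in> K" "y \<in> K" for x y k
    by (rule isometric_on_diff[OF isometric_on_monomial[OF V_isometric] K_closed that])
  have mono_0: "monomial n V (\<lambda>_. k) 0 = 0" for k
    using mono_diff[of 0 0 k] closed_csubspaceD(1)[OF K_closed] by simp
  have "(\<Sum>k\<le>n. monomial n V (\<lambda>_. k) (L (if k = 1 then e else 0))) = Vprod (L e)"
  proof -
    have "(\<Sum>k\<le>n. monomial n V (\<lambda>_. k) (L (if k = 1 then e else 0))) = (\<Sum>k\<le>n. if k = 1 then Vprod (L e) else 0)"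
      by (rule sum.cong) (auto simp: Vprod_def L_0 mono_0)
    then show ?thesis using n_pos by simp
  qed
  then have "(\<Sum>k\<le>n. monomial n V (\<lambda>_. k) (L (b k))) = 0"
    using c(3) revV[OF L_mem[OF e]]
    by (simp add: b_def L_diff c(1) e closed_csubspaceD[OF E_closed] mono_diff L_mem sum_subtractf
        del: upt_Suc)
  note b0 = expansion_unique[OF bE this]
  have ck: "c k = (if k = 1 then e else 0)" for k
  proof (cases "k \<le> n")
    case True
    then show ?thesis using b0[of k] by (simp add: b_def split: if_splits)
  next
    case False
    then show ?thesis using c(2)[of k] n_pos by auto
  qed
  have "(\<Sum>k\<le>n. c k) = e" using n_pos by (simp add: ck)
  then show U: "oprod U [1..<Suc n] e = e" using c(4) revU[OF e] by simp
  have "(\<Sum>k\<le>n. of_nat k *\<^sub>C c k) = (\<Sum>k\<le>n. if k = 1 then e else 0)"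
    by (rule sum.cong) (auto simp: ck scaleC_one)
  then have "(\<Sum>k\<le>n. of_nat k *\<^sub>C c k) = e" using n_pos by simp
  moreover have QE: "(\<Sum>l=1..n. Q l e) \<in> E" by (intro closed_csubspaceD[OF E_closed] Q_mem e) auto
  ultimately show "oprod U [1..<Suc n] (\<Sum>l=1..n. Q l e) = e" using c(5) revU[OF QE] by simp
qed

lemma Q_sum: "e \<in> E \<Longrightarrow> (\<Sum>l=1..n. Q l e) = e"
  using U_product_and_derivative(2)[of e]
    U_product_and_derivative(1)[of "\<Sum>l=1..n. Q l e"] closed_csubspaceD(6)[OF E_closed, of "{1..n}" "\<lambda>l. Q l e"] Q_mem
  by simp

lemma dilation_data_PU: "dilation_data n T P U"
proof -
  have c2: "perp E (P i) (adj E (U i) (perp E (P j) (adj E (U j) x)))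
      = perp E (P j) (adj E (U j) (perp E (P i) (adj E (U i) x)))"
    if "i \<in> {1..n}" "j \<in> {1..n}" "x \<in> E" for i j x
    using that by (simp add: perp_P_adj_U AB_mem As_commute[of i j] del: atLeastAtMost_iff)
  have c3: "U i (P i (U j (P j x))) = U j (P j (U i (P i x)))"
    if "i \<in> {1..n}" "j \<in> {1..n}" "x \<in> E" for i j x
    using that by (simp add: U_P AB_mem AB_commute(2)[of i j] del: atLeastAtMost_iff)
  have ext: "P \<in> extensional {1..n}" "U \<in> extensional {1..n}"
    by (simp_all add: P_def U_def)
  have PU: "P \<in> {1..n} \<rightarrow>\<^sub>E projections E" "U \<in> {1..n} \<rightarrow>\<^sub>E unitaries E"
    using P_projection U_unitary by (simp_all add: PiE_iff ext del: One_nat_def)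
  show ?thesis
    unfolding dilation_data_def Let_def oprod_T D_def[symmetric] E_def[symmetric] Tstar_def[symmetric]
    using PU U_commuting U_product_and_derivative(1) c2 c3 Q_sum
    by (intro conjI ballI allI) (simp_all add: D_adj_T perp_P_adj_U P_adj_U D_mem Q_def del: atLeastAtMost_iff upt_Suc)
qed

end


section \<open>The dilation on power series given by projections and unitaries\<close>

lemma ell2_eqI: "(\<And>k. Rep_ell2 x k = Rep_ell2 y k) \<Longrightarrow> x = y"
  by (metis Rep_ell2_inject ext)

lemma Rep_ell2_add: "Rep_ell2 (x + y) k = Rep_ell2 x k + Rep_ell2 y k"
  by transfer simp

lemma Rep_ell2_scaleC: "Rep_ell2 (a *\<^sub>C x) k = a *\<^sub>C Rep_ell2 x k"
  by transfer simp

lemma Rep_ell2_0: "Rep_ell2 0 k = 0"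
  by transfer simp

lemma summable_ell2: "summable (\<lambda>k. (norm (Rep_ell2 x k))\<^sup>2)"
  using Rep_ell2[of x] by simp

lemma norm_ell2_sums: "(\<lambda>k. (norm (Rep_ell2 x k))\<^sup>2) sums (norm x)\<^sup>2"
  using summable_sums[OF summable_ell2[of x]] suminf_nonneg[OF summable_ell2[of x]]
  by (simp add: norm_ell2.rep_eq)

lemma cinner_ell2_sums: "(\<lambda>k. cinner (Rep_ell2 x k) (Rep_ell2 y k)) sums cinner x y"
  using summable_sums[OF square_summable_cinner[OF summable_ell2 summable_ell2], of x y]
  by (simp add: cinner_ell2.rep_eq)

lemma norm_ell2_eqI:
  assumes "(\<lambda>k. (norm (Rep_ell2 x k))\<^sup>2) sums r\<^sup>2" "r \<ge> 0"
  shows "norm x = r"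
proof -
  have "(norm x)\<^sup>2 = r\<^sup>2" using sums_unique2[OF norm_ell2_sums assms(1)] .
  then show ?thesis using assms(2) by (simp add: power2_eq_iff_nonneg)
qed

lemma isometric_dilation_single:
  assumes "csubspace K" "closed K" "Vector_Spaces.linear scaleC scaleC J" "\<And>h. norm (J h) = norm h"
    "range J \<subseteq> K" "V \<in> isometries K" "\<And>k h. J ((T ^^ k) h) = proj_onto (range J) ((V ^^ k) (J h))"
  shows "isometric_dilation K J 1 (\<lambda>_. V) (\<lambda>_. T)"
  using assms by (simp add: isometric_dilation_def commuting_def)

locale dilation_model = contraction_tuple n T
  for n and T :: "nat \<Rightarrow> 'a::chilbert_space \<Rightarrow> 'a" +
  fixes P U :: "nat \<Rightarrow> 'a \<Rightarrow> 'a"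
  assumes data: "dilation_data n T P U"
begin

definition Ustar :: "nat \<Rightarrow> 'a \<Rightarrow> 'a" where "Ustar i = adj E (U i)"

lemma U_commuting: "commuting E n U"
  and U_product: "e \<in> E \<Longrightarrow> oprod U [1..<Suc n] e = e"
  and data_D: "i \<in> {1..n} \<Longrightarrow>
    D (adj UNIV (T i) h) = perp E (P i) (Ustar i (D h)) + P i (Ustar i (D (Tstar h)))"
  and data_perp: "i \<in> {1..n} \<Longrightarrow> j \<in> {1..n} \<Longrightarrow> e \<in> E \<Longrightarrow>
    perp E (P i) (Ustar i (perp E (P j) (Ustar j e))) = perp E (P j) (Ustar j (perp E (P i) (Ustar i e)))"
  and data_P: "i \<in> {1..n} \<Longrightarrow> j \<in> {1..n} \<Longrightarrow> e \<in> E \<Longrightarrow> U i (P i (U j (P j e))) = U j (P j (U i (P i e)))"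
  and data_sum: "e \<in> E \<Longrightarrow> (\<Sum>m=1..n. oprod Ustar [1..<m] (P m (oprod U (rev [1..<m]) e))) = e"
  using data unfolding dilation_data_def Let_def oprod_T D_def[symmetric] E_def[symmetric]
    Tstar_def[symmetric] Ustar_def[symmetric] by blast+

lemma P_projection: "i \<in> {1..n} \<Longrightarrow> P i \<in> projections E"
  and U_unitary: "i \<in> {1..n} \<Longrightarrow> U i \<in> unitaries E"
  and extensional_PU: "P \<in> extensional {1..n}" "U \<in> extensional {1..n}"
  using data unfolding dilation_data_def Let_def oprod_T E_def[symmetric] PiE_iff by blast+

definition A :: "nat \<Rightarrow> 'a \<Rightarrow> 'a" where "A i e = U i (e - P i e)"
definition B :: "nat \<Rightarrow> 'a \<Rightarrow> 'a" where "B i e = U i (P i e)"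
definition As :: "nat \<Rightarrow> 'a \<Rightarrow> 'a" where "As i e = perp E (P i) (Ustar i e)"
definition Bs :: "nat \<Rightarrow> 'a \<Rightarrow> 'a" where "Bs i e = P i (Ustar i e)"

lemmas E_mem = closed_csubspaceD[OF E_closed]

context
  fixes i assumes i: "i \<in> {1..n}"
begin

lemma U_bop: "U i \<in> bop E" and P_bop: "P i \<in> bop E" and Ustar_bop: "Ustar i \<in> bop E"
proof -
  show U: "U i \<in> bop E" using U_unitary[OF i] by (simp add: unitaries_def)
  show "P i \<in> bop E" using P_projection[OF i] by (simp add: projections_def)
  show "Ustar i \<in> bop E" unfolding Ustar_def by (rule adj_in_bop[OF E_closed U])
qed

lemma U_mem: "e \<in> E \<Longrightarrow> U i e \<in> E" and P_mem: "e \<in> E \<Longrightarrow> P i e \<in> E" and Ustar_mem: "e \<in> E \<Longrightarrow> Ustar i e \<in> E"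
  using bopD(1)[OF U_bop] bopD(1)[OF P_bop] bopD(1)[OF Ustar_bop] by blast+

lemma U_Ustar: "e \<in> E \<Longrightarrow> U i (Ustar i e) = e" and Ustar_U: "e \<in> E \<Longrightarrow> Ustar i (U i e) = e"
  using U_unitary[OF i] by (simp_all add: unitaries_def Ustar_def)

lemma cinner_U: "e \<in> E \<Longrightarrow> x \<in> E \<Longrightarrow> cinner (U i e) x = cinner e (Ustar i x)"
  unfolding Ustar_def by (simp add: cinner_adj_right[OF E_closed U_bop])

lemma cinner_P: "e \<in> E \<Longrightarrow> x \<in> E \<Longrightarrow> cinner (P i e) x = cinner e (P i x)"
  using cinner_adj_right[OF E_closed P_bop] P_projection[OF i] by (simp add: projections_def)

lemma P_idem: "e \<in> E \<Longrightarrow> P i (P i e) = P i e"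
  using P_projection[OF i] by (simp add: projections_def)

lemma cinner_U_U: "e \<in> E \<Longrightarrow> x \<in> E \<Longrightarrow> cinner (U i e) (U i x) = cinner e x"
  by (simp add: cinner_U U_mem Ustar_U)

lemma AB_mem: "e \<in> E \<Longrightarrow> A i e \<in> E" "e \<in> E \<Longrightarrow> B i e \<in> E" "e \<in> E \<Longrightarrow> As i e \<in> E" "e \<in> E \<Longrightarrow> Bs i e \<in> E"
  by (simp_all add: A_def B_def As_def Bs_def perp_def U_mem P_mem Ustar_mem E_mem)

lemma AB_linear:
  assumes "e \<in> E" "x \<in> E"
  shows "A i (e + x) = A i e + A i x" "B i (e + x) = B i e + B i x"
  by (simp_all add: A_def B_def bopD(3)[OF P_bop] bopD(3)[OF U_bop] P_mem assms E_mem
      bop_diff[OF U_bop E_closed])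

lemma AB_scaleC:
  assumes "e \<in> E"
  shows "A i (a *\<^sub>C e) = a *\<^sub>C A i e" "B i (a *\<^sub>C e) = a *\<^sub>C B i e"
  by (simp_all add: A_def B_def bopD(4)[OF P_bop] bopD(4)[OF U_bop] P_mem assms E_mem
      bop_diff[OF U_bop E_closed] scaleC_diff_right)

lemma AB_adjoint:
  assumes "e \<in> E" "x \<in> E"
  shows "cinner (A i e) x = cinner e (As i x)" "cinner (B i e) x = cinner e (Bs i x)"
  using assms by (simp_all add: A_def B_def As_def Bs_def perp_def cinner_U E_mem P_mem Ustar_mem
      cinner_diff_left cinner_diff_right cinner_P)

lemma AB_add: "e \<in> E \<Longrightarrow> A i e + B i e = U i e"
  by (simp add: A_def B_def bop_diff[OF U_bop E_closed] P_mem)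

lemma AB_orthogonal: "e \<in> E \<Longrightarrow> x \<in> E \<Longrightarrow> cinner (A i e) (B i x) = 0"
  by (simp add: A_def B_def cinner_U_U E_mem P_mem cinner_diff_left cinner_P P_idem)

lemma norm_AB: "e \<in> E \<Longrightarrow> (norm (A i e))\<^sup>2 + (norm (B i e))\<^sup>2 = (norm e)\<^sup>2"
proof -
  assume e: "e \<in> E"
  have "(norm (A i e))\<^sup>2 + (norm (B i e))\<^sup>2 = (norm (U i e))\<^sup>2"
    using norm_add_squared_orthogonal[OF AB_orthogonal[OF e e]] by (simp add: AB_add e)
  also have "\<dots> = (norm e)\<^sup>2" by (simp add: norm_squared_Re_cinner cinner_U_U e)
  finally show ?thesis .
qed

lemma AB_0: "A i 0 = 0" "B i 0 = 0"
  using AB_linear(1,2)[of 0 0] E_mem(1) by simp_all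

end

text \<open>The multipliers commute: the extreme coefficients by hypothesis, the middle one because the sum
  of all coefficients is \<open>U\<^sub>i U\<^sub>j\<close>.\<close>

lemma AB_commute:
  assumes i: "i \<in> {1..n}" and j: "j \<in> {1..n}" and e: "e \<in> E"
  shows "A i (A j e) = A j (A i e)" "B i (B j e) = B j (B i e)"
    "A i (B j e) + B i (A j e) = A j (B i e) + B j (A i e)"
proof -
  note m = AB_mem[OF i] AB_mem[OF j] e
  show 1: "A i (A j e) = A j (A i e)"
  proof (rule cinner_left_ext[OF E_closed])
    show "cinner (A i (A j e)) z = cinner (A j (A i e)) z" if "z \<in> E" for z
      using data_perp[OF i j that] that
      by (simp add: AB_adjoint[OF i] AB_adjoint[OF j] m As_def[symmetric])
  qed (simp_all add: m)
  show 2: "B i (B j e) = B j (B i e)"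
    unfolding B_def by (rule data_P[OF i j e])
  have exp: "U i (U j e) = A i (A j e) + (A i (B j e) + B i (A j e)) + B i (B j e)"
    if i: "i \<in> {1..n}" and j: "j \<in> {1..n}" for i j
  proof -
    note m = AB_mem[OF i] AB_mem[OF j] e
    have "U i (U j e) = A i (A j e + B j e) + B i (A j e + B j e)"
      by (simp add: AB_add[OF i] AB_add[OF j] U_mem[OF j] e)
    then show ?thesis by (simp add: AB_linear[OF i] m add_ac)
  qed
  have "U i (U j e) = U j (U i e)"
    using U_commuting i j e unfolding commuting_def by blast
  then show "A i (B j e) + B i (A j e) = A j (B i e) + B j (A i e)"
    unfolding exp[OF i j] exp[OF j i] 1 2 by simp
qed

sublocale U: commuting_family E n U
  by unfold_locales (simp_all add: U_mem U_commuting)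

definition K :: "'a ell2 set" where "K = {x. \<forall>k. Rep_ell2 x k \<in> E}"

text \<open>The entry before the first one is \<open>0\<close>.\<close>

definition prev :: "(nat \<Rightarrow> 'a) \<Rightarrow> nat \<Rightarrow> 'a" where
  "prev f k = (case k of 0 \<Rightarrow> 0 | Suc j \<Rightarrow> f j)"

text \<open>Multiplication by \<open>A i + z B i\<close> on square-summable power series with coefficients in \<open>E\<close>.\<close>

definition V :: "nat \<Rightarrow> 'a ell2 \<Rightarrow> 'a ell2" where
  "V i = (\<lambda>x\<in>K. Abs_ell2 (\<lambda>k. A i (Rep_ell2 x k) + B i (prev (Rep_ell2 x) k)))"

definition J :: "'a \<Rightarrow> 'a ell2" where
  "J h = Abs_ell2 (\<lambda>k. D ((Tstar ^^ k) h))"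

lemma K_closed: "closed_csubspace K"
  unfolding closed_csubspace_def
proof
  show "csubspace K"
    by (rule cvec.subspaceI) (simp_all add: K_def Rep_ell2_add Rep_ell2_scaleC Rep_ell2_0 E_mem)
  show "closed K"
    unfolding closed_sequential_limits
  proof (intro allI impI)
    fix f :: "nat \<Rightarrow> 'a ell2" and l assume f: "(\<forall>m. f m \<in> K) \<and> f \<longlonglongrightarrow> l"
    have "Rep_ell2 l k \<in> E" for k
    proof -
      have "(\<lambda>m. norm (f m - l)) \<longlonglongrightarrow> 0" using f by (intro tendsto_norm_zero LIM_zero) simp
      then have "(\<lambda>m. Rep_ell2 (f m) k - Rep_ell2 l k) \<longlonglongrightarrow> 0"
        by (rule Lim_null_comparison[rotated])
          (simp add: Rep_ell2_diff[symmetric] norm_Rep_ell2_le)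
      then have "(\<lambda>m. Rep_ell2 (f m) k) \<longlonglongrightarrow> Rep_ell2 l k" by (rule LIM_zero_cancel)
      then show ?thesis
        using closed_sequentially[OF E_mem(7), of "\<lambda>m. Rep_ell2 (f m) k"] f by (simp add: K_def)
    qed
    then show "l \<in> K" by (simp add: K_def)
  qed
qed

lemma K_Rep: "x \<in> K \<Longrightarrow> Rep_ell2 x k \<in> E"
  by (simp add: K_def)

lemma prev_mem: "(\<And>k. f k \<in> E) \<Longrightarrow> prev f k \<in> E"
  by (simp add: prev_def E_mem split: nat.split)

lemma prev_Suc [simp]: "prev f (Suc k) = f k" and prev_0 [simp]: "prev f 0 = 0"
  by (simp_all add: prev_def)

lemma sums_prev:
  fixes g :: "'a \<Rightarrow> 'b::real_normed_vector"
  assumes "(\<lambda>k. g (f k)) sums s" "g 0 = 0"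
  shows "(\<lambda>k. g (prev f k)) sums s"
  using sums_Suc[of "\<lambda>k. g (prev f k)" s] assms by simp

text \<open>Multiplication by \<open>A i + z B i\<close> is isometric, because in every entry the two summands are orthogonal and
  \<open>\<parallel>A i e\<parallel>\<^sup>2 + \<parallel>B i e\<parallel>\<^sup>2 = \<parallel>e\<parallel>\<^sup>2\<close>.\<close>

lemma V_sums:
  assumes i: "i \<in> {1..n}" and x: "x \<in> K"
  shows "(\<lambda>k. (norm (A i (Rep_ell2 x k) + B i (prev (Rep_ell2 x) k)))\<^sup>2) sums (norm x)\<^sup>2"
proof -
  let ?x = "Rep_ell2 x"
  have le: "(norm (A i (?x k)))\<^sup>2 \<le> (norm (?x k))\<^sup>2" "(norm (B i (?x k)))\<^sup>2 \<le> (norm (?x k))\<^sup>2" for k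
    using norm_AB[OF i K_Rep[OF x, of k]] zero_le_power2[of "norm (A i (?x k))"]
      zero_le_power2[of "norm (B i (?x k))"] by linarith+
  have a: "summable (\<lambda>k. (norm (A i (?x k)))\<^sup>2)" and b: "summable (\<lambda>k. (norm (B i (?x k)))\<^sup>2)"
    by (rule summable_comparison_test'[OF summable_ell2[of x], of 0]; use le in simp)+
  have b': "(\<lambda>k. (norm (B i (prev ?x k)))\<^sup>2) sums (\<Sum>k. (norm (B i (?x k)))\<^sup>2)"
    by (rule sums_prev[of "\<lambda>y. (norm (B i y))\<^sup>2"]) (simp_all add: b AB_0[OF i] summable_sums)
  have "(\<lambda>k. (norm (A i (?x k)))\<^sup>2 + (norm (B i (?x k)))\<^sup>2) sums
      ((\<Sum>k. (norm (A i (?x k)))\<^sup>2) + (\<Sum>k. (norm (B i (?x k)))\<^sup>2))"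
    by (intro sums_add summable_sums a b)
  then have tot: "(\<Sum>k. (norm (A i (?x k)))\<^sup>2) + (\<Sum>k. (norm (B i (?x k)))\<^sup>2) = (norm x)\<^sup>2"
    using sums_unique2[OF norm_ell2_sums[of x]] by (simp add: norm_AB[OF i K_Rep[OF x]])
  have "(\<lambda>k. (norm (A i (?x k)))\<^sup>2 + (norm (B i (prev ?x k)))\<^sup>2) sums (norm x)\<^sup>2"
    unfolding tot[symmetric] by (intro sums_add summable_sums a b')
  then show ?thesis
    by (simp add: norm_add_squared_orthogonal AB_orthogonal[OF i] K_Rep[OF x] prev_mem)
qed

lemma Rep_V:
  assumes "i \<in> {1..n}" "x \<in> K"
  shows "Rep_ell2 (V i x) k = A i (Rep_ell2 x k) + B i (prev (Rep_ell2 x) k)"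
proof -
  have "Rep_ell2 (V i x) = (\<lambda>k. A i (Rep_ell2 x k) + B i (prev (Rep_ell2 x) k))"
    using V_sums[OF assms] assms(2) by (simp add: V_def Abs_ell2_inverse sums_iff)
  then show ?thesis by simp
qed

lemma V_mem: "i \<in> {1..n} \<Longrightarrow> x \<in> K \<Longrightarrow> V i x \<in> K"
  by (simp add: K_def Rep_V AB_mem E_mem prev_mem del: atLeastAtMost_iff)

lemma prev_add: "prev (\<lambda>k. f k + g k) k = prev f k + prev g k"
  and prev_scaleC: "prev (\<lambda>k. a *\<^sub>C f k) k = a *\<^sub>C prev f k"
  by (simp_all add: prev_def split: nat.split)

lemma V_isometry:
  assumes i: "i \<in> {1..n}"
  shows "V i \<in> isometries K"
  unfolding isometries_iff isometric_on_def
proof (intro conjI ballI allI)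
  fix x y a assume x: "x \<in> K"
  show "V i x \<in> K" by (rule V_mem[OF i x])
  show "norm (V i x) = norm x"
    using V_sums[OF i x] by (intro norm_ell2_eqI) (simp_all add: Rep_V[OF i x])
  note m = K_Rep[OF x] prev_mem E_mem
  have ax: "a *\<^sub>C x \<in> K" using x by (intro closed_csubspaceD[OF K_closed])
  show "V i (a *\<^sub>C x) = a *\<^sub>C V i x"
    by (rule ell2_eqI)
      (simp add: Rep_V[OF i x] Rep_V[OF i ax] Rep_ell2_scaleC[abs_def] prev_scaleC AB_scaleC[OF i] m scaleC_add_right)
  assume y: "y \<in> K"
  have xy: "x + y \<in> K" using x y by (intro closed_csubspaceD[OF K_closed])
  show "V i (x + y) = V i x + V i y"
    by (rule ell2_eqI)
      (simp add: Rep_V[OF i x] Rep_V[OF i y] Rep_V[OF i xy] Rep_ell2_add[abs_def] prev_add AB_linear[OF i] m K_Rep[OF y] add_ac)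
qed (simp add: V_def)

lemma V_commuting: "commuting K n V"
  unfolding commuting_def
proof (intro ballI)
  fix i j x assume i: "i \<in> {1..n}" and j: "j \<in> {1..n}" and x: "x \<in> K"
  have exp: "Rep_ell2 (V i (V j x)) k = A i (A j (Rep_ell2 x k)) +
      (A i (B j (prev (Rep_ell2 x) k)) + B i (A j (prev (Rep_ell2 x) k))) + B i (B j (prev (prev (Rep_ell2 x)) k))"
    if i: "i \<in> {1..n}" and j: "j \<in> {1..n}" for i j k
    by (cases k)
      (simp_all add: Rep_V[OF i V_mem[OF j x]] Rep_V[OF j x] AB_linear[OF i] AB_mem[OF j] AB_0[OF i] AB_0[OF j]
        K_Rep[OF x] prev_mem E_mem add_ac)
  show "V i (V j x) = V j (V i x)"
    by (rule ell2_eqI)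
      (simp only: exp[OF i j] exp[OF j i] AB_commute[OF i j] K_Rep[OF x] prev_mem)
qed

sublocale V: commuting_family K n V
  by unfold_locales (simp_all add: V_mem V_commuting)

definition Q :: "nat \<Rightarrow> 'a \<Rightarrow> 'a" where
  "Q m e = oprod Ustar [1..<m] (P m (oprod U (rev [1..<m]) e))"

lemma oprod_U_mem: "m \<le> n \<Longrightarrow> e \<in> E \<Longrightarrow> oprod U (rev [1..<Suc m]) e \<in> E"
  by (rule oprod_mem) (auto intro: U_mem)

lemma cinner_oprod_U:
  assumes "set is \<subseteq> {1..n}" "e \<in> E" "x \<in> E"
  shows "cinner (oprod U (rev is) e) x = cinner e (oprod Ustar is x)"
  using assms
proof (induction "is" arbitrary: e)
  case (Cons i "is")
  have "j \<in> {1..n}" if "j \<in> set is" for j using Cons.prems that by auto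
  then have "oprod Ustar is x \<in> E"
    by (rule oprod_mem[OF Ustar_mem]) (use Cons.prems in simp_all)
  then show ?case
    using Cons by (simp add: oprod_append U_mem cinner_U)
qed simp

lemma Q_mem: "m \<in> {1..n} \<Longrightarrow> e \<in> E \<Longrightarrow> Q m e \<in> E"
  unfolding Q_def by (intro oprod_mem[where S = E] P_mem) (auto intro: U_mem Ustar_mem)

lemma oprod_U_Q:
  assumes "m \<in> {1..n}" "e \<in> E"
  shows "oprod U (rev [1..<m]) (Q m e) = P m (oprod U (rev [1..<m]) e)"
  unfolding Q_def
proof (rule oprod_rev_inverse[where S = E])
  show "P m (oprod U (rev [1..<m]) e) \<in> E"
    by (intro P_mem oprod_mem[where S = E]) (use assms in \<open>auto intro: U_mem\<close>)
  show "U i (Ustar i x) = x" "Ustar i x \<in> E" if "i \<in> set [1..<m]" "x \<in> E" for i x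
    using that assms by (auto intro: U_Ustar Ustar_mem)
qed

lemma cinner_Q:
  assumes m: "m \<in> {1..n}" and e: "e \<in> E" and x: "x \<in> E"
  shows "cinner (Q m e) x = cinner e (Q m x)"
proof -
  let ?W = "oprod U (rev [1..<m])"
  have W: "?W y \<in> E" if "y \<in> E" for y
    by (rule oprod_mem) (use m that in \<open>auto intro: U_mem\<close>)
  have sub: "set [1..<m] \<subseteq> {1..n}" using m by auto
  have "cinner e (Q m x) = cinner (P m (?W e)) (?W x)"
    unfolding Q_def cinner_P[OF m W[OF e] W[OF x]]
    by (rule cinner_oprod_U[OF sub e P_mem[OF m W[OF x]], symmetric])
  moreover have "cinner x (Q m e) = cinner (?W x) (P m (?W e))"
    unfolding Q_def using cinner_oprod_U[OF sub x P_mem[OF m W[OF e]]] by simp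
  ultimately show ?thesis by (metis cinner_commute)
qed

lemma Q_idem:
  assumes m: "m \<in> {1..n}" and e: "e \<in> E"
  shows "Q m (Q m e) = Q m e"
proof -
  have "oprod U (rev [1..<m]) e \<in> E"
    by (rule oprod_mem) (use assms in \<open>auto intro: U_mem\<close>)
  then show ?thesis
    unfolding Q_def[of m "Q m e"] oprod_U_Q[OF assms] by (simp add: P_idem[OF m] Q_def)
qed

lemma Q_sum: "e \<in> E \<Longrightarrow> (\<Sum>m=1..n. Q m e) = e"
  using data_sum by (simp add: Q_def)

text \<open>Projections with sum \<open>I\<close> satisfy \<open>\<parallel>x\<parallel>\<^sup>2 = \<Sum>\<^sub>l \<parallel>Q\<^sub>l x\<parallel>\<^sup>2\<close>. For \<open>x\<close> in the range of \<open>Q\<^sub>j\<close> the \<open>j\<close>-th term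
  is already \<open>\<parallel>x\<parallel>\<^sup>2\<close>, so the other ones vanish.\<close>

lemma Q_orthogonal:
  assumes j: "j \<in> {1..n}" and m: "m \<in> {1..n}" and "j \<noteq> m" and e: "e \<in> E"
  shows "Q m (Q j e) = 0"
proof -
  define x where "x = Q j e"
  have x: "x \<in> E" unfolding x_def by (rule Q_mem[OF j e])
  have sq: "(norm (Q l x))\<^sup>2 = Re (cinner (Q l x) x)" if "l \<in> {1..n}" for l
    using cinner_Q[OF that Q_mem[OF that x] x] by (simp add: norm_squared_Re_cinner Q_idem[OF that x])
  have "(norm x)\<^sup>2 = Re (cinner (\<Sum>l=1..n. Q l x) x)"
    unfolding Q_sum[OF x] by (rule norm_squared_Re_cinner)
  also have "\<dots> = (\<Sum>l=1..n. (norm (Q l x))\<^sup>2)"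
    by (simp add: cinner_sum_left sq)
  also have "\<dots> = (norm (Q j x))\<^sup>2 + (\<Sum>l\<in>{1..n}-{j}. (norm (Q l x))\<^sup>2)"
    using j by (simp add: sum.remove)
  also have "Q j x = x" unfolding x_def by (rule Q_idem[OF j e])
  finally have "(\<Sum>l\<in>{1..n}-{j}. (norm (Q l x))\<^sup>2) = 0" by simp
  then have "(norm (Q m x))\<^sup>2 = 0"
    using m assms(3) by (subst (asm) sum_nonneg_eq_0_iff) auto
  then show ?thesis by (simp add: x_def)
qed

lemma Q_add: "m \<in> {1..n} \<Longrightarrow> e \<in> E \<Longrightarrow> x \<in> E \<Longrightarrow> Q m (e + x) = Q m e + Q m x"
  by (rule cinner_left_ext[OF E_closed])
    (simp_all add: Q_mem E_mem cinner_Q cinner_add_left del: atLeastAtMost_iff)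

lemma Q_diff: "m \<in> {1..n} \<Longrightarrow> e \<in> E \<Longrightarrow> x \<in> E \<Longrightarrow> Q m (e - x) = Q m e - Q m x"
  using Q_add[of m "e - x" x] by (simp add: E_mem)

definition R :: "nat \<Rightarrow> 'a \<Rightarrow> 'a" where "R m e = (\<Sum>l=1..m. Q l e)"

lemma R_mem: "m \<le> n \<Longrightarrow> e \<in> E \<Longrightarrow> R m e \<in> E"
  unfolding R_def by (intro E_mem(6) Q_mem) auto

lemma Q_R:
  assumes "Suc m \<le> n" "e \<in> E"
  shows "Q (Suc m) (R m e) = 0"
proof -
  have Q0: "Q (Suc m) 0 = 0" using Q_add[of "Suc m" 0 0] assms E_mem(1) by simp
  have "Q (Suc m) (\<Sum>l\<in>I. Q l e) = 0" if "I \<subseteq> {1..m}" for I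
    using finite_subset[OF that finite_atLeastAtMost] that
  proof (induction I)
    case (insert l I)
    have "(\<Sum>l\<in>I. Q l e) \<in> E" by (intro E_mem(6) Q_mem assms) (use insert assms in auto)
    moreover have "Q l e \<in> E" by (intro Q_mem assms) (use insert assms in auto)
    moreover have "Q (Suc m) (Q l e) = 0"
      by (rule Q_orthogonal) (use insert assms in auto)
    ultimately show ?case
      using insert assms by (simp add: Q_add)
  qed (simp add: Q0)
  then show ?thesis unfolding R_def by blast
qed

text \<open>Because \<open>P\<^sub>m\<^sub>+\<^sub>1 U\<^sub>m \<dots> U\<^sub>1 = U\<^sub>m \<dots> U\<^sub>1 Q\<^sub>m\<^sub>+\<^sub>1\<close>, the unitaries can be moved to the left, and the partial
  product of the pencils is \<open>U\<^sub>m \<dots> U\<^sub>1 \<Prod>\<^sub>l (I - Q\<^sub>l + z Q\<^sub>l)\<close>. By orthogonality the product over \<open>l\<close> is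
  \<open>I - R\<^sub>m + z R\<^sub>m\<close> with \<open>R\<^sub>m = Q\<^sub>1 + \<dots> + Q\<^sub>m\<close>.\<close>

lemma Rep_partial_product:
  assumes "m \<le> n" and x: "x \<in> K"
  shows "Rep_ell2 (oprod V (rev [1..<Suc m]) x) k =
    oprod U (rev [1..<Suc m]) (Rep_ell2 x k - R m (Rep_ell2 x k) + R m (prev (Rep_ell2 x) k))"
  using assms(1)
proof (induction m arbitrary: k)
  case 0
  then show ?case by (simp add: R_def)
next
  case (Suc m)
  define i where "i = Suc m"
  have i: "i \<in> {1..n}" using Suc.prems by (simp add: i_def)
  define W where "W = oprod U (rev [1..<Suc m])"
  define y where "y k = Rep_ell2 x k - R m (Rep_ell2 x k) + R m (prev (Rep_ell2 x) k)" for k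
  have xE: "Rep_ell2 x k \<in> E" "prev (Rep_ell2 x) k \<in> E" for k
    by (simp_all add: K_Rep[OF x] prev_mem)
  have RE: "R m e \<in> E" if "e \<in> E" for e using Suc.prems that by (intro R_mem) auto
  have yE: "y k \<in> E" for k by (simp add: y_def xE RE E_mem)
  have WE: "W e \<in> E" if "e \<in> E" for e using Suc.prems that unfolding W_def by (intro oprod_U_mem) auto
  have W_add: "W (e + f) = W e + W f" if "e \<in> E" "f \<in> E" for e f
  proof -
    have "cinner (W (e + f)) z = cinner (W e + W f) z" if "z \<in> E" for z
      unfolding W_def cinner_add_left
      using cinner_oprod_U[of "[1..<Suc m]" _ z] \<open>e \<in> E\<close> \<open>f \<in> E\<close> that Suc.prems
      by (subst (1 2 3) cinner_oprod_U) (auto simp: cinner_add_left E_mem)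
    then show ?thesis
      by (intro cinner_left_ext[OF E_closed]) (simp_all add: WE that E_mem)
  qed
  have W_diff: "W (e - f) = W e - W f" if "e \<in> E" "f \<in> E" for e f
    using W_add[of "e - f" f] that by (simp add: E_mem)
  have PW: "P i (W e) = W (Q i e)" if "e \<in> E" for e
    using oprod_U_Q[OF i that] by (simp add: W_def i_def del: upt_Suc)
  have AW: "A i (W e) = U i (W (e - Q i e))" and BW: "B i (W e) = U i (W (Q i e))" if "e \<in> E" for e
    using that by (simp_all add: A_def B_def PW W_diff Q_mem[OF i])
  have mem: "oprod V (rev [1..<Suc m]) x \<in> K"
    by (rule oprod_mem) (use x Suc.prems V_mem in auto)
  have R0: "R m 0 = 0" and W0: "W 0 = 0" 
    using W_add[of 0 0] E_mem(1) Q_add[of _ 0 0] Suc.prems unfolding R_def by (auto intro!: sum.neutral)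
  have IH: "Rep_ell2 (oprod V (rev [1..<Suc m]) x) = (\<lambda>k. W (y k))"
    using Suc by (simp add: W_def y_def fun_eq_iff del: upt_Suc)
  have "Rep_ell2 (oprod V (rev [1..<Suc (Suc m)]) x) k = Rep_ell2 (V i (oprod V (rev [1..<Suc m]) x)) k"
    unfolding oprod_rev_snoc i_def ..
  also have "\<dots> = A i (W (y k)) + B i (prev (\<lambda>k. W (y k)) k)"
    unfolding Rep_V[OF i mem] IH ..
  also have "prev (\<lambda>k. W (y k)) k = W (prev y k)"
    by (cases k) (simp_all add: W0)
  also have "A i (W (y k)) + B i (W (prev y k)) = U i (W (y k - Q i (y k) + Q i (prev y k)))"
    by (simp add: AW BW yE prev_mem bopD(3)[OF U_bop[OF i], symmetric] WE Q_mem[OF i] E_mem W_add)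
  also have "Q i (y k) = Q i (Rep_ell2 x k)"
    using Q_R[of m] Suc.prems
    by (simp add: y_def i_def[symmetric] Q_add[OF i] Q_diff[OF i] xE RE E_mem)
  also have "Q i (prev y k) = Q i (prev (Rep_ell2 x) k)"
  proof (cases k)
    case (Suc j)
    then show ?thesis
      using Q_R[of m] Suc.prems \<open>Suc m \<le> n\<close>
      by (simp add: y_def i_def[symmetric] Q_add[OF i] Q_diff[OF i] xE RE E_mem)
  qed simp
  also have "y k - Q i (Rep_ell2 x k) + Q i (prev (Rep_ell2 x) k)
      = Rep_ell2 x k - R (Suc m) (Rep_ell2 x k) + R (Suc m) (prev (Rep_ell2 x) k)"
    by (simp add: y_def R_def i_def)
  finally show ?case unfolding oprod_rev_snoc W_def i_def .
qed

lemma Rep_product: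
  assumes x: "x \<in> K"
  shows "Rep_ell2 (oprod V [1..<Suc n] x) k = prev (Rep_ell2 x) k"
proof -
  have R: "R n e = e" if "e \<in> E" for e using Q_sum[OF that] by (simp add: R_def)
  have m: "Rep_ell2 x k \<in> E" "prev (Rep_ell2 x) k \<in> E"
    by (simp_all add: K_Rep[OF x] prev_mem)
  show ?thesis
    unfolding V.product_rev[OF x, symmetric] Rep_partial_product[OF order_refl x]
    using U_product[OF m(2)] U.product_rev[OF m(2)] by (simp add: R m del: upt_Suc)
qed

text \<open>The squared norms of the entries telescope, as \<open>\<parallel>D T\<^sup>*\<^sup>k h\<parallel>\<^sup>2 = \<parallel>T\<^sup>*\<^sup>k h\<parallel>\<^sup>2 - \<parallel>T\<^sup>*\<^sup>k\<^sup>+\<^sup>1 h\<parallel>\<^sup>2\<close>, and the limit term is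
  \<open>0\<close> because \<open>T\<close> is \<open>C\<^sub>\<cdot>\<^sub>0\<close>.\<close>

lemma Rep_J: "Rep_ell2 (J h) k = D ((Tstar ^^ k) h)"
  and norm_J: "norm (J h) = norm h"
proof -
  have "(\<lambda>k. (norm ((Tstar ^^ k) h))\<^sup>2) \<longlonglongrightarrow> 0"
    using tendsto_power[OF tendsto_norm[OF Tstar_pow_lim[of h]], of 2] by simp
  then have "(\<lambda>k. (norm ((Tstar ^^ k) h))\<^sup>2 - (norm ((Tstar ^^ Suc k) h))\<^sup>2) sums ((norm ((Tstar ^^ 0) h))\<^sup>2 - 0)"
    by (rule telescope_sums')
  then have s: "(\<lambda>k. (norm (D ((Tstar ^^ k) h)))\<^sup>2) sums (norm h)\<^sup>2"
    by (simp add: norm_D)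
  then have "Rep_ell2 (J h) = (\<lambda>k. D ((Tstar ^^ k) h))"
    by (simp add: J_def Abs_ell2_inverse sums_iff)
  then show "Rep_ell2 (J h) k = D ((Tstar ^^ k) h)" by simp
  show "norm (J h) = norm h"
    using s by (intro norm_ell2_eqI) (simp_all add: \<open>Rep_ell2 (J h) = _\<close>)
qed

lemma J_mem: "J h \<in> K"
  by (simp add: K_def Rep_J D_mem)

lemma Tstar_pow_linear: "(Tstar ^^ k) (x + y) = (Tstar ^^ k) x + (Tstar ^^ k) y"
  "(Tstar ^^ k) (a *\<^sub>C x) = a *\<^sub>C (Tstar ^^ k) x"
  by (induction k) (simp_all add: Tstar_linear)

lemma J_linear: "J (x + y) = J x + J y" "J (a *\<^sub>C x) = a *\<^sub>C J x"
  by (rule ell2_eqI; simp add: Rep_J Rep_ell2_add Rep_ell2_scaleC D_linear Tstar_pow_linear)+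

lemma cinner_J: "cinner (J x) (J y) = cinner x y"
  by (rule isometry_cinner[of UNIV]) (simp_all add: J_linear norm_J)

text \<open>The adjoint of multiplication by \<open>A i + z B i\<close> sends \<open>(x\<^sub>k)\<close> to \<open>(As i x\<^sub>k + Bs i x\<^sub>k\<^sub>+\<^sub>1)\<close>. For \<open>J h\<close> these entries are
  \<open>D T\<^sub>i\<^sup>* T\<^sup>*\<^sup>k h\<close> by the identity for \<open>D T\<^sub>i\<^sup>*\<close>, applied to \<open>T\<^sup>*\<^sup>k h\<close>.\<close>

lemma cinner_V_J:
  assumes i: "i \<in> {1..n}" and x: "x \<in> K"
  shows "cinner (V i x) (J h) = cinner x (J (adj UNIV (T i) h))"
proof -
  let ?x = "Rep_ell2 x" and ?h = "\<lambda>k. D ((Tstar ^^ k) h)"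
  have xE: "?x k \<in> E" "prev ?x k \<in> E" for k by (simp_all add: K_Rep[OF x] prev_mem)
  have comm: "(Tstar ^^ k) (adj UNIV (T i) h) = adj UNIV (T i) ((Tstar ^^ k) h)" for k
    by (induction k) (simp_all add: Tstar_adj_T[OF i])
  have "cinner (?x k) (D ((Tstar ^^ k) (adj UNIV (T i) h)))
      = cinner (A i (?x k)) (?h k) + cinner (B i (?x k)) (?h (Suc k))" for k
    unfolding comm data_D[OF i] As_def[symmetric] Bs_def[symmetric]
    by (simp add: cinner_add_right AB_adjoint[OF i] xE D_mem)
  then have s: "(\<lambda>k. cinner (A i (?x k)) (?h k) + cinner (B i (?x k)) (?h (Suc k))) sums cinner x (J (adj UNIV (T i) h))"
    using cinner_ell2_sums[of x "J (adj UNIV (T i) h)"] by (simp add: Rep_J)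
  have "summable (\<lambda>k. (norm (A i (?x k)))\<^sup>2)"
    by (rule summable_comparison_test'[OF summable_ell2[of x], of 0])
      (use norm_AB[OF i K_Rep[OF x]] zero_le_power2 in \<open>smt (verit) real_norm_def\<close>)
  then have a: "summable (\<lambda>k. cinner (A i (?x k)) (?h k))"
    using summable_ell2[of "J h"] by (intro square_summable_cinner) (simp_all add: Rep_J)
  define sa where "sa = (\<Sum>k. cinner (A i (?x k)) (?h k))"
  have sa: "(\<lambda>k. cinner (A i (?x k)) (?h k)) sums sa" unfolding sa_def by (rule summable_sums[OF a])
  have "(\<lambda>k. cinner (B i (prev ?x (Suc k))) (?h (Suc k))) sums (cinner x (J (adj UNIV (T i) h)) - sa)"
    using sums_diff[OF s sa] by simp
  then have "(\<lambda>k. cinner (B i (prev ?x k)) (?h k)) sums (cinner x (J (adj UNIV (T i) h)) - sa)"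
    by (subst (asm) sums_Suc_iff) (simp add: AB_0[OF i])
  from sums_add[OF sa this]
  have "(\<lambda>k. cinner (Rep_ell2 (V i x) k) (Rep_ell2 (J h) k)) sums cinner x (J (adj UNIV (T i) h))"
    by (simp add: Rep_V[OF i x] Rep_J cinner_add_left)
  then show ?thesis using sums_unique2[OF cinner_ell2_sums] by blast
qed

lemma cinner_V_pow_J:
  assumes i: "i \<in> {1..n}" and x: "x \<in> K"
  shows "cinner ((V i ^^ k) x) (J h) = cinner x (J ((adj UNIV (T i) ^^ k) h))"
  using x
proof (induction k arbitrary: h)
  case (Suc k)
  have "cinner ((V i ^^ Suc k) x) (J h) = cinner ((V i ^^ k) x) (J (adj UNIV (T i) h))"
    using V.pow_mem[OF i Suc.prems] by (simp add: cinner_V_J[OF i])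
  then show ?case using Suc by (simp add: funpow_swap1)
qed simp

lemma cinner_T_pow:
  assumes i: "i \<in> {1..n}"
  shows "cinner ((T i ^^ k) x) h = cinner x ((adj UNIV (T i) ^^ k) h)"
proof (induction k arbitrary: h)
  case (Suc k)
  have "cinner ((T i ^^ Suc k) x) h = cinner ((T i ^^ k) x) (adj UNIV (T i) h)"
    by (simp add: cinner_adj_right T_bop[OF i])
  then show ?case using Suc by (simp add: funpow_swap1)
qed simp

lemma cinner_monomial: "cinner (monomial n V k (J h)) (J g) = cinner (monomial n T k h) g"
proof -
  have *: "cinner (oprod (\<lambda>i. V i ^^ k i) is (J h)) (J g) = cinner (oprod (\<lambda>i. T i ^^ k i) is h) g"
    if "set is \<subseteq> {1..n}" for "is"
    using that
  proof (induction "is" arbitrary: g)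
    case Nil
    then show ?case by (simp add: cinner_J)
  next
    case (Cons i "is")
    then have i: "i \<in> {1..n}" by simp
    have "j \<in> {1..n}" if "j \<in> set is" for j using Cons.prems that by auto
    then have "oprod (\<lambda>i. V i ^^ k i) is (J h) \<in> K"
      by (rule oprod_mem[OF V.pow_mem]) (simp_all add: J_mem)
    then show ?case
      using Cons by (simp add: cinner_V_pow_J[OF i] cinner_T_pow[OF i])
  qed
  show ?thesis unfolding monomial_def by (rule *) auto
qed

lemma range_J_closed: "closed_csubspace (range J)"
  by (rule closed_csubspace_isometric_image) (simp_all add: J_linear norm_J)

lemma monomial_proj: "J (monomial n T k h) = proj_onto (range J) (monomial n V k (J h))"
proof (rule proj_onto_eqI[OF range_J_closed, symmetric])
  fix z assume "z \<in> range J"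
  then obtain g where "z = J g" by blast
  then show "cinner (monomial n V k (J h) - J (monomial n T k h)) z = 0"
    by (simp add: cinner_diff_left cinner_monomial cinner_J)
qed simp

lemma linear_J: "Vector_Spaces.linear scaleC scaleC J"
  by unfold_locales (rule J_linear)+

lemma dilation: "isometric_dilation K J n V T"
  unfolding isometric_dilation_def monomial_def[symmetric]
  using K_closed linear_J norm_J J_mem V_isometry V_commuting monomial_proj
  by (auto simp: closed_csubspace_def)

lemma product_monomial: "oprod V [1..<Suc n] = monomial n V (\<lambda>_. 1)"
  by (simp only: monomial_1)

lemma product_mem: "x \<in> K \<Longrightarrow> oprod V [1..<Suc n] x \<in> K"
  unfolding product_monomial by (rule V.monomial_mem)

lemma Rep_product_pow:
  assumes "x \<in> K"
  shows "Rep_ell2 ((oprod V [1..<Suc n] ^^ m) x) k = (if k < m then 0 else Rep_ell2 x (k - m))"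
proof (induction m arbitrary: k)
  case (Suc m)
  have "Rep_ell2 ((oprod V [1..<Suc n] ^^ Suc m) x) k = prev (Rep_ell2 ((oprod V [1..<Suc n] ^^ m) x)) k"
    using Rep_product[OF funpow_mem[of K, OF product_mem assms]] by (simp del: upt_Suc)
  then show ?case using Suc by (cases k) (simp_all del: upt_Suc)
qed simp

lemma cinner_singleton:
  assumes "\<And>j. Rep_ell2 y j = (if j = k then e else 0)"
  shows "cinner x y = cinner (Rep_ell2 x k) e"
proof -
  have "(\<lambda>j. if j = k then cinner (Rep_ell2 x j) e else 0) sums cinner (Rep_ell2 x k) e"
    by (rule sums_single)
  moreover have "(\<lambda>j. if j = k then cinner (Rep_ell2 x j) e else 0) = (\<lambda>j. cinner (Rep_ell2 x j) (Rep_ell2 y j))"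
    by (auto simp: assms)
  ultimately show ?thesis using sums_unique2[OF cinner_ell2_sums] by metis
qed

text \<open>The vector \<open>V\<^sup>k (J h - V J T\<^sup>* h)\<close> has \<open>D h\<close> as its \<open>k\<close>-th entry and is \<open>0\<close> elsewhere, so a vector orthogonal to the
  closed span has all its entries orthogonal to the range of \<open>D\<close>.\<close>

lemma minimal: "minimal_isometric_dilation K J (restrict (oprod V [1..<Suc n]) K) Tprod"
proof -
  let ?S = "oprod V [1..<Suc n]"
  let ?G = "{(restrict ?S K ^^ k) (J h) | k h. True}"
  have pow: "(restrict ?S K ^^ k) (J h) = (?S ^^ k) (J h)" for k h
    using restrict_funpow[OF product_mem J_mem] .
  have "?S \<in> {f. isometric_on K f}"
    unfolding product_monomial using isometric_on_monomial[of n K V] V_isometry by (simp add: isometries_iff)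
  then have iso: "restrict ?S K \<in> isometries K"
    by (intro isometric_on_restrict K_closed) simp
  have "J ((Tprod ^^ k) h) = proj_onto (range J) ((restrict ?S K ^^ k) (J h))" for k h
    unfolding pow V.product_pow[OF J_mem] oprod_T[symmetric] T.product_pow[OF UNIV_I] by (rule monomial_proj)
  then have "isometric_dilation K J 1 (\<lambda>_. restrict ?S K) (\<lambda>_. Tprod)"
    using K_closed linear_J norm_J J_mem iso
    by (intro isometric_dilation_single) (auto simp: closed_csubspace_def)
  moreover have "closure (cspan ?G) = K"
  proof (rule closed_csubspace_eqI[OF closed_csubspace_closure[OF cvec.subspace_span] K_closed])
    have GK: "?G \<subseteq> K"
      using pow funpow_mem[of K ?S, OF product_mem J_mem] by auto
    have "cspan ?G \<subseteq> K"
      using K_closed GK by (intro cvec.span_minimal) (auto simp: closed_csubspace_def)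
    then show "closure (cspan ?G) \<subseteq> K"
      by (intro closure_minimal closed_csubspaceD[OF K_closed])
    fix x assume x: "x \<in> K" and ortho: "\<And>z. z \<in> closure (cspan ?G) \<Longrightarrow> cinner x z = 0"
    have G0: "cinner x ((?S ^^ k) (J h)) = 0" for k h
    proof -
      have "(?S ^^ k) (J h) \<in> ?G" unfolding pow[symmetric] by blast
      then show ?thesis by (intro ortho subsetD[OF closure_subset] cvec.span_base)
    qed
    have "cinner (Rep_ell2 x k) (D h) = 0" for k h
    proof -
      let ?y = "(?S ^^ k) (J h) - (?S ^^ Suc k) (J (Tstar h))"
      have "Rep_ell2 ?y j = (if j = k then D h else 0)" for j
      proof -
        have "(Tstar ^^ (j - Suc k)) (Tstar h) = (Tstar ^^ (j - k)) h" if "k < j"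
          using that funpow_swap1[of Tstar "j - Suc k" h] Suc_diff_Suc[OF that]
          by (metis funpow.simps(2) o_apply)
        then show ?thesis
          unfolding Rep_ell2_diff Rep_product_pow[OF J_mem] Rep_J by auto
      qed
      from cinner_singleton[OF this, of x] show ?thesis
        unfolding cinner_diff_right G0 by simp
    qed
    then have "Rep_ell2 x k = 0" for k
      by (intro E_eq_0 K_Rep x)
    then show "x = 0" by (intro ell2_eqI) (simp add: Rep_ell2_0)
  qed
  ultimately show ?thesis by (simp add: minimal_isometric_dilation_def del: upt_Suc)
qed

end


section \<open>Uniqueness of the projections and unitaries\<close>

context dilation_model
begin

lemma Rep_J_diff:
  "Rep_ell2 (J g - oprod V [1..<Suc n] (J (Tstar g))) k = (if k = 0 then D g else 0)"
  unfolding Rep_ell2_diff Rep_product[OF J_mem] by (cases k) (simp_all add: Rep_J funpow_swap1)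

lemma cinner_V_product:
  assumes i: "i \<in> {1..n}" and "x \<in> K" "y \<in> K"
  shows "cinner (V i x) (oprod V [1..<Suc n] y) = cinner x (cofactor n V i y)"
proof -
  have y: "cofactor n V i y \<in> K" unfolding cofactor_def by (rule V.monomial_mem[OF assms(3)])
  have "cinner (V i x) (V i (cofactor n V i y)) = cinner x (cofactor n V i y)"
    using V_isometry[OF i] assms(2) y by (intro isometric_on_cinner[OF _ K_closed]) (simp_all add: isometries_iff)
  then show ?thesis by (simp only: V.factor_cofactor[OF i assms(3)] product_monomial)
qed

lemma cinner_J_monomial: "cinner (J h) (monomial n V k (J g)) = cinner h (monomial n T k g)"
  using cinner_monomial[of k g h] by (metis cinner_commute)

text \<open>The right-hand side does not involve \<open>P\<close> and \<open>U\<close>. It is the inner product of \<open>V\<^sub>i J h\<close>, with initial entry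
  \<open>A\<^sub>i D h\<close>, and of \<open>J g - V J T\<^sup>* g\<close>, with the single entry \<open>D g\<close>.\<close>

lemma A_determined:
  assumes i: "i \<in> {1..n}"
  shows "cinner (A i (D h)) (D g) = cinner (T i h) g - cinner h (cofactor n T i (Tstar g))"
proof -
  let ?S = "oprod V [1..<Suc n]"
  let ?y = "J g - ?S (J (Tstar g))"
  from cinner_singleton[OF Rep_J_diff, of "V i (J h)" g]
  have "cinner (A i (D h)) (D g) = cinner (V i (J h)) ?y"
    by (simp add: Rep_V[OF i J_mem] Rep_J AB_0[OF i] del: upt_Suc)
  also have "\<dots> = cinner (V i (J h)) (J g) - cinner (J h) (cofactor n V i (J (Tstar g)))"
    unfolding cinner_diff_right cinner_V_product[OF i J_mem J_mem] ..
  also have "cinner (V i (J h)) (J g) = cinner (T i h) g"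
    using cinner_monomial[of "\<lambda>j. if j = i then 1 else 0" h g]
    unfolding V.monomial_single[OF i] T.monomial_single[OF i] .
  finally show ?thesis by (simp add: cofactor_def cinner_J_monomial)
qed

text \<open>The same with \<open>V (J g - V J T\<^sup>* g)\<close>, which has its single entry \<open>D g\<close> one place further. The term in
  \<open>A i\<close> is known by the previous lemma.\<close>

lemma B_determined:
  assumes i: "i \<in> {1..n}"
  shows "cinner (B i (D h)) (D g) =
    cinner h (cofactor n T i g) - cinner h (cofactor n T i (Tprod (Tstar g))) - cinner (A i (D (Tstar h))) (D g)"
proof -
  let ?S = "oprod V [1..<Suc n]"
  let ?z = "J g - ?S (J (Tstar g))"
  let ?y = "?S ?z"
  have z: "?z \<in> K" by (intro closed_csubspaceD[OF K_closed] J_mem product_mem)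
  have "Rep_ell2 ?y k = (if k = 1 then D g else 0)" for k
    unfolding Rep_product[OF z] using Rep_J_diff[of g "k - 1"] by (cases k) simp_all
  from cinner_singleton[OF this, of "V i (J h)"]
  have "cinner (A i (D (Tstar h))) (D g) + cinner (B i (D h)) (D g) = cinner (V i (J h)) ?y"
    by (simp add: Rep_V[OF i J_mem] Rep_J cinner_add_left del: upt_Suc)
  also have "\<dots> = cinner (J h) (cofactor n V i ?z)"
    by (rule cinner_V_product[OF i J_mem z])
  also have "cofactor n V i ?z = cofactor n V i (J g) - cofactor n V i (?S (J (Tstar g)))"
  proof -
    have "isometric_on K (cofactor n V i)"
      unfolding cofactor_def using V_isometry by (intro isometric_on_monomial) (simp add: isometries_iff)
    then show ?thesis by (rule isometric_on_diff[OF _ K_closed J_mem product_mem[OF J_mem]])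
  qed
  also have "cinner (J h) \<dots> = cinner h (cofactor n T i g) - cinner h (cofactor n T i (Tprod (Tstar g)))"
    unfolding cinner_diff_right cofactor_def product_monomial V.monomial_add[OF J_mem] cinner_J_monomial
      Tprod_def T.monomial_add[OF UNIV_I] ..
  finally show ?thesis by (simp add: algebra_simps)
qed

end

text \<open>The vectors \<open>D h\<close> are dense in \<open>E\<close>, so the matrix coefficients above fix \<open>A\<^sub>i = U\<^sub>i P\<^sub>i\<^sup>\<bottom>\<close> and \<open>B\<^sub>i = U\<^sub>i P\<^sub>i\<close>,
  and with them \<open>U\<^sub>i = A\<^sub>i + B\<^sub>i\<close> and \<open>P\<^sub>i = U\<^sub>i\<^sup>* B\<^sub>i\<close>.\<close>

lemma (in contraction_tuple) dilation_data_unique: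
  assumes "dilation_data n T P U" "dilation_data n T P' U'"
  shows "P = P'" "U = U'"
proof -
  interpret M: dilation_model n T P U by unfold_locales (rule assms)
  interpret M': dilation_model n T P' U' by unfold_locales (rule assms)
  have As: "M.As i (D g) = M'.As i (D g)" and Bs: "M.Bs i (D g) = M'.Bs i (D g)" if i: "i \<in> {1..n}" for i g
  proof -
    have A: "cinner (M.A i (D h)) (D g) = cinner (M'.A i (D h)) (D g)" for h g
      unfolding M.A_determined[OF i] M'.A_determined[OF i] ..
    have B: "cinner (M.B i (D h)) (D g) = cinner (M'.B i (D h)) (D g)" for h g
      unfolding M.B_determined[OF i] M'.B_determined[OF i] A ..
    have "M.As i (D g) - M'.As i (D g) = 0"
    proof (rule E_eq_0)
      show "cinner (M.As i (D g) - M'.As i (D g)) (D h) = 0" for h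
        using A[of h g] M.AB_adjoint(1)[OF i D_mem D_mem] M'.AB_adjoint(1)[OF i D_mem D_mem]
        by (subst cinner_eq_0_commute) (simp add: cinner_diff_right)
    qed (simp add: closed_csubspaceD[OF E_closed] M.AB_mem[OF i] M'.AB_mem[OF i] D_mem)
    then show "M.As i (D g) = M'.As i (D g)" by simp
    have "M.Bs i (D g) - M'.Bs i (D g) = 0"
    proof (rule E_eq_0)
      show "cinner (M.Bs i (D g) - M'.Bs i (D g)) (D h) = 0" for h
        using B[of h g] M.AB_adjoint(2)[OF i D_mem D_mem] M'.AB_adjoint(2)[OF i D_mem D_mem]
        by (subst cinner_eq_0_commute) (simp add: cinner_diff_right)
    qed (simp add: closed_csubspaceD[OF E_closed] M.AB_mem[OF i] M'.AB_mem[OF i] D_mem)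
    then show "M.Bs i (D g) = M'.Bs i (D g)" by simp
  qed
  have A: "M.A i e = M'.A i e" and B: "M.B i e = M'.B i e" if i: "i \<in> {1..n}" and e: "e \<in> E" for i e
  proof -
    have "M.A i e - M'.A i e = 0"
      by (rule E_eq_0)
        (simp_all add: closed_csubspaceD[OF E_closed] M.AB_mem[OF i] M'.AB_mem[OF i] e cinner_diff_left
          M.AB_adjoint[OF i] M'.AB_adjoint[OF i] D_mem As[OF i])
    then show "M.A i e = M'.A i e" by simp
    have "M.B i e - M'.B i e = 0"
      by (rule E_eq_0)
        (simp_all add: closed_csubspaceD[OF E_closed] M.AB_mem[OF i] M'.AB_mem[OF i] e cinner_diff_left
          M.AB_adjoint[OF i] M'.AB_adjoint[OF i] D_mem Bs[OF i])
    then show "M.B i e = M'.B i e" by simp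
  qed
  have U: "U i = U' i" if i: "i \<in> {1..n}" for i
    by (rule bop_eqI[OF bopD(2)[OF M.U_bop[OF i]] bopD(2)[OF M'.U_bop[OF i]]])
      (simp only: M.AB_add[OF i, symmetric] M'.AB_add[OF i, symmetric] A[OF i] B[OF i])
  have P: "P i = P' i" if i: "i \<in> {1..n}" for i
  proof (rule bop_eqI[OF bopD(2)[OF M.P_bop[OF i]] bopD(2)[OF M'.P_bop[OF i]]])
    fix e assume e: "e \<in> E"
    have "M.Ustar i (M.B i e) = M'.Ustar i (M'.B i e)"
      by (simp add: M.Ustar_def M'.Ustar_def U[OF i] B[OF i e])
    then show "P i e = P' i e"
      by (simp add: M.B_def M'.B_def M.Ustar_U[OF i] M'.Ustar_U[OF i] M.P_mem[OF i] M'.P_mem[OF i] e)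
  qed
  show "P = P'" by (rule extensionalityI[OF M.extensional_PU(1) M'.extensional_PU(1)]) (rule P)
  show "U = U'" by (rule extensionalityI[OF M.extensional_PU(2) M'.extensional_PU(2)]) (rule U)
qed


section \<open>The characterization\<close>

theorem theorem4p1:
  fixes n :: nat and T :: "nat \<Rightarrow> 'a::chilbert_space \<Rightarrow> 'a"
  assumes "n \<ge> 1"
    and "\<forall>i\<in>{1..n}. contraction (T i)"
    and "commuting UNIV n T"
    and "C_dot_zero (oprod T [1..<Suc n])"
  shows "(has_minimal_product_dilation TYPE('k::chilbert_space) n T \<longrightarrow>
            (\<exists>!PU. dilation_data n T (fst PU) (snd PU))) \<and>
         ((\<exists>!PU. dilation_data n T (fst PU) (snd PU)) \<longrightarrow>
            has_minimal_product_dilation TYPE('a ell2) n T)"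
proof (intro conjI impI)
  interpret contraction_tuple n T by unfold_locales (rule assms)+
  assume "has_minimal_product_dilation TYPE('k) n T"
  then obtain K :: "'k set" and J V where dil: "isometric_dilation K J n V T"
    "minimal_isometric_dilation K J (restrict (oprod V [1..<Suc n]) K) (oprod T [1..<Suc n])"
    unfolding has_minimal_product_dilation_def by blast
  interpret product_dilation n T K J V by unfold_locales (rule dil)+
  obtain L where "wandering_embedding n T K J V L"
    using wandering_embedding_exists by blast
  then interpret wandering_embedding n T K J V L .
  show "\<exists>!PU. dilation_data n T (fst PU) (snd PU)"
  proof (rule ex1I)
    show "dilation_data n T (fst (P, U)) (snd (P, U))" using dilation_data_PU by simp
    show "PU = (P, U)" if "dilation_data n T (fst PU) (snd PU)" for PU
      using dilation_data_unique[OF that dilation_data_PU] by (simp add: prod_eq_iff)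
  qed
next
  interpret contraction_tuple n T by unfold_locales (rule assms)+
  assume "\<exists>!PU. dilation_data n T (fst PU) (snd PU)"
  then obtain P U where data: "dilation_data n T P U" by auto
  interpret dilation_model n T P U by unfold_locales (rule data)
  show "has_minimal_product_dilation TYPE('a ell2) n T"
    unfolding has_minimal_product_dilation_def
    using dilation minimal[folded oprod_T] by blast
qed

end
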